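(* Let $\Gamma\subset\mathrm{PSL}_2(\mathbb R)$ be any Fuchsian group of the first kind and suppose $E\in Q_2(\Gamma)$ is holomorphic on $\mathbb H$, including at every cusp, with $Q_1(E)=c\ne0$. Then for every $k\ge0$, with $J=\lfloor k/2\rfloor$, the multiplication map $$\mu:\bigoplus_{j=0}^JM_{k-2j}(\Gamma)\to Q_k(\Gamma),\qquad(h_j)_{0\le j\le J}\mapsto\sum_{j=0}^Jh_jE^j,$$ is a linear isomorphism. Equivalently, $Q(\Gamma)=M(\Gamma)[E]$ is a free polynomial ring in the single generator $E$ over the graded ring $M(\Gamma)$.
   Context: A Fuchsian group of the first kind is a finitely generated discrete subgroup of $\mathrm{PSL}_2(\mathbb R)$ of finite covolume; elements of $\Gamma$ are lifted to $\mathrm{SL}_2(\mathbb R)$ (full preimage). For $\gamma=\begin{pmatrix}a&b\\c&d\end{pmatrix}$: $j(\gamma,\tau)=c\tau+d$, $X(\gamma,\tau)=c/j(\gamma,\tau)$ (with $c$ the matrix entry), $f|_k\gamma(\tau)=j(\gamma,\tau)^{-k}f(\gamma\tau)$. $Q_k(\Gamma)$: holomorphic $f:\mathbb H\to\mathbb C$ for which there are $s\ge0$ and holomorphic $Q_0(f)=f,\dots,Q_s(f)$ on $\mathbb H$ with $f|_k\gamma(\tau)=\sum_{m=0}^sX(\gamma,\tau)^mQ_m(f)(\tau)$ for all $\gamma\in\Gamma$ (the $Q_m(f)$ are uniquely determined), holomorphic at the cusps: for every $\sigma\in\mathrm{SL}_2(\mathbb R)$ with $\sigma\infty$ a cusp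 and every $m$, $Q_m(f)|_{k-2m}\sigma$ is bounded as $\mathrm{Im}\,\tau\to\infty$, uniformly for $\mathrm{Re}\,\tau$ in compact sets. $M_k(\Gamma)\subset Q_k(\Gamma)$ is the subspace of $f$ with $f|_k\gamma=f$ for all $\gamma\in\Gamma$. $Q(\Gamma)=\bigoplus_{k\ge0}Q_k(\Gamma)$, $M(\Gamma)=\bigoplus_kM_k(\Gamma)$. The hypothesis $Q_1(E)=c$ means that $Q_1(E)$ is the nonzero constant $c$ and $E|_2\gamma=E+cX(\gamma,\tau)$. *)

theory Defs
  imports
    "HOL-Analysis.Analysis"
    "HOL-Library.Function_Algebras"
    "HOL-Algebra.Generated_Groups"
    "HOL-Algebra.QuotRing"
    "HOL-Algebra.Subrings"
    "HOL-Algebra.UnivPoly"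
begin

definition upper_half_plane :: "complex set" where
  "upper_half_plane = {\<tau>. 0 < Im \<tau>}"

definition SL2R :: "(real^2^2) monoid" where
  "SL2R = \<lparr>carrier = {A. det A = 1}, mult = (**), one = mat 1\<rparr>"

definition PSL2R :: "(real^2^2) set monoid" where
  "PSL2R = SL2R Mod {mat 1, - mat 1}"

text \<open>The elements of PSL2R are the cosets {A, -A}, so the full preimage in SL2R of a
  subset of PSL2R is the union of its members.\<close>

definition lift :: "(real^2^2) set set \<Rightarrow> (real^2^2) set" where
  "lift \<Gamma> = \<Union>\<Gamma>"

definition mob :: "real^2^2 \<Rightarrow> complex \<Rightarrow> complex" where
  "mob A = moebius (of_real (A$1$1)) (of_real (A$1$2)) (of_real (A$2$1)) (of_real (A$2$2))"

definition hyperbolic_area :: "complex measure" where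
  "hyperbolic_area = density lborel (\<lambda>\<tau>. ennreal (1 / (Im \<tau>)^2))"

definition fundamental_domain :: "(real^2^2) set set \<Rightarrow> complex set \<Rightarrow> bool" where
  "fundamental_domain \<Gamma> F \<longleftrightarrow>
     F \<in> sets borel \<and> F \<subseteq> upper_half_plane \<and>
     (\<forall>\<tau>\<in>upper_half_plane. \<exists>\<gamma>\<in>lift \<Gamma>. mob \<gamma> \<tau> \<in> F) \<and>
     (\<forall>\<gamma>\<in>lift \<Gamma> - {mat 1, - mat 1}. mob \<gamma> ` F \<inter> F \<in> null_sets hyperbolic_area)"

text \<open>Discreteness is stated for the preimage in SL2R; since SL2R is a two-fold covering of
  PSL2R, this is discreteness of the group itself.\<close>

definition fuchsian_first_kind :: "(real^2^2) set set \<Rightarrow> bool" where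
  "fuchsian_first_kind \<Gamma> \<longleftrightarrow>
     subgroup \<Gamma> PSL2R \<and>
     (\<exists>S. finite S \<and> S \<subseteq> carrier PSL2R \<and> generate PSL2R S = \<Gamma>) \<and>
     discrete (lift \<Gamma>) \<and>
     (\<exists>F. fundamental_domain \<Gamma> F \<and> emeasure hyperbolic_area F < \<infinity>)"

definition parabolic :: "real^2^2 \<Rightarrow> bool" where
  "parabolic A \<longleftrightarrow> det A = 1 \<and> \<bar>trace A\<bar> = 2 \<and> A \<noteq> mat 1 \<and> A \<noteq> - mat 1"

text \<open>Boundary points are given by homogeneous coordinates: a nonzero vector \<open>v\<close> stands for the
  point \<open>v$1 / v$2\<close> of the real projective line, and \<open>\<infinity>\<close> is the point of \<open>axis 1 1\<close>.
  A cusp is a boundary point fixed by a parabolic element.\<close>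

definition cusp :: "(real^2^2) set set \<Rightarrow> real^2 \<Rightarrow> bool" where
  "cusp \<Gamma> v \<longleftrightarrow> v \<noteq> 0 \<and> (\<exists>\<gamma>\<in>lift \<Gamma>. parabolic \<gamma> \<and> (\<exists>t. \<gamma> *v v = t *\<^sub>R v))"

definition j :: "real^2^2 \<Rightarrow> complex \<Rightarrow> complex" where
  "j A \<tau> = of_real (A$2$1) * \<tau> + of_real (A$2$2)"

definition X :: "real^2^2 \<Rightarrow> complex \<Rightarrow> complex" where
  "X A \<tau> = of_real (A$2$1) / j A \<tau>"

definition slash :: "int \<Rightarrow> real^2^2 \<Rightarrow> (complex \<Rightarrow> complex) \<Rightarrow> complex \<Rightarrow> complex" where
  "slash k A f \<tau> = j A \<tau> powi (- k) * f (mob A \<tau>)"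

definition bounded_at_cusps ::
  "(real^2^2) set set \<Rightarrow> int \<Rightarrow> (complex \<Rightarrow> complex) \<Rightarrow> bool" where
  "bounded_at_cusps \<Gamma> k f \<longleftrightarrow>
     (\<forall>\<sigma>\<in>carrier SL2R. cusp \<Gamma> (\<sigma> *v axis 1 1) \<longrightarrow>
        (\<forall>K. compact K \<longrightarrow>
           (\<exists>Y>0. \<exists>B. \<forall>\<tau>. Re \<tau> \<in> K \<and> Im \<tau> > Y \<longrightarrow> cmod (slash k \<sigma> f \<tau>) \<le> B)))"

text \<open>\<open>Q m\<close> for \<open>m \<le> s\<close> plays the role of the coefficient function usually written
  \<open>Q\<^sub>m(f)\<close>.\<close>

definition quasimodular_coeffs ::
  "(real^2^2) set set \<Rightarrow> int \<Rightarrow> (complex \<Rightarrow> complex) \<Rightarrow> nat \<Rightarrow>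
   (nat \<Rightarrow> complex \<Rightarrow> complex) \<Rightarrow> bool" where
  "quasimodular_coeffs \<Gamma> k f s Q \<longleftrightarrow>
     (\<forall>\<tau>\<in>upper_half_plane. Q 0 \<tau> = f \<tau>) \<and>
     (\<forall>m\<le>s. Q m holomorphic_on upper_half_plane) \<and>
     (\<forall>\<gamma>\<in>lift \<Gamma>. \<forall>\<tau>\<in>upper_half_plane. slash k \<gamma> f \<tau> = (\<Sum>m\<le>s. X \<gamma> \<tau> ^ m * Q m \<tau>)) \<and>
     (\<forall>m\<le>s. bounded_at_cusps \<Gamma> (k - 2 * int m) (Q m))"

text \<open>A function on the upper half-plane is represented by the total function that extends it
  by zero, so that equality of elements is equality of functions on the half-plane.\<close>

definition Q_space :: "(real^2^2) set set \<Rightarrow> int \<Rightarrow> (complex \<Rightarrow> complex) set" where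
  "Q_space \<Gamma> k =
     {f. (\<forall>\<tau>. \<tau> \<notin> upper_half_plane \<longrightarrow> f \<tau> = 0) \<and> f holomorphic_on upper_half_plane \<and>
         (\<exists>s Q. quasimodular_coeffs \<Gamma> k f s Q)}"

definition M_space :: "(real^2^2) set set \<Rightarrow> int \<Rightarrow> (complex \<Rightarrow> complex) set" where
  "M_space \<Gamma> k =
     {f \<in> Q_space \<Gamma> k. \<forall>\<gamma>\<in>lift \<Gamma>. \<forall>\<tau>\<in>upper_half_plane. slash k \<gamma> f \<tau> = f \<tau>}"

definition fun_scale :: "complex \<Rightarrow> (complex \<Rightarrow> complex) \<Rightarrow> complex \<Rightarrow> complex" where
  "fun_scale a f = (\<lambda>\<tau>. a * f \<tau>)"

definition fam_scale ::
  "complex \<Rightarrow> (nat \<Rightarrow> complex \<Rightarrow> complex) \<Rightarrow> nat \<Rightarrow> complex \<Rightarrow> complex" where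
  "fam_scale a h = (\<lambda>i. fun_scale a (h i))"

definition M_sum :: "(real^2^2) set set \<Rightarrow> nat \<Rightarrow> nat \<Rightarrow> (nat \<Rightarrow> complex \<Rightarrow> complex) set" where
  "M_sum \<Gamma> k J = {h. (\<forall>i\<le>J. h i \<in> M_space \<Gamma> (int k - 2 * int i)) \<and> (\<forall>i>J. h i = 0)}"

definition mult_map ::
  "(complex \<Rightarrow> complex) \<Rightarrow> nat \<Rightarrow> (nat \<Rightarrow> complex \<Rightarrow> complex) \<Rightarrow> complex \<Rightarrow> complex" where
  "mult_map E J h = (\<lambda>\<tau>. \<Sum>i\<le>J. h i \<tau> * E \<tau> ^ i)"

text \<open>The graded rings are external direct sums: an element is the finitely supported family
  of its homogeneous components, and multiplication is convolution. The unit is the constant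
  function 1 in weight 0.\<close>

definition Q_ring :: "(real^2^2) set set \<Rightarrow> (nat \<Rightarrow> complex \<Rightarrow> complex) ring" where
  "Q_ring \<Gamma> =
     \<lparr>carrier = {F. (\<forall>k. F k \<in> Q_space \<Gamma> (int k)) \<and> finite {k. F k \<noteq> 0}},
      mult = (\<lambda>F G n \<tau>. \<Sum>i\<le>n. F i \<tau> * G (n - i) \<tau>),
      one = (\<lambda>n \<tau>. if n = 0 \<and> \<tau> \<in> upper_half_plane then 1 else 0),
      zero = (\<lambda>n \<tau>. 0),
      add = (\<lambda>F G n \<tau>. F n \<tau> + G n \<tau>)\<rparr>"

definition M_ring :: "(real^2^2) set set \<Rightarrow> (nat \<Rightarrow> complex \<Rightarrow> complex) ring" where
  "M_ring \<Gamma> =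
     Q_ring \<Gamma>
       \<lparr>carrier := {F. (\<forall>k. F k \<in> M_space \<Gamma> (int k)) \<and> finite {k. F k \<noteq> 0}}\<rparr>"

definition homogeneous :: "nat \<Rightarrow> (complex \<Rightarrow> complex) \<Rightarrow> nat \<Rightarrow> complex \<Rightarrow> complex" where
  "homogeneous k f = (\<lambda>n. if n = k then f else 0)"

end

theory Submission
  imports Defs "HOL-Complex_Analysis.Conformal_Mappings"
begin

text \<open>
  For \<open>\<gamma> \<in> lift \<Gamma>\<close> the hypothesis on \<open>E\<close> says \<open>E|\<gamma> = E + c X(\<gamma>, -)\<close>. This is affine in \<open>X\<close>, so a
  transformation law \<open>f|\<gamma> = (\<Sum>m. X(\<gamma>, -)\<^sup>m Q\<^sub>m)\<close> can be rewritten as \<open>f|\<gamma> = (\<Sum>i. h\<^sub>i (E|\<gamma>)\<^sup>i)\<close>, with \<open>h\<^sub>i\<close>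
  the coefficient of \<open>Z\<^sup>i\<close> in \<open>(\<Sum>m. Q\<^sub>m ((Z - E)/c)\<^sup>m)\<close>. Taking \<open>\<gamma> = 1\<close> gives \<open>f = (\<Sum>i. h\<^sub>i E\<^sup>i)\<close>. Applying a
  further \<open>\<delta>\<close> gives \<open>(\<Sum>i. (h\<^sub>i|\<delta>) (E|\<gamma>\<delta>)\<^sup>i) = (\<Sum>i. h\<^sub>i (E|\<gamma>\<delta>)\<^sup>i)\<close> for all \<open>\<gamma>\<close>, and if \<open>X(-, \<tau>)\<close> takes
  infinitely many values these are two polynomials that agree at infinitely many points, so
  \<open>h\<^sub>i|\<delta> = h\<^sub>i\<close>: every \<open>h\<^sub>i\<close> is modular, of weight \<open>k - 2i\<close> (\<open>E_expansion\<close>). The same comparison shows that the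
  \<open>h\<^sub>i\<close> are unique (\<open>mult_map_injective\<close>). The ring isomorphism collects this over all weights.

  Two facts about \<open>\<Gamma>\<close> are behind this, and both come from its finite covolume: \<open>X(-, \<tau>)\<close> takes infinitely
  many values (\<open>infinite_X_values\<close>), and there are no nonzero modular forms of negative weight
  (\<open>negative_weight_vanishes\<close>), so that the sum stops at \<open>i = k/2\<close>. The area enters through one
  inequality (\<open>area_le_of_bounded_multiplicity\<close>): if the translates of \<open>F\<close> cover the half-plane and every
  point lies in at most \<open>N\<close> translates of \<open>W\<close>, then \<open>area W \<le> N area F\<close>.

  If \<open>X(-, \<tau>)\<close> had finitely many values, the bottom rows of \<open>\<Gamma>\<close> would lie on finitely many lines, and finitely
  many translates of a fundamental domain would cover the half-plane modulo the affine maps in \<open>\<Gamma>\<close>. The vertical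
  stretch commutes with affine maps and rescales area, so there would be such covers of arbitrarily
  small area, which contradicts the inequality.

  For \<open>f\<close> of weight \<open>-w < 0\<close> the function \<open>|f|\<^sup>2 / y\<^sup>w\<close> is \<open>\<Gamma>\<close>-invariant and has no positive local maximum, so it is
  enough to bound it by its value at some point. Call a point thick if no nontrivial element
  of \<open>\<Gamma>\<close> is close to the identity there. The inequality shows that the thick part is compact modulo
  \<open>\<Gamma>\<close> (\<open>thick_part_compact_mod_G\<close>), which gives a bound there. A thin point lies in a region that belongs to a
  single element of \<open>\<Gamma>\<close> and has thick boundary (\<open>thin_component\<close>, by the commutator argument of Zassenhaus). On
  such a region the maximum principle extends the bound from the boundary to the interior
  (\<open>petersson_le_on_thin_component\<close>): it is compact, or compact modulo a hyperbolic element, or a horodisc at a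
  cusp, where the growth condition applies.
\<close>

section \<open>Real two-by-two matrices and their action on the upper half-plane\<close>

lemma mat2_eq_iff:
  fixes A B :: "real^2^2"
  shows "A = B \<longleftrightarrow> A$1$1 = B$1$1 \<and> A$1$2 = B$1$2 \<and> A$2$1 = B$2$1 \<and> A$2$2 = B$2$2"
  unfolding vec_eq_iff forall_2 conj_assoc by (rule refl)

lemma mat2_mult_entries [simp]:
  fixes A B :: "real^2^2"
  shows "(A ** B)$i$k = A$i$1 * B$1$k + A$i$2 * B$2$k"
  by (simp add: matrix_matrix_mult_def sum_2)

lemma mat2_one_entries [simp]:
  "(mat 1 :: real^2^2)$1$1 = 1" "(mat 1 :: real^2^2)$1$2 = 0"
  "(mat 1 :: real^2^2)$2$1 = 0" "(mat 1 :: real^2^2)$2$2 = 1"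
  by (simp_all add: mat_def)

definition mat2 :: "real \<Rightarrow> real \<Rightarrow> real \<Rightarrow> real \<Rightarrow> real^2^2" where
  "mat2 a b c d = vector [vector [a, b], vector [c, d]]"

lemma mat2_entries [simp]:
  "(mat2 a b c d)$1$1 = a" "(mat2 a b c d)$1$2 = b"
  "(mat2 a b c d)$2$1 = c" "(mat2 a b c d)$2$2 = d"
  by (simp_all add: mat2_def vector_2)

text \<open>The adjugate is the inverse in \<open>SL2R\<close>, without division and with the same norm.\<close>

definition adj :: "real^2^2 \<Rightarrow> real^2^2" where
  "adj A = mat2 (A$2$2) (- (A$1$2)) (- (A$2$1)) (A$1$1)"

lemma adj_entries [simp]:
  "adj A $1$1 = A$2$2" "adj A $1$2 = - (A$1$2)" "adj A $2$1 = - (A$2$1)" "adj A $2$2 = A$1$1"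
  by (simp_all add: adj_def)

lemma trace_2: "trace (A :: real^2^2) = A$1$1 + A$2$2"
  by (simp add: trace_def sum_2)

lemma det_one_entries: "det (A :: real^2^2) = 1 \<Longrightarrow> A$1$1 * A$2$2 = 1 + A$1$2 * A$2$1"
  by (simp add: det_2)

lemma det_adj [simp]: "det (adj A) = det A"
  by (simp add: det_2)

lemma adj_adj [simp]: "adj (adj A) = A"
  by (simp add: mat2_eq_iff)

lemma adj_mult: "adj (A ** B) = adj B ** adj A"
  by (simp add: mat2_eq_iff)

lemma adj_mat_1 [simp]: "adj (mat 1) = mat 1"
  by (simp add: mat2_eq_iff)

lemma mult_adj:
  assumes "det A = 1"
  shows "A ** adj A = mat 1" "adj A ** A = mat 1"
  using det_one_entries[OF assms] by (simp_all add: mat2_eq_iff algebra_simps)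

lemma mult_adj_assoc:
  assumes "det A = 1"
  shows "A ** (adj A ** B) = B" "adj A ** (A ** B) = B" "B ** A ** adj A = B" "B ** adj A ** A = B"
  using mult_adj[OF assms] by (metis matrix_mul_assoc matrix_mul_lid matrix_mul_rid)+

lemma j_nonzero:
  assumes "det A = 1" "0 < Im \<tau>"
  shows "j A \<tau> \<noteq> 0"
proof
  assume "j A \<tau> = 0"
  then have "A$2$1 * Im \<tau> = 0" "A$2$1 * Re \<tau> + A$2$2 = 0"
    by (auto simp: j_def complex_eq_iff)
  then have "A$2$1 = 0" "A$2$2 = 0" using assms by auto
  then show False using assms by (simp add: det_2)
qed

lemma mob_eq: "mob A \<tau> = (of_real (A$1$1) * \<tau> + of_real (A$1$2)) / j A \<tau>"
  by (simp add: mob_def moebius_def j_def)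

lemma Im_mob:
  assumes "det A = 1" "0 < Im \<tau>"
  shows "Im (mob A \<tau>) = Im \<tau> / (cmod (j A \<tau>))\<^sup>2"
proof -
  let ?a = "A$1$1" and ?b = "A$1$2" and ?c = "A$2$1" and ?d = "A$2$2"
  have "Im (mob A \<tau>) = ((?a * Im \<tau>) * (?c * Re \<tau> + ?d) - (?a * Re \<tau> + ?b) * (?c * Im \<tau>)) / (cmod (j A \<tau>))\<^sup>2"
    by (simp add: mob_eq Im_divide j_def cmod_power2)
  also have "(?a * Im \<tau>) * (?c * Re \<tau> + ?d) - (?a * Re \<tau> + ?b) * (?c * Im \<tau>) = Im \<tau> * (?a * ?d - ?b * ?c)"
    by (simp add: algebra_simps)
  also have "?a * ?d - ?b * ?c = 1" using assms by (simp add: det_2)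
  finally show ?thesis by simp
qed

lemma Im_mob_pos: "det A = 1 \<Longrightarrow> 0 < Im \<tau> \<Longrightarrow> 0 < Im (mob A \<tau>)"
  by (simp add: Im_mob j_nonzero)

lemma j_mult:
  assumes "det B = 1" "0 < Im \<tau>"
  shows "j (A ** B) \<tau> = j A (mob B \<tau>) * j B \<tau>"
  using j_nonzero[OF assms] by (simp add: mob_eq j_def[of A] field_simps) (simp add: j_def algebra_simps)

lemma mob_mult:
  assumes "det A = 1" "det B = 1" "0 < Im \<tau>"
  shows "mob (A ** B) \<tau> = mob A (mob B \<tau>)"
proof -
  have nz: "j B \<tau> \<noteq> 0" "j A (mob B \<tau>) \<noteq> 0"
    using assms j_nonzero Im_mob_pos by auto
  have "of_real (A$1$1) * mob B \<tau> + of_real (A$1$2)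
        = (of_real ((A**B)$1$1) * \<tau> + of_real ((A**B)$1$2)) / j B \<tau>"
    using nz(1) by (simp add: mob_eq[of B] field_simps) (simp add: j_def algebra_simps)
  then show ?thesis
    unfolding mob_eq[of "A**B"] mob_eq[of A] j_mult[OF assms(2,3)] using nz by (simp add: divide_simps)
qed

lemma mob_one [simp]: "mob (mat 1) \<tau> = \<tau>" and j_one [simp]: "j (mat 1) \<tau> = 1"
  by (simp_all add: mob_eq j_def)

lemma mob_adj:
  assumes "det A = 1" "0 < Im \<tau>"
  shows "mob (adj A) (mob A \<tau>) = \<tau>" "mob A (mob (adj A) \<tau>) = \<tau>"
  using mob_mult[of "adj A" A \<tau>] mob_mult[of A "adj A" \<tau>] assms by (simp_all add: mult_adj)

lemma norm_mat2_sq: "(norm (A :: real^2^2))\<^sup>2 = (A$1$1)\<^sup>2 + (A$1$2)\<^sup>2 + (A$2$1)\<^sup>2 + (A$2$2)\<^sup>2"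
  by (simp add: norm_vec_def L2_set_def sum_2)

text \<open>The norm of a nested vector is the Frobenius norm; each entry is estimated by Cauchy-Schwarz.\<close>

lemma norm_mat2_mult: "norm ((A :: real^2^2) ** (B :: real^2^2)) \<le> norm A * norm B"
proof -
  have cs: "(x * u + y * v)\<^sup>2 \<le> (x\<^sup>2 + y\<^sup>2) * (u\<^sup>2 + v\<^sup>2)" for x y u v :: real
  proof -
    have "(x\<^sup>2 + y\<^sup>2) * (u\<^sup>2 + v\<^sup>2) - (x * u + y * v)\<^sup>2 = (x * v - y * u)\<^sup>2"
      by (simp add: power2_eq_square algebra_simps)
    then show ?thesis by (metis diff_ge_0_iff_ge zero_le_power2)
  qed
  have "(norm (A ** B))\<^sup>2 \<le>
     ((A$1$1)\<^sup>2 + (A$1$2)\<^sup>2) * ((B$1$1)\<^sup>2 + (B$2$1)\<^sup>2) + ((A$1$1)\<^sup>2 + (A$1$2)\<^sup>2) * ((B$1$2)\<^sup>2 + (B$2$2)\<^sup>2)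
     + ((A$2$1)\<^sup>2 + (A$2$2)\<^sup>2) * ((B$1$1)\<^sup>2 + (B$2$1)\<^sup>2) + ((A$2$1)\<^sup>2 + (A$2$2)\<^sup>2) * ((B$1$2)\<^sup>2 + (B$2$2)\<^sup>2)"
    unfolding norm_mat2_sq mat2_mult_entries by (intro add_mono cs)
  also have "\<dots> = (norm A * norm B)\<^sup>2"
    unfolding power_mult_distrib norm_mat2_sq by (simp add: algebra_simps)
  finally show ?thesis by (rule power2_le_imp_le) simp
qed

lemma norm_adj [simp]: "norm (adj A) = norm A"
proof -
  have "(norm (adj A))\<^sup>2 = (norm A)\<^sup>2" by (simp add: norm_mat2_sq)
  then show ?thesis by simp
qed

lemma norm_mat_1: "norm (mat 1 :: real^2^2) = sqrt 2"
  using norm_mat2_sq[of "mat 1"] by (simp add: real_sqrt_unique)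

section \<open>Hyperbolic area\<close>

lemma vec2_eq_iff: "(u :: 'a^2) = v \<longleftrightarrow> u$1 = v$1 \<and> u$2 = v$2"
  unfolding vec_eq_iff forall_2 by (rule refl)

text \<open>Cartesian coordinates, through which the change of variables formula for real vectors is applied.\<close>

definition vec_of_complex :: "complex \<Rightarrow> real^2" where
  "vec_of_complex z = vector [Re z, Im z]"

definition complex_of_vec :: "real^2 \<Rightarrow> complex" where
  "complex_of_vec v = Complex (v$1) (v$2)"

lemma vec_of_complex_of_vec [simp]: "vec_of_complex (complex_of_vec v) = v"
  and complex_of_vec_of_complex [simp]: "complex_of_vec (vec_of_complex z) = z"
  by (simp_all add: vec_of_complex_def complex_of_vec_def vec2_eq_iff vector_2)

lemma linear_complex_of_vec: "linear complex_of_vec" and linear_vec_of_complex: "linear vec_of_complex"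
  by (auto intro!: linearI simp: vec_of_complex_def complex_of_vec_def vec2_eq_iff vector_2 complex_eq_iff)

lemma Basis_real_2: "(Basis :: (real^2) set) = {axis 1 1, axis 2 1}"
  by (auto simp: Basis_vec_def UNIV_2)

lemma measurable_complex_of_vec [measurable]: "complex_of_vec \<in> borel \<rightarrow>\<^sub>M borel"
  using linear_complex_of_vec by (intro borel_measurable_continuous_onI linear_continuous_on linear_conv_bounded_linear[THEN iffD1])

lemma lborel_complex_eq_distr: "(lborel :: complex measure) = distr lborel borel complex_of_vec"
proof (rule lborel_eqI)
  fix l u :: complex
  assume le: "\<And>b. b \<in> Basis \<Longrightarrow> l \<bullet> b \<le> u \<bullet> b"
  have le': "Re l \<le> Re u" "Im l \<le> Im u"
    using le[of 1] le[of \<i>] by (auto simp: Basis_complex_def)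
  have vb: "complex_of_vec -` box l u = box (vec_of_complex l) (vec_of_complex u)"
    by (auto simp: box_def Basis_real_2 inner_axis vec_of_complex_def complex_of_vec_def Basis_complex_def vector_2)
  have "axis 1 1 \<noteq> (axis 2 1 :: real^2)" by (simp add: axis_eq_axis)
  then have "emeasure lborel (box (vec_of_complex l) (vec_of_complex u)) = ennreal ((Re u - Re l) * (Im u - Im l))"
    using le' by (subst emeasure_lborel_box)
       (auto simp: Basis_real_2 inner_axis vec_of_complex_def vector_2 prod_ennreal ennreal_mult)
  moreover have "(\<Prod>b\<in>Basis. (u - l) \<bullet> b) = (Re u - Re l) * (Im u - Im l)"
    by (simp add: Basis_complex_def complex_eq_iff)
  ultimately show "emeasure (distr lborel borel complex_of_vec) (box l u) = ennreal (\<Prod>b\<in>Basis. (u - l) \<bullet> b)"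
    by (subst emeasure_distr) (auto simp: vb)
qed simp

definition area :: "complex set \<Rightarrow> ennreal" where "area S = emeasure hyperbolic_area S"

lemma sets_hyperbolic_area [simp]: "sets hyperbolic_area = sets borel"
  and space_hyperbolic_area [simp]: "space hyperbolic_area = UNIV"
  by (simp_all add: hyperbolic_area_def)

lemma area_eq_nn_integral:
  assumes "S \<in> sets borel"
  shows "area S = (\<integral>\<^sup>+v. indicator (complex_of_vec -` S) v * ennreal (1 / (v$2)\<^sup>2) \<partial>lborel)"
proof -
  have "area S = (\<integral>\<^sup>+z. ennreal (1 / (Im z)\<^sup>2) * indicator S z \<partial>lborel)"
    unfolding area_def hyperbolic_area_def using assms by (subst emeasure_density) auto
  also have "\<dots> = (\<integral>\<^sup>+v. ennreal (1 / (Im (complex_of_vec v))\<^sup>2) * indicator S (complex_of_vec v) \<partial>lborel)"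
    using assms by (subst lborel_complex_eq_distr, subst nn_integral_distr) auto
  also have "\<dots> = (\<integral>\<^sup>+v. indicator (complex_of_vec -` S) v * ennreal (1 / (v$2)\<^sup>2) \<partial>lborel)"
    by (intro nn_integral_cong) (auto simp: complex_of_vec_def indicator_def)
  finally show ?thesis .
qed

lemma mob_has_field_derivative:
  assumes "det A = 1" "0 < Im \<tau>"
  shows "(mob A has_field_derivative 1 / (j A \<tau>)\<^sup>2) (at \<tau>)"
proof -
  have nz: "j A \<tau> \<noteq> 0" by (rule j_nonzero[OF assms])
  have d: "complex_of_real (A$1$1) * of_real (A$2$2) = 1 + of_real (A$1$2) * of_real (A$2$1)"
    using arg_cong[OF det_one_entries[OF assms(1)], of complex_of_real] by simp
  have "((\<lambda>\<tau>. (of_real (A$1$1) * \<tau> + of_real (A$1$2)) / (of_real (A$2$1) * \<tau> + of_real (A$2$2))) has_field_derivative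
     (of_real (A$1$1) * j A \<tau> - (of_real (A$1$1) * \<tau> + of_real (A$1$2)) * of_real (A$2$1)) / (j A \<tau> * j A \<tau>)) (at \<tau>)"
    using nz unfolding j_def by (auto intro!: derivative_eq_intros)
  moreover have "of_real (A$1$1) * j A \<tau> - (of_real (A$1$1) * \<tau> + of_real (A$1$2)) * of_real (A$2$1) = 1"
    using d by (simp add: j_def algebra_simps)
  moreover have "mob A = (\<lambda>\<tau>. (of_real (A$1$1) * \<tau> + of_real (A$1$2)) / (of_real (A$2$1) * \<tau> + of_real (A$2$2)))"
    by (auto simp: mob_eq j_def)
  ultimately show ?thesis by (simp add: power2_eq_square)
qed

lemma mob_holomorphic:
  assumes "det A = 1"
  shows "mob A holomorphic_on upper_half_plane"
  unfolding holomorphic_on_def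
proof
  fix \<tau> assume "\<tau> \<in> upper_half_plane"
  then have "mob A field_differentiable (at \<tau>)"
    using mob_has_field_derivative[OF assms] unfolding upper_half_plane_def field_differentiable_def by blast
  then show "mob A field_differentiable (at \<tau> within upper_half_plane)"
    by (rule field_differentiable_at_within)
qed

lemma upper_half_plane_borel [measurable, simp]: "upper_half_plane \<in> sets borel"
  and open_upper_half_plane: "open upper_half_plane"
  using open_halfspace_Im_gt[of 0] by (simp_all add: upper_half_plane_def)

lemma mob_image_eq_vimage:
  assumes "det A = 1" "S \<subseteq> upper_half_plane"
  shows "mob A ` S = {\<tau>\<in>upper_half_plane. mob (adj A) \<tau> \<in> S}"
proof (intro equalityI subsetI)
  fix \<tau> assume "\<tau> \<in> {\<tau>\<in>upper_half_plane. mob (adj A) \<tau> \<in> S}"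
  then show "\<tau> \<in> mob A ` S"
    using mob_adj(2)[OF assms(1), of \<tau>]
    by (intro image_eqI[of _ _ "mob (adj A) \<tau>"]) (auto simp: upper_half_plane_def)
qed (use assms mob_adj(1)[OF assms(1)] in \<open>auto simp: upper_half_plane_def Im_mob_pos subset_iff\<close>)

lemma mob_vimage_borel:
  assumes "det A = 1" "S \<in> sets borel"
  shows "{\<tau>\<in>upper_half_plane. mob A \<tau> \<in> S} \<in> sets borel"
proof -
  have "mob A \<in> measurable (restrict_space borel upper_half_plane) borel"
    by (intro borel_measurable_continuous_on_restrict holomorphic_on_imp_continuous_on mob_holomorphic assms)
  from measurable_sets[OF this assms(2)]
  have "mob A -` S \<inter> upper_half_plane \<in> sets (restrict_space borel upper_half_plane)"
    by (simp add: space_restrict_space)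
  then have "mob A -` S \<inter> upper_half_plane \<in> sets borel"
    by (subst (asm) sets_restrict_space_iff) auto
  moreover have "mob A -` S \<inter> upper_half_plane = {\<tau>\<in>upper_half_plane. mob A \<tau> \<in> S}" by auto
  ultimately show ?thesis by simp
qed

lemma mob_image_borel:
  assumes "det A = 1" "S \<subseteq> upper_half_plane" "S \<in> sets borel"
  shows "mob A ` S \<in> sets borel"
  unfolding mob_image_eq_vimage[OF assms(1,2)] using assms by (intro mob_vimage_borel) auto

lemma inj_on_mob: "det A = 1 \<Longrightarrow> inj_on (mob A) upper_half_plane"
  by (rule inj_on_inverseI[of _ "mob (adj A)"]) (simp add: upper_half_plane_def mob_adj)

text \<open>Multiplication by the complex derivative \<open>w\<close> has real Jacobian determinant \<open>|w|\<^sup>2\<close>.\<close>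

lemma det_complex_mult:
  "linear (\<lambda>v. vec_of_complex (w * complex_of_vec v))"
  "det (matrix (\<lambda>v. vec_of_complex (w * complex_of_vec v))) = (cmod w)\<^sup>2"
proof -
  show "linear (\<lambda>v. vec_of_complex (w * complex_of_vec v))"
    by (auto intro!: linearI simp: vec_of_complex_def complex_of_vec_def vec2_eq_iff vector_2 algebra_simps)
  show "det (matrix (\<lambda>v. vec_of_complex (w * complex_of_vec v))) = (cmod w)\<^sup>2"
    by (simp add: det_2 matrix_def vec_of_complex_def complex_of_vec_def axis_def vector_2 cmod_power2)
       (simp add: power2_eq_square)
qed

text \<open>The Jacobian of a Moebius map is \<open>|j|\<^sup>-\<^sup>4\<close>, and \<open>Im\<close> changes by the factor \<open>|j|\<^sup>-\<^sup>2\<close>, so the density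
  \<open>1 / Im\<^sup>2\<close> is preserved.\<close>

lemma area_mob_image:
  assumes A: "det A = 1" and S: "S \<subseteq> upper_half_plane" "S \<in> sets borel" and fin: "area S < \<infinity>"
  shows "area (mob A ` S) = area S"
proof -
  define V where "V = complex_of_vec -` S"
  define g where "g = (\<lambda>v. vec_of_complex (mob A (complex_of_vec v)))"
  define f :: "real^2 \<Rightarrow> real" where "f = (\<lambda>v. 1 / (v$2)\<^sup>2)"
  have f0: "\<And>v. 0 \<le> f v" by (simp add: f_def)
  have V[measurable]: "V \<in> sets borel"
    using measurable_sets[OF measurable_complex_of_vec S(2)] by (simp add: V_def)
  have gV: "g ` V = complex_of_vec -` (mob A ` S)"
  proof (intro equalityI subsetI)
    fix v assume "v \<in> complex_of_vec -` (mob A ` S)"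
    then obtain z where "z \<in> S" "complex_of_vec v = mob A z" by auto
    then show "v \<in> g ` V"
      by (intro image_eqI[of _ _ "vec_of_complex z"]) (auto simp: g_def V_def, metis vec_of_complex_of_vec)
  qed (auto simp: V_def g_def)
  have fm[measurable]: "f \<in> borel_measurable borel"
    unfolding f_def by measurable
  obtain r where r: "area S = ennreal r" "0 \<le> r"
    using fin by (cases "area S") auto
  have nn: "(\<integral>\<^sup>+v. ennreal (indicator V v * f v) \<partial>lborel) = ennreal r"
    unfolding r(1)[symmetric] area_eq_nn_integral[OF S(2)]
    by (intro nn_integral_cong) (auto simp: V_def f_def indicator_def)
  then have "integrable lborel (\<lambda>v. indicator V v * f v)" "integral\<^sup>L lborel (\<lambda>v. indicator V v * f v) = r"
    using f0 r(2) by (auto intro!: integrableI_nonneg simp: integral_eq_nn_integral)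
  then have "((\<lambda>v. indicator V v * f v) has_integral r) UNIV"
    using has_integral_integral_lborel by blast
  moreover have "(\<lambda>v. indicator V v * f v) = (\<lambda>v. if v \<in> V then f v else 0)" by auto
  ultimately have fV: "(f has_integral r) V"
    using has_integral_restrict_UNIV[of V f r] by simp
  define g' where "g' = (\<lambda>v h. vec_of_complex (1 / (j A (complex_of_vec v))\<^sup>2 * complex_of_vec h))"
  have der: "(g has_derivative g' v) (at v within V)" if "v \<in> V" for v
  proof -
    have z: "0 < Im (complex_of_vec v)" using that S by (auto simp: V_def upper_half_plane_def)
    have lin: "(complex_of_vec has_derivative complex_of_vec) F" "(vec_of_complex has_derivative vec_of_complex) G" for F G
      using linear_complex_of_vec linear_vec_of_complex by (auto intro: linear_imp_has_derivative)
    have "(mob A has_derivative (*) (1 / (j A (complex_of_vec v))\<^sup>2)) (at (complex_of_vec v))"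
      using mob_has_field_derivative[OF A z] by (simp add: has_field_derivative_def)
    from diff_chain_at[OF lin(1) this] 
    have "(mob A \<circ> complex_of_vec has_derivative (*) (1 / (j A (complex_of_vec v))\<^sup>2) \<circ> complex_of_vec) (at v)" .
    from diff_chain_at[OF this lin(2)] have "(g has_derivative g' v) (at v)"
      unfolding o_def g_def g'_def .
    then show ?thesis by (rule has_derivative_at_withinI)
  qed
  have inj: "inj_on g V"
  proof (rule inj_onI)
    fix u v assume "u \<in> V" "v \<in> V" "g u = g v"
    then have "mob A (complex_of_vec u) = mob A (complex_of_vec v)" "complex_of_vec u \<in> S" "complex_of_vec v \<in> S"
      by (auto simp: g_def V_def) (metis complex_of_vec_of_complex)
    then have "complex_of_vec u = complex_of_vec v"
      using inj_on_mob[OF A] S(1) by (meson inj_on_def subsetD)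
    then show "u = v" by (metis vec_of_complex_of_vec)
  qed
  have jac: "\<bar>det (matrix (g' v))\<bar> *\<^sub>R (vec (f (g v)) :: real^1) = vec (f v)" if "v \<in> V" for v
  proof -
    have z: "0 < Im (complex_of_vec v)" using that S by (auto simp: V_def upper_half_plane_def)
    have "f (g v) = (cmod (j A (complex_of_vec v)))^4 / (Im (complex_of_vec v))\<^sup>2"
      using Im_mob[OF A z] by (simp add: f_def g_def vec_of_complex_def vector_2 power_divide flip: power_mult)
    moreover have "\<bar>det (matrix (g' v))\<bar> = 1 / (cmod (j A (complex_of_vec v)))^4"
      unfolding g'_def det_complex_mult(2) by (simp add: norm_divide norm_power power_divide flip: power_mult)
    ultimately have "\<bar>det (matrix (g' v))\<bar> * f (g v) = f v"
      using j_nonzero[OF A z] by (simp add: f_def complex_of_vec_def)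
    then show ?thesis by (simp add: vec_eq_iff)
  qed
  have vec1: "h absolutely_integrable_on W \<and> integral W h = vec r \<longleftrightarrow> ((\<lambda>v. h v $ 1) has_integral r) W"
    if "\<And>v. v \<in> W \<Longrightarrow> 0 \<le> h v $ 1" for h :: "real^2 \<Rightarrow> real^1" and W
  proof -
    have "h absolutely_integrable_on W \<longleftrightarrow> (\<lambda>v. h v $ 1) integrable_on W"
      using that by (simp add: absolutely_integrable_on_1_iff absolutely_integrable_on_iff_nonneg)
    moreover have "integral W h = vec r \<longleftrightarrow> integral W (\<lambda>v. h v $ 1) = r" 
      if "h integrable_on W"
      using integral_on_1_eq[of W h] by (auto simp: vec_eq_iff)
    ultimately show ?thesis
      using integrable_on_1_iff[of h W] has_integral_integrable_integral by blast
  qed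
  have "((\<lambda>v. vec (f v) :: real^1) absolutely_integrable_on V \<and> integral V (\<lambda>v. vec (f v) :: real^1) = vec r)"
    using fV by (subst vec1) (auto simp: f0)
  then have "(\<lambda>v. \<bar>det (matrix (g' v))\<bar> *\<^sub>R (vec (f (g v)) :: real^1)) absolutely_integrable_on V \<and>
     integral V (\<lambda>v. \<bar>det (matrix (g' v))\<bar> *\<^sub>R (vec (f (g v)) :: real^1)) = vec r"
    using jac by (simp cong: set_integrable_cong Henstock_Kurzweil_Integration.integral_cong)
  then have "(\<lambda>v. vec (f v) :: real^1) absolutely_integrable_on (g ` V) \<and> integral (g ` V) (\<lambda>v. vec (f v) :: real^1) = vec r"
    using has_absolute_integral_change_of_variables[OF _ der inj, of "\<lambda>v. vec (f v) :: real^1" "vec r"] V by auto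
  then have "(f has_integral r) (g ` V)"
    by (subst (asm) vec1) (auto simp: f0)
  from nn_integral_has_integral_lebesgue[OF _ this]
  have "(\<integral>\<^sup>+v. ennreal (indicator (g ` V) v * f v) \<partial>lborel) = ennreal r" using f0 by auto
  moreover have "(\<integral>\<^sup>+v. indicator (g ` V) v * ennreal (1 / (v$2)\<^sup>2) \<partial>lborel) = (\<integral>\<^sup>+v. ennreal (indicator (g ` V) v * f v) \<partial>lborel)"
    by (intro nn_integral_cong) (auto simp: f_def indicator_def)
  ultimately show ?thesis
    unfolding r(1) area_eq_nn_integral[OF mob_image_borel[OF A S]] gV by simp
qed

text \<open>Cut \<open>W\<close> into the pieces \<open>W \<inter> \<gamma>\<^sup>-\<^sup>1 F\<close> and move them into \<open>F\<close>. The total area of the moved pieces is the integral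
  over \<open>z \<in> F\<close> of the number of \<open>\<gamma>\<close> with \<open>z \<in> \<gamma> W\<close>.\<close>

lemma area_le_of_bounded_multiplicity:
  fixes G :: "(real^2^2) set" and N :: nat
  assumes "countable G" and detG: "\<And>\<gamma>. \<gamma> \<in> G \<Longrightarrow> det \<gamma> = 1"
    and F: "F \<subseteq> upper_half_plane" "F \<in> sets borel" "area F < \<infinity>"
    and cover: "\<And>\<tau>. \<tau> \<in> upper_half_plane \<Longrightarrow> \<exists>\<gamma>\<in>G. mob \<gamma> \<tau> \<in> F"
    and W: "W \<subseteq> upper_half_plane" "W \<in> sets borel"
    and mult: "\<And>z. z \<in> upper_half_plane \<Longrightarrow> finite {\<gamma>\<in>G. z \<in> mob \<gamma> ` W} \<and> card {\<gamma>\<in>G. z \<in> mob \<gamma> ` W} \<le> N"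
  shows "area W \<le> of_nat N * area F"
proof -
  define P where "P = (\<lambda>\<gamma>. W \<inter> {\<tau>\<in>upper_half_plane. mob \<gamma> \<tau> \<in> F})"
  define R where "R = (\<lambda>\<gamma>. mob \<gamma> ` W \<inter> F)"
  have PS: "P \<gamma> \<in> sets borel" if "\<gamma> \<in> G" for \<gamma>
    unfolding P_def using that detG F W by (intro sets.Int mob_vimage_borel) auto
  have RS: "R \<gamma> \<in> sets borel" if "\<gamma> \<in> G" for \<gamma>
    unfolding R_def using that detG F W by (intro sets.Int mob_image_borel) auto
  have PR: "area (P \<gamma>) = area (R \<gamma>)" if "\<gamma> \<in> G" for \<gamma>
  proof -
    have sub: "R \<gamma> \<subseteq> upper_half_plane" using F by (auto simp: R_def)
    have "area (R \<gamma>) \<le> area F"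
      unfolding area_def using F by (intro emeasure_mono) (auto simp: R_def)
    then have fin: "area (R \<gamma>) < \<infinity>" using F(3) by (rule le_less_trans)
    have "mob (adj \<gamma>) ` R \<gamma> = P \<gamma>"
    proof (intro equalityI subsetI)
      fix z assume "z \<in> mob (adj \<gamma>) ` R \<gamma>"
      then obtain w where "w \<in> W" "mob \<gamma> w \<in> F" "z = mob (adj \<gamma>) (mob \<gamma> w)" by (auto simp: R_def)
      then show "z \<in> P \<gamma>" using W mob_adj(1)[OF detG[OF that], of w]
        by (auto simp: P_def upper_half_plane_def)
    next
      fix z assume z: "z \<in> P \<gamma>"
      then have "0 < Im z" "mob \<gamma> z \<in> R \<gamma>" using W by (auto simp: P_def R_def upper_half_plane_def)
      then show "z \<in> mob (adj \<gamma>) ` R \<gamma>"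
        using mob_adj(1)[OF detG[OF that], of z] by (intro image_eqI[of _ _ "mob \<gamma> z"]) auto
    qed
    then show ?thesis
      using area_mob_image[of "adj \<gamma>" "R \<gamma>"] detG[OF that] sub RS[OF that] fin by simp
  qed
  have "area W = (\<integral>\<^sup>+z. indicator W z \<partial>hyperbolic_area)"
    unfolding area_def using W by simp
  also have "\<dots> \<le> (\<integral>\<^sup>+z. (\<integral>\<^sup>+\<gamma>. indicator (P \<gamma>) z \<partial>count_space G) \<partial>hyperbolic_area)"
  proof (rule nn_integral_mono)
    fix z
    show "indicator W z \<le> (\<integral>\<^sup>+\<gamma>. (indicator (P \<gamma>) z :: ennreal) \<partial>count_space G)"
    proof (cases "z \<in> W")
      case True
      then obtain \<gamma> where \<gamma>: "\<gamma> \<in> G" "mob \<gamma> z \<in> F" using cover W by blast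
      then have "z \<in> P \<gamma>" using True W by (auto simp: P_def)
      then have "(1::ennreal) = indicator (P \<gamma>) z" by simp
      also have "\<dots> \<le> (\<integral>\<^sup>+\<gamma>. (indicator (P \<gamma>) z :: ennreal) \<partial>count_space G)"
        by (rule nn_integral_ge_point[OF \<gamma>(1)])
      finally show ?thesis using True by simp
    qed simp
  qed
  also have "\<dots> = (\<integral>\<^sup>+\<gamma>. (\<integral>\<^sup>+z. indicator (P \<gamma>) z \<partial>hyperbolic_area) \<partial>count_space G)"
    using PS by (intro nn_integral_count_space_nn_integral assms(1) borel_measurable_indicator) auto
  also have "\<dots> = (\<integral>\<^sup>+\<gamma>. (\<integral>\<^sup>+z. indicator (R \<gamma>) z \<partial>hyperbolic_area) \<partial>count_space G)"
  proof (rule nn_integral_cong)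
    fix \<gamma> assume "\<gamma> \<in> space (count_space G)"
    then have "\<gamma> \<in> G" by simp
    then show "(\<integral>\<^sup>+z. indicator (P \<gamma>) z \<partial>hyperbolic_area) = (\<integral>\<^sup>+z. indicator (R \<gamma>) z \<partial>hyperbolic_area)"
      using PS RS PR by (simp add: area_def)
  qed
  also have "\<dots> = (\<integral>\<^sup>+z. (\<integral>\<^sup>+\<gamma>. indicator (R \<gamma>) z \<partial>count_space G) \<partial>hyperbolic_area)"
    using RS by (intro nn_integral_count_space_nn_integral[symmetric] assms(1) borel_measurable_indicator) auto
  also have "\<dots> \<le> (\<integral>\<^sup>+z. of_nat N * indicator F z \<partial>hyperbolic_area)"
  proof (rule nn_integral_mono)
    fix z
    show "(\<integral>\<^sup>+\<gamma>. (indicator (R \<gamma>) z :: ennreal) \<partial>count_space G) \<le> of_nat N * indicator F z"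
    proof (cases "z \<in> F")
      case True
      then have z: "z \<in> upper_half_plane" using F by auto
      have "(\<integral>\<^sup>+\<gamma>. (indicator (R \<gamma>) z :: ennreal) \<partial>count_space G)
          = (\<integral>\<^sup>+\<gamma>. indicator {\<gamma>\<in>G. z \<in> mob \<gamma> ` W} \<gamma> \<partial>count_space G)"
        using True by (intro nn_integral_cong) (auto simp: R_def indicator_def)
      also have "\<dots> = of_nat (card {\<gamma>\<in>G. z \<in> mob \<gamma> ` W})"
        using mult[OF z] by (subst nn_integral_indicator) (auto simp: emeasure_count_space_finite)
      also have "\<dots> \<le> of_nat N * indicator F z" using mult[OF z] True by simp
      finally show ?thesis .
    qed (simp add: R_def)
  qed
  also have "\<dots> = of_nat N * area F"
    unfolding area_def using F by (simp add: nn_integral_cmult_indicator)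
  finally show ?thesis .
qed

section \<open>Discrete groups: displacement and compactness of the thick part\<close>

text \<open>Pigeonhole: the ball is covered by finitely many balls of radius \<open>e/2\<close>, and each of them contains at most
  one point of \<open>S\<close>.\<close>

lemma separated_card_bounded:
  fixes C e :: real
  assumes "0 < e"
  shows "\<exists>N. \<forall>S \<subseteq> cball (0 :: real^2^2) C.
     (\<forall>A\<in>S. \<forall>B\<in>S. A \<noteq> B \<longrightarrow> e \<le> norm (A - B)) \<longrightarrow> finite S \<and> card S \<le> N"
proof -
  obtain T where T: "finite T" "cball (0 :: real^2^2) C \<subseteq> (\<Union>x\<in>T. ball x (e/2))"
    using compactE_image[OF compact_cball[of "0 :: real^2^2" C], of "cball 0 C" "\<lambda>x. ball x (e/2)"] assms
    by (metis (no_types, lifting) UN_iff centre_in_ball half_gt_zero open_ball subsetI)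
  show ?thesis
  proof (intro exI[of _ "card T"] allI impI)
    fix S assume S: "S \<subseteq> cball (0 :: real^2^2) C" "\<forall>A\<in>S. \<forall>B\<in>S. A \<noteq> B \<longrightarrow> e \<le> norm (A - B)"
    then have "\<forall>A\<in>S. \<exists>x\<in>T. dist x A < e/2" using T(2) by fastforce
    then obtain t where t: "\<And>A. A \<in> S \<Longrightarrow> t A \<in> T \<and> dist (t A) A < e/2" by metis
    have "inj_on t S"
    proof (rule inj_onI)
      fix A B assume AB: "A \<in> S" "B \<in> S" "t A = t B"
      then have "dist A B < e" using t dist_triangle3[of A B "t A"] by (smt (verit) field_sum_of_halves)
      then show "A = B" using S(2) AB by (force simp: dist_norm)
    qed
    moreover have "t ` S \<subseteq> T" using t by auto
    ultimately show "finite S \<and> card S \<le> card T"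
      using T(1) by (meson card_inj_on_le inj_on_finite)
  qed
qed

text \<open>Since \<open>|A\<^sup>-\<^sup>1 B - 1| \<le> |A| |B - A|\<close>, a gap around the identity separates all elements of bounded norm. The
  bound depends only on the gap and on \<open>C\<close>, so it is uniform over all conjugates of a group that have this gap.\<close>

lemma card_bounded_of_isolated_one:
  fixes C e :: real
  assumes "0 < e"
  shows "\<exists>N. \<forall>H. (\<forall>A\<in>H. \<forall>B\<in>H. det A = 1 \<and> adj A ** B \<in> H) \<longrightarrow> (\<forall>A\<in>H. A \<noteq> mat 1 \<longrightarrow> e \<le> norm (A - mat 1)) \<longrightarrow>
     finite {A\<in>H. norm A \<le> C} \<and> card {A\<in>H. norm A \<le> C} \<le> N"
proof -
  define C' where "C' = max C 1"
  have C': "0 < C'" "C \<le> C'" by (auto simp: C'_def)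
  obtain N where N: "\<And>S. S \<subseteq> cball (0 :: real^2^2) C' \<Longrightarrow> \<forall>A\<in>S. \<forall>B\<in>S. A \<noteq> B \<longrightarrow> e / C' \<le> norm (A - B) \<Longrightarrow>
     finite S \<and> card S \<le> N"
    using separated_card_bounded[of "e / C'" C'] assms C' by auto
  show ?thesis
  proof (intro exI[of _ N] allI impI)
    fix H :: "(real^2^2) set"
    assume H: "\<forall>A\<in>H. \<forall>B\<in>H. det A = 1 \<and> adj A ** B \<in> H" "\<forall>A\<in>H. A \<noteq> mat 1 \<longrightarrow> e \<le> norm (A - mat 1)"
    show "finite {A\<in>H. norm A \<le> C} \<and> card {A\<in>H. norm A \<le> C} \<le> N"
    proof (rule N)
      show "\<forall>A\<in>{A\<in>H. norm A \<le> C}. \<forall>B\<in>{A\<in>H. norm A \<le> C}. A \<noteq> B \<longrightarrow> e / C' \<le> norm (A - B)"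
      proof (intro ballI impI)
        fix A B assume A: "A \<in> {A\<in>H. norm A \<le> C}" and B: "B \<in> {A\<in>H. norm A \<le> C}" and "A \<noteq> B"
        then have dA: "det A = 1" using H by auto
        have "adj A ** B \<noteq> mat 1"
        proof
          assume "adj A ** B = mat 1"
          then have "A ** (adj A ** B) = A" by simp
          then show False using mult_adj_assoc(1)[OF dA, of B] \<open>A \<noteq> B\<close> by simp
        qed
        then have "e \<le> norm (adj A ** B - mat 1)" using H A B by auto
        also have "adj A ** B - mat 1 = adj A ** (B - A)"
          using mult_adj(2)[OF dA] by (simp add: mat2_eq_iff algebra_simps)
        also have "norm \<dots> \<le> norm A * norm (B - A)"
          using norm_mat2_mult[of "adj A"] by simp
        also have "\<dots> \<le> C' * norm (A - B)"
          using A C' by (intro mult_mono) (auto simp: norm_minus_commute)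
        finally show "e / C' \<le> norm (A - B)" using C' by (simp add: field_simps)
      qed
    qed (use C' in auto)
  qed
qed

text \<open>The affine map with \<open>i \<mapsto> z\<close>; conjugation by it turns questions about a neighbourhood of \<open>z\<close> into questions about \<open>i\<close>.\<close>

definition frame :: "complex \<Rightarrow> real^2^2" where
  "frame z = mat2 (sqrt (Im z)) (Re z / sqrt (Im z)) 0 (1 / sqrt (Im z))"

lemma det_frame [simp]: "0 < Im z \<Longrightarrow> det (frame z) = 1"
  by (simp add: det_2 frame_def)

lemma mob_frame: 
  assumes "0 < Im z"
  shows "mob (frame z) w = of_real (Im z) * w + of_real (Re z)"
proof -
  have s: "complex_of_real (sqrt (Im z)) * of_real (sqrt (Im z)) = of_real (Im z)"
    using assms by (simp flip: of_real_mult)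
  have "complex_of_real (sqrt (Im z)) \<noteq> 0" using assms by simp
  then show ?thesis
    by (simp add: mob_eq frame_def j_def field_simps s[symmetric])
qed

lemma mob_frame_i [simp]: "0 < Im z \<Longrightarrow> mob (frame z) \<i> = z"
  by (simp add: mob_frame complex_eq_iff)

text \<open>Left multiplication by an upper triangular matrix reaches every point from \<open>i\<close>, so a matrix is determined up to rotation
  by the image of \<open>i\<close>, and rotations preserve the Frobenius norm.\<close>

lemma norm_eq_mob_i:
  assumes "det A = 1"
  shows "(norm A)\<^sup>2 = (1 + (cmod (mob A \<i>))\<^sup>2) / Im (mob A \<i>)"
proof -
  have j2: "(cmod (j A \<i>))\<^sup>2 = (A$2$1)\<^sup>2 + (A$2$2)\<^sup>2" by (simp add: j_def cmod_power2)
  have nz: "j A \<i> \<noteq> 0" using j_nonzero[OF assms, of \<i>] by simp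
  have I: "Im (mob A \<i>) = 1 / (cmod (j A \<i>))\<^sup>2" using Im_mob[OF assms, of \<i>] by simp
  have m: "(cmod (mob A \<i>))\<^sup>2 = ((A$1$1)\<^sup>2 + (A$1$2)\<^sup>2) / (cmod (j A \<i>))\<^sup>2"
    by (simp add: mob_eq norm_divide power_divide) (simp add: cmod_power2)
  have frac: "(1 + P / J) / (1 / J) = P + J" if "J \<noteq> 0" for P J :: real
    using that by (simp add: field_simps)
  have "(cmod (j A \<i>))\<^sup>2 \<noteq> 0" using nz by simp
  from frac[OF this] show ?thesis unfolding I m norm_mat2_sq by (simp only: j2 add.assoc)
qed

text \<open>A rectangle around \<open>i\<close> that serves as a standard neighbourhood of it.\<close>

definition unit_box :: "complex set" where
  "unit_box = box (Complex (- 1/2) (1/2)) (Complex (1/2) (3/2))"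

lemma unit_box_iff: "w \<in> unit_box \<longleftrightarrow> - 1/2 < Re w \<and> Re w < 1/2 \<and> 1/2 < Im w \<and> Im w < 3/2"
  by (auto simp: unit_box_def in_box_complex_iff)

lemma unit_box_bounds:
  assumes "w \<in> unit_box"
  shows "0 < Im w" "(1 + (cmod w)\<^sup>2) / Im w \<le> 7"
proof -
  have w: "\<bar>Re w\<bar> < 1/2" "1/2 < Im w" "Im w < 3/2" using assms unfolding unit_box_iff by auto
  then show "0 < Im w" by linarith
  have "(Re w)\<^sup>2 \<le> (1/2)\<^sup>2" "(Im w)\<^sup>2 \<le> (3/2)\<^sup>2"
    using w by (auto simp: power2_le_iff_abs_le)
  then have "(Re w)\<^sup>2 \<le> 1/4" "(Im w)\<^sup>2 \<le> 9/4" by (simp_all add: power_divide)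
  then have "1 + (cmod w)\<^sup>2 \<le> 7 * Im w" using w unfolding cmod_power2 by linarith
  then show "(1 + (cmod w)\<^sup>2) / Im w \<le> 7" using w by (simp add: field_simps)
qed

text \<open>Both \<open>M ** frame w\<close> and \<open>frame w\<close> take \<open>i\<close> into the box, so their norms are at most \<open>sqrt 7\<close>, and \<open>M\<close> is the first times the
  inverse of the second.\<close>

lemma norm_le_of_mob_unit_box:
  assumes M: "det M = 1" and w: "w \<in> unit_box" "mob M w \<in> unit_box"
  shows "norm M \<le> 7"
proof -
  note w0 = unit_box_bounds(1)[OF w(1)]
  let ?A = "M ** frame w"
  have A: "det ?A = 1" "mob ?A \<i> = mob M w"
    using M w0 by (simp_all add: det_mul mob_mult)
  have "(norm ?A)\<^sup>2 \<le> 7" using norm_eq_mob_i[OF A(1)] unit_box_bounds(2)[OF w(2)] A(2) by simp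
  moreover have "(norm (frame w))\<^sup>2 \<le> 7"
    using norm_eq_mob_i[of "frame w"] unit_box_bounds(2)[OF w(1)] w0 by simp
  ultimately have "(norm ?A)\<^sup>2 * (norm (frame w))\<^sup>2 \<le> 7 * 7" by (intro mult_mono) auto
  moreover have "norm M \<le> norm ?A * norm (frame w)"
    using norm_mat2_mult[of ?A "adj (frame w)"] mult_adj_assoc(3)[of "frame w" M] w0 by simp
  then have "(norm M)\<^sup>2 \<le> (norm ?A * norm (frame w))\<^sup>2" by (rule power_mono) simp
  ultimately have "(norm M)\<^sup>2 \<le> 7\<^sup>2" by (simp add: power_mult_distrib)
  then show ?thesis by (rule power2_le_imp_le) simp
qed

lemma unit_box_subset: "unit_box \<subseteq> upper_half_plane"
  using unit_box_bounds(1) by (auto simp: upper_half_plane_def)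

lemma unit_box_borel [measurable, simp]: "unit_box \<in> sets borel"
  by (simp add: unit_box_def)

lemma emeasure_unit_box: "emeasure lborel unit_box = 1"
  unfolding unit_box_def by (subst emeasure_lborel_box) (auto simp: Basis_complex_def)

lemma area_unit_box: "area unit_box < \<infinity>" "0 < area unit_box"
proof -
  have e: "area unit_box = (\<integral>\<^sup>+z. ennreal (1 / (Im z)\<^sup>2) * indicator unit_box z \<partial>lborel)"
    unfolding area_def hyperbolic_area_def by (subst emeasure_density) auto
  have "area unit_box \<le> (\<integral>\<^sup>+z. 4 * indicator unit_box z \<partial>lborel)"
    unfolding e
  proof (rule nn_integral_mono)
    fix z :: complex
    show "ennreal (1 / (Im z)\<^sup>2) * indicator unit_box z \<le> 4 * indicator unit_box z"
    proof (cases "z \<in> unit_box")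
      case True
      then have "1/2 < Im z" unfolding unit_box_iff by auto
      then have "(1/2)\<^sup>2 \<le> (Im z)\<^sup>2" by (intro power_mono) auto
      then have "1 / (Im z)\<^sup>2 \<le> 4" by (simp add: field_simps power2_eq_square)
      then have "ennreal (1 / (Im z)\<^sup>2) \<le> ennreal 4" by (rule ennreal_leI)
      then show ?thesis using True by simp
    qed simp
  qed
  also have "\<dots> = 4" by (subst nn_integral_cmult_indicator) (auto simp: emeasure_unit_box)
  finally show "area unit_box < \<infinity>" using ennreal_numeral_less_top[of "num.Bit0 (num.Bit0 num.One)"] by (auto elim: le_less_trans)
  have "(\<integral>\<^sup>+z. ennreal (1/4) * indicator unit_box z \<partial>lborel) \<le> area unit_box"
    unfolding e
  proof (rule nn_integral_mono)
    fix z :: complex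
    show "ennreal (1/4) * indicator unit_box z \<le> ennreal (1 / (Im z)\<^sup>2) * indicator unit_box z"
    proof (cases "z \<in> unit_box")
      case True
      then have z: "1/2 < Im z" "Im z < 3/2" unfolding unit_box_iff by auto
      then have "(Im z)\<^sup>2 \<le> 2\<^sup>2" by (intro power_mono) auto
      then have "1/4 \<le> 1 / (Im z)\<^sup>2" using z by (simp add: field_simps power2_eq_square)
      then have "ennreal (1/4) \<le> ennreal (1 / (Im z)\<^sup>2)" by (rule ennreal_leI)
      then show ?thesis using True by simp
    qed simp
  qed
  also have "(\<integral>\<^sup>+z. ennreal (1/4) * indicator unit_box z \<partial>lborel) = ennreal (1/4)"
    by (subst nn_integral_cmult_indicator) (auto simp: emeasure_unit_box)
  finally show "0 < area unit_box" using less_le_trans[of 0 "ennreal (1/4)"] by simp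
qed

locale discrete_group =
  fixes G :: "(real^2^2) set"
  assumes det_G: "\<gamma> \<in> G \<Longrightarrow> det \<gamma> = 1"
    and one_G: "mat 1 \<in> G"
    and mult_G: "\<gamma> \<in> G \<Longrightarrow> \<delta> \<in> G \<Longrightarrow> \<gamma> ** \<delta> \<in> G"
    and adj_G: "\<gamma> \<in> G \<Longrightarrow> adj \<gamma> \<in> G"
    and isolated_G: "\<exists>e>0. \<forall>\<gamma>\<in>G. \<gamma> \<noteq> mat 1 \<longrightarrow> e \<le> norm (\<gamma> - mat 1)"
begin

lemma finite_norm_le: "finite {\<gamma>\<in>G. norm \<gamma> \<le> C}"
proof -
  obtain e where e: "0 < e" "\<forall>\<gamma>\<in>G. \<gamma> \<noteq> mat 1 \<longrightarrow> e \<le> norm (\<gamma> - mat 1)"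
    using isolated_G by blast
  obtain N where N: "\<forall>H. (\<forall>A\<in>H. \<forall>B\<in>H. det A = 1 \<and> adj A ** B \<in> H) \<longrightarrow> (\<forall>A\<in>H. A \<noteq> mat 1 \<longrightarrow> e \<le> norm (A - mat 1)) \<longrightarrow>
     finite {A\<in>H. norm A \<le> C} \<and> card {A\<in>H. norm A \<le> C} \<le> N"
    using card_bounded_of_isolated_one[OF e(1), of C] by (elim exE)
  have "\<forall>A\<in>G. \<forall>B\<in>G. det A = 1 \<and> adj A ** B \<in> G" by (simp add: det_G mult_G adj_G)
  then show ?thesis using N[rule_format, of G] e(2) by simp
qed

lemma countable_G: "countable G"
proof -
  have "G \<subseteq> (\<Union>n::nat. {\<gamma>\<in>G. norm \<gamma> \<le> real n})"
    using real_arch_simple by auto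
  moreover have "countable (\<Union>n::nat. {\<gamma>\<in>G. norm \<gamma> \<le> real n})"
    by (intro countable_UN countableI_type countable_finite finite_norm_le)
  ultimately show ?thesis by (rule countable_subset)
qed

text \<open>The group as seen from \<open>z\<close>: conjugated so that \<open>z\<close> moves to \<open>i\<close>.\<close>

definition framed :: "complex \<Rightarrow> (real^2^2) set" where
  "framed z = (\<lambda>\<gamma>. adj (frame z) ** \<gamma> ** frame z) ` G"

text \<open>The distance of \<open>\<gamma>\<close> from the identity as seen from \<open>\<tau>\<close>. It is small only if \<open>\<gamma>\<close> is close to the identity near \<open>\<tau>\<close>, whereas a
  rotation by a large angle about \<open>\<tau>\<close> fixes \<open>\<tau>\<close> without being small.\<close>

definition displacement :: "real^2^2 \<Rightarrow> complex \<Rightarrow> real" where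
  "displacement \<gamma> \<tau> = norm (adj (frame \<tau>) ** \<gamma> ** frame \<tau> - mat 1)"

definition thick :: "real \<Rightarrow> complex \<Rightarrow> bool" where
  "thick e \<tau> \<longleftrightarrow> 0 < Im \<tau> \<and> (\<forall>\<gamma>\<in>G. \<gamma> \<noteq> mat 1 \<longrightarrow> e \<le> displacement \<gamma> \<tau>)"

definition box_at :: "complex \<Rightarrow> complex set" where
  "box_at z = mob (frame z) ` unit_box"

lemma box_at_meet:
  assumes "\<gamma> \<in> G" "0 < Im z" "0 < Im z'" "u \<in> box_at z" "mob \<gamma> u \<in> box_at z'"
  shows "norm (adj (frame z') ** \<gamma> ** frame z) \<le> 7"
proof -
  obtain w w' where w: "w \<in> unit_box" "u = mob (frame z) w" "w' \<in> unit_box" "mob \<gamma> u = mob (frame z') w'"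
    using assms by (auto simp: box_at_def)
  note pos = unit_box_bounds(1)[OF w(1)] unit_box_bounds(1)[OF w(3)]
  have "mob (adj (frame z') ** \<gamma> ** frame z) w = w'"
    using pos assms w(2,4) det_G[OF assms(1)] mob_adj(1)[of "frame z'" w']
    by (simp add: mob_mult det_mul Im_mob_pos)
  then show ?thesis
    using norm_le_of_mob_unit_box[of "adj (frame z') ** \<gamma> ** frame z" w] w assms det_G[OF assms(1)] by (simp add: det_mul)
qed

lemma box_at_properties:
  assumes "0 < Im z"
  shows "area (box_at z) = area unit_box" "box_at z \<subseteq> upper_half_plane" "box_at z \<in> sets borel" "z \<in> box_at z"
proof -
  show "area (box_at z) = area unit_box" "box_at z \<in> sets borel" unfolding box_at_def
    using assms unit_box_subset area_unit_box by (simp_all add: area_mob_image mob_image_borel)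
  show "box_at z \<subseteq> upper_half_plane" using assms unit_box_bounds(1)
    by (auto simp: box_at_def upper_half_plane_def Im_mob_pos)
  have "\<i> \<in> unit_box" by (simp add: unit_box_iff)
  then show "z \<in> box_at z" unfolding box_at_def using mob_frame_i[OF assms] by (metis imageI)
qed

lemma framed_card_bounded:
  assumes "0 < e"
  shows "\<exists>N. \<forall>z. thick e z \<longrightarrow> finite {A\<in>framed z. norm A \<le> C} \<and>
      card {A\<in>framed z. norm A \<le> C} \<le> N"
proof -
  obtain N where N: "\<forall>H. (\<forall>A\<in>H. \<forall>B\<in>H. det A = 1 \<and> adj A ** B \<in> H) \<longrightarrow> (\<forall>A\<in>H. A \<noteq> mat 1 \<longrightarrow> e \<le> norm (A - mat 1)) \<longrightarrow>
     finite {A\<in>H. norm A \<le> C} \<and> card {A\<in>H. norm A \<le> C} \<le> N"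
    using card_bounded_of_isolated_one[OF assms, of C] by (elim exE)
  show ?thesis
  proof (intro exI[of _ N] allI impI N[rule_format] ballI)
    fix z A B assume z: "thick e z"
      and A: "A \<in> framed z" and B: "B \<in> framed z"
    have d: "det (frame z) = 1" using z by (simp add: thick_def)
    obtain \<alpha> \<beta> where ab: "\<alpha> \<in> G" "\<beta> \<in> G" "A = adj (frame z) ** \<alpha> ** frame z" "B = adj (frame z) ** \<beta> ** frame z"
      using A B unfolding framed_def by blast
    have "adj A ** B = adj (frame z) ** adj \<alpha> ** (frame z ** (adj (frame z) ** (\<beta> ** frame z)))"
      by (simp add: ab adj_mult matrix_mul_assoc)
    also have "\<dots> = adj (frame z) ** (adj \<alpha> ** \<beta>) ** frame z"
      unfolding mult_adj_assoc(1)[OF d] by (simp add: matrix_mul_assoc)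
    finally have "adj A ** B \<in> framed z"
      unfolding framed_def using ab mult_G adj_G by blast
    then show "det A = 1 \<and> adj A ** B \<in> framed z"
      using ab d det_G by (simp add: det_mul)
  next
    fix z A assume z: "thick e z" and A: "A \<in> framed z" "A \<noteq> mat 1"
    then obtain \<alpha> where a: "\<alpha> \<in> G" "A = adj (frame z) ** \<alpha> ** frame z" unfolding framed_def by blast
    have "det (frame z) = 1" using z by (simp add: thick_def)
    then have "adj (frame z) ** mat 1 ** frame z = mat 1" by (simp add: mult_adj)
    then have "\<alpha> \<noteq> mat 1" using A(2) unfolding a(2) by metis
    then show "e \<le> norm (A - mat 1)" using z a by (simp add: thick_def displacement_def)
  qed
qed

lemma inj_conjugate: "det \<sigma> = 1 \<Longrightarrow> det \<rho> = 1 \<Longrightarrow> inj (\<lambda>\<gamma> :: real^2^2. \<rho> ** \<gamma> ** (\<sigma> :: real^2^2) :: real^2^2)"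
proof (rule injI)
  fix a b :: "real^2^2" assume d: "det \<sigma> = 1" "det \<rho> = 1" and "\<rho> ** a ** \<sigma> = \<rho> ** b ** \<sigma>"
  then have "adj \<rho> ** (\<rho> ** a ** \<sigma> ** adj \<sigma>) = adj \<rho> ** (\<rho> ** b ** \<sigma> ** adj \<sigma>)" by simp
  then show "a = b" unfolding mult_adj_assoc(3)[OF d(1)] mult_adj_assoc(2)[OF d(2)] .
qed

text \<open>If \<open>\<gamma>\<^sub>0\<close> and \<open>\<gamma>\<close> both carry a point of the box to \<open>u\<close>, then \<open>\<gamma>\<^sub>0\<^sup>-\<^sup>1 \<gamma>\<close> carries a point of the box to a point of the box, so
  its norm as seen from \<open>z\<close> is at most 7.\<close>

lemma box_at_multiplicity:
  assumes "0 < Im z" "u \<in> upper_half_plane"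
    and fin: "finite {A\<in>framed z. norm A \<le> 7}"
  shows "finite {\<gamma>\<in>G. u \<in> mob \<gamma> ` box_at z} \<and>
    card {\<gamma>\<in>G. u \<in> mob \<gamma> ` box_at z} \<le> card {A\<in>framed z. norm A \<le> 7}"
proof (cases "{\<gamma>\<in>G. u \<in> mob \<gamma> ` box_at z} = {}")
  case False
  then obtain \<gamma>0 w0 where g0: "\<gamma>0 \<in> G" "w0 \<in> box_at z" "u = mob \<gamma>0 w0" by blast
  have d: "det (frame z) = 1" "det (adj (frame z) ** adj \<gamma>0) = 1"
    using assms(1) det_G[OF g0(1)] by (simp_all add: det_mul)
  define \<phi> where "\<phi> = (\<lambda>\<gamma>. (adj (frame z) ** adj \<gamma>0) ** \<gamma> ** frame z)"
  have inj: "inj_on \<phi> {\<gamma>\<in>G. u \<in> mob \<gamma> ` box_at z}"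
    using inj_conjugate[OF d] unfolding \<phi>_def by (rule inj_on_subset) simp
  have sub: "\<phi> ` {\<gamma>\<in>G. u \<in> mob \<gamma> ` box_at z} \<subseteq> {A\<in>framed z. norm A \<le> 7}"
  proof
    fix A assume "A \<in> \<phi> ` {\<gamma>\<in>G. u \<in> mob \<gamma> ` box_at z}"
    then obtain \<gamma> w where g: "\<gamma> \<in> G" "w \<in> box_at z" "u = mob \<gamma> w" "A = \<phi> \<gamma>" by blast
    have G': "adj \<gamma>0 ** \<gamma> \<in> G" using g0 g mult_G adj_G by simp
    have A: "A = adj (frame z) ** (adj \<gamma>0 ** \<gamma>) ** frame z" by (simp add: g(4) \<phi>_def matrix_mul_assoc)
    have w: "0 < Im w" "0 < Im w0" using g(2) g0(2) box_at_properties(2)[OF assms(1)] by (auto simp: upper_half_plane_def)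
    have "mob (adj \<gamma>0 ** \<gamma>) w = mob (adj \<gamma>0) (mob \<gamma>0 w0)"
      using mob_mult[of "adj \<gamma>0" \<gamma> w] det_G g0 g w by simp
    also have "\<dots> = w0" using mob_adj(1)[of \<gamma>0 w0] det_G g0 w by simp
    finally have "norm A \<le> 7" unfolding A
      using box_at_meet[OF G' assms(1) assms(1) g(2)] g0(2) by simp
    then show "A \<in> {A\<in>framed z. norm A \<le> 7}"
      unfolding framed_def using A G' by blast
  qed
  show ?thesis using card_inj_on_le[OF inj sub fin] inj_on_finite[OF inj sub fin] by simp
next
  case True
  show ?thesis unfolding True by simp
qed

text \<open>Boxes at thick points that are disjoint modulo \<open>G\<close> all have the same area and a common multiplicity bound,
  so the finite area of \<open>F\<close> allows only finitely many. Given a maximal family, the box at any thick point has a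
  translate that meets a box of the family, which puts a translate of the point itself into a compact
  neighbourhood of the centre of that box.\<close>

lemma thick_part_compact_mod_G:
  assumes F: "F \<subseteq> upper_half_plane" "F \<in> sets borel" "area F < \<infinity>"
    and cover: "\<And>\<tau>. \<tau> \<in> upper_half_plane \<Longrightarrow> \<exists>\<gamma>\<in>G. mob \<gamma> \<tau> \<in> F" and "0 < e"
  shows "\<exists>K. compact K \<and> K \<subseteq> upper_half_plane \<and> (\<forall>\<tau>. thick e \<tau> \<longrightarrow> (\<exists>\<gamma>\<in>G. mob \<gamma> \<tau> \<in> K))"
proof -
  let ?near = "\<lambda>z. {A\<in>framed z. norm A \<le> 7}"
  obtain N where N: "\<forall>z. thick e z \<longrightarrow> finite (?near z) \<and> card (?near z) \<le> N"
    using framed_card_bounded[OF \<open>0 < e\<close>, of 7] by (elim exE)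
  define sep where "sep = (\<lambda>Z. finite Z \<and> (\<forall>z\<in>Z. thick e z) \<and>
     (\<forall>z\<in>Z. \<forall>z'\<in>Z. \<forall>\<gamma>\<in>G. z \<noteq> z' \<longrightarrow> mob \<gamma> ` box_at z \<inter> box_at z' = {}))"
  have bound: "of_nat (card Z) * area unit_box \<le> of_nat N * area F" if Z: "sep Z" for Z
  proof -
    have thick: "\<And>z. z \<in> Z \<Longrightarrow> thick e z" and "finite Z" using Z by (auto simp: sep_def)
    have pos: "0 < Im z" if "z \<in> Z" for z using thick[OF that] by (simp add: thick_def)
    have disj: "disjoint_family_on box_at Z"
    proof (unfold disjoint_family_on_def, intro ballI impI)
      fix z z' assume "z \<in> Z" "z' \<in> Z" "z \<noteq> z'"
      then have "mob (mat 1) ` box_at z \<inter> box_at z' = {}" using Z one_G unfolding sep_def by blast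
      then show "box_at z \<inter> box_at z' = {}" by simp
    qed
    have "of_nat (card Z) * area unit_box = (\<Sum>z\<in>Z. area (box_at z))"
      using box_at_properties(1)[OF pos] by simp
    also have "\<dots> = area (\<Union>z\<in>Z. box_at z)"
      unfolding area_def by (rule sum_emeasure) (use box_at_properties(3)[OF pos] disj \<open>finite Z\<close> in auto)
    also have "\<dots> \<le> of_nat N * area F"
    proof (rule area_le_of_bounded_multiplicity[OF countable_G det_G F cover])
      show "(\<Union>z\<in>Z. box_at z) \<subseteq> upper_half_plane" using box_at_properties(2)[OF pos] by blast
      show "(\<Union>z\<in>Z. box_at z) \<in> sets borel" using box_at_properties(3)[OF pos] \<open>finite Z\<close> by (intro sets.finite_UN) auto
      fix u assume u: "u \<in> upper_half_plane"
      show "finite {\<gamma>\<in>G. u \<in> mob \<gamma> ` (\<Union>z\<in>Z. box_at z)} \<and> card {\<gamma>\<in>G. u \<in> mob \<gamma> ` (\<Union>z\<in>Z. box_at z)} \<le> N"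
      proof (cases "{\<gamma>\<in>G. u \<in> mob \<gamma> ` (\<Union>z\<in>Z. box_at z)} = {}")
        case True show ?thesis unfolding True by simp
      next
        case False
        then obtain \<gamma>0 z0 w0 where g0: "\<gamma>0 \<in> G" "z0 \<in> Z" "w0 \<in> box_at z0" "u = mob \<gamma>0 w0" by blast
        have sub: "{\<gamma>\<in>G. u \<in> mob \<gamma> ` (\<Union>z\<in>Z. box_at z)} \<subseteq> {\<gamma>\<in>G. u \<in> mob \<gamma> ` box_at z0}"
        proof
          fix \<gamma> assume "\<gamma> \<in> {\<gamma>\<in>G. u \<in> mob \<gamma> ` (\<Union>z\<in>Z. box_at z)}"
          then obtain z w where g: "\<gamma> \<in> G" "z \<in> Z" "w \<in> box_at z" "u = mob \<gamma> w" by blast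
          have w: "0 < Im w" "0 < Im w0"
            using g(3) g0(3) box_at_properties(2)[OF pos[OF g(2)]] box_at_properties(2)[OF pos[OF g0(2)]] by (auto simp: upper_half_plane_def)
          have "mob (adj \<gamma>0 ** \<gamma>) w = w0"
            using mob_mult[of "adj \<gamma>0" \<gamma> w] mob_adj(1)[of \<gamma>0 w0] det_G g0 g w by simp
          then have "w0 \<in> mob (adj \<gamma>0 ** \<gamma>) ` box_at z" using g(3) by blast
          moreover have "adj \<gamma>0 ** \<gamma> \<in> G" using g g0 adj_G mult_G by simp
          ultimately have "z = z0" using Z g(2) g0(2,3) unfolding sep_def by blast
          then show "\<gamma> \<in> {\<gamma>\<in>G. u \<in> mob \<gamma> ` box_at z0}" using g by blast
        qed
        have "finite {\<gamma>\<in>G. u \<in> mob \<gamma> ` box_at z0} \<and> card {\<gamma>\<in>G. u \<in> mob \<gamma> ` box_at z0} \<le> N"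
          using box_at_multiplicity[OF pos[OF g0(2)] u] N thick[OF g0(2)] by (meson order_trans)
        then show ?thesis using card_mono[OF _ sub] finite_subset[OF sub] by linarith
      qed
    qed
    finally show ?thesis .
  qed
  obtain r where r: "0 < r" "area unit_box = ennreal r" using area_unit_box
    by (cases "area unit_box") auto
  obtain q where q: "0 \<le> q" "area F = ennreal q" using F(3) by (cases "area F") auto
  have card_le: "card Z \<le> nat \<lceil>real N * q / r\<rceil>" if "sep Z" for Z
  proof -
    have "ennreal (real (card Z) * r) \<le> ennreal (real N * q)"
      using bound[OF that] r q by (simp add: ennreal_mult ennreal_of_nat_eq_real_of_nat)
    then have "real (card Z) * r \<le> real N * q" using q by (simp add: ennreal_le_iff)
    then have "real (card Z) \<le> real N * q / r" using r by (simp add: field_simps)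
    then show ?thesis by linarith
  qed
  have "sep {}" by (simp add: sep_def)
  then obtain Z where Z: "sep Z" and max: "\<And>Z'. sep Z' \<Longrightarrow> card Z' \<le> card Z"
    using ex_has_greatest_nat[of sep "{}" card "nat \<lceil>real N * q / r\<rceil> + 1"] card_le by (metis less_add_one order_le_less_trans order_less_imp_le)
  have finZ: "finite Z" and pos: "\<And>z. z \<in> Z \<Longrightarrow> 0 < Im z" using Z by (auto simp: sep_def thick_def)
  \<comment> \<open>The points \<open>M i\<close> with \<open>norm M \<le> 7\<close>, by \<open>norm_eq_mob_i\<close>; the inequality already implies \<open>Im w > 0\<close>.\<close>
  define K0 where "K0 = {w. 1 + (cmod w)\<^sup>2 \<le> 49 * Im w}"
  have K0: "compact K0"
    unfolding compact_eq_bounded_closed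
  proof
    have "cmod w \<le> 49" if "w \<in> K0" for w
    proof -
      have "cmod w * cmod w \<le> 49 * cmod w" using that abs_Im_le_cmod[of w] by (simp add: K0_def power2_eq_square)
      then show ?thesis using mult_le_cancel_right_pos[of "cmod w" "cmod w" 49] by (cases "w = 0") auto
    qed
    then show "bounded K0" by (auto simp: bounded_iff)
    show "closed K0" unfolding K0_def by (intro closed_Collect_le continuous_intros)
  qed
  have K0H: "0 < Im w" if "w \<in> K0" for w
    using that zero_le_power2[of "cmod w"] unfolding K0_def mem_Collect_eq by linarith
  show ?thesis
  proof (intro exI[of _ "\<Union>z\<in>Z. mob (frame z) ` K0"] conjI allI impI)
    have "continuous_on K0 (mob (frame z))" if "z \<in> Z" for z
    proof -
      have "K0 \<subseteq> upper_half_plane" using K0H by (auto simp: upper_half_plane_def)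
      then show ?thesis
        using holomorphic_on_imp_continuous_on[OF mob_holomorphic[of "frame z"]] pos[OF that] by (auto intro: continuous_on_subset)
    qed
    then show "compact (\<Union>z\<in>Z. mob (frame z) ` K0)"
      by (intro compact_UN finZ compact_continuous_image K0)
    show "(\<Union>z\<in>Z. mob (frame z) ` K0) \<subseteq> upper_half_plane"
      using K0H pos Im_mob_pos by (auto simp: upper_half_plane_def)
    fix \<tau> assume t: "thick e \<tau>"
    then have pt: "0 < Im \<tau>" by (simp add: thick_def)
    have "\<exists>z\<in>Z. \<exists>\<gamma>\<in>G. mob \<gamma> ` box_at \<tau> \<inter> box_at z \<noteq> {}"
    proof (rule ccontr)
      assume no: "\<not> (\<exists>z\<in>Z. \<exists>\<gamma>\<in>G. mob \<gamma> ` box_at \<tau> \<inter> box_at z \<noteq> {})"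
      have "\<tau> \<notin> Z"
      proof
        assume "\<tau> \<in> Z"
        moreover have "\<tau> \<in> mob (mat 1) ` box_at \<tau> \<inter> box_at \<tau>" using box_at_properties(4)[OF pt] by simp
        ultimately show False using no one_G by blast
      qed
      have no': "mob \<gamma> ` box_at z \<inter> box_at \<tau> = {}" if "z \<in> Z" "\<gamma> \<in> G" for z \<gamma>
      proof (rule ccontr)
        assume "mob \<gamma> ` box_at z \<inter> box_at \<tau> \<noteq> {}"
        then obtain w where w: "w \<in> box_at z" "mob \<gamma> w \<in> box_at \<tau>" by blast
        have "mob (adj \<gamma>) (mob \<gamma> w) = w"
          using mob_adj(1)[OF det_G[OF that(2)]] w(1) box_at_properties(2)[OF pos[OF that(1)]] by (auto simp: upper_half_plane_def)
        then have "w \<in> mob (adj \<gamma>) ` box_at \<tau> \<inter> box_at z" using w by (metis IntI imageI)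
        then show False using no that adj_G by blast
      qed
      have "sep (insert \<tau> Z)"
        unfolding sep_def
      proof (intro conjI ballI impI)
        show "finite (insert \<tau> Z)" using finZ by simp
        show "thick e z" if "z \<in> insert \<tau> Z" for z using that t Z by (auto simp: sep_def)
        fix z z' \<gamma> assume "z \<in> insert \<tau> Z" "z' \<in> insert \<tau> Z" "\<gamma> \<in> G" "z \<noteq> z'"
        then consider "z = \<tau>" "z' \<in> Z" | "z \<in> Z" "z' = \<tau>" | "z \<in> Z" "z' \<in> Z" by blast
        then show "mob \<gamma> ` box_at z \<inter> box_at z' = {}"
        proof cases
          case 1 then show ?thesis using no \<open>\<gamma> \<in> G\<close> by blast
        next
          case 2 then show ?thesis using no' \<open>\<gamma> \<in> G\<close> by blast
        next
          case 3 then show ?thesis using Z \<open>\<gamma> \<in> G\<close> \<open>z \<noteq> z'\<close> unfolding sep_def by blast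
        qed
      qed
      then show False using max[of "insert \<tau> Z"] \<open>\<tau> \<notin> Z\<close> finZ by simp
    qed
    then obtain z \<gamma> w where w: "z \<in> Z" "\<gamma> \<in> G" "w \<in> box_at \<tau>" "mob \<gamma> w \<in> box_at z" by blast
    let ?M = "adj (frame z) ** \<gamma> ** frame \<tau>"
    have "norm ?M \<le> 7" by (rule box_at_meet[OF w(2) pt pos[OF w(1)] w(3,4)])
    then have n49: "(norm ?M)\<^sup>2 \<le> 49" using power_mono[of "norm ?M" 7 2] by simp
    have dz: "det (frame z) = 1" "det (frame \<tau>) = 1" "det \<gamma> = 1" using pos[OF w(1)] pt det_G[OF w(2)] by simp_all
    then have dM: "det ?M = 1" by (simp add: det_mul)
    have IM: "0 < Im (mob ?M \<i>)" using Im_mob_pos[OF dM] by simp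
    have "mob ?M \<i> \<in> K0" using n49 IM unfolding norm_eq_mob_i[OF dM] K0_def by (simp add: field_simps)
    moreover have "mob (frame z) (mob ?M \<i>) = mob \<gamma> \<tau>"
    proof -
      have "mob (frame z) (mob ?M \<i>) = mob (frame z ** ?M) \<i>"
        using mob_mult[OF dz(1) dM, of \<i>] by simp
      also have "frame z ** ?M = \<gamma> ** frame \<tau>"
        using mult_adj_assoc(1)[OF dz(1), of "\<gamma> ** frame \<tau>"] by (simp only: matrix_mul_assoc)
      also have "mob (\<gamma> ** frame \<tau>) \<i> = mob \<gamma> \<tau>"
        using mob_mult[OF dz(3,2), of \<i>] pt by simp
      finally show ?thesis .
    qed
    ultimately show "\<exists>\<gamma>\<in>G. mob \<gamma> \<tau> \<in> (\<Union>z\<in>Z. mob (frame z) ` K0)"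
      using w(1,2) by (metis UN_iff imageI)
  qed
qed

end

section \<open>Infinitely many values of X\<close>

text \<open>Vertical stretching is right multiplication by a diagonal matrix when the half-plane is identified with the
  group of real affine maps; left multiplications commute with it, but it does not preserve the invariant area.\<close>

definition stretch :: "real \<Rightarrow> complex \<Rightarrow> complex" where
  "stretch t z = Complex (Re z) (t * Im z)"

lemma stretch_Re_Im [simp]: "Re (stretch t z) = Re z" "Im (stretch t z) = t * Im z"
  by (simp_all add: stretch_def)

lemma stretch_measurable [measurable]: "stretch t \<in> borel \<rightarrow>\<^sub>M borel"
proof -
  have "continuous_on UNIV (\<lambda>z. of_real (Re z) + of_real (t * Im z) * \<i>)"
    by (intro continuous_intros)
  moreover have "stretch t = (\<lambda>z. of_real (Re z) + of_real (t * Im z) * \<i>)"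
    by (rule ext) (simp add: complex_eq_iff)
  ultimately show ?thesis by (simp add: borel_measurable_continuous_onI)
qed

lemma area_stretch_vimage:
  assumes "0 < t" "S \<in> sets borel"
  shows "area (stretch t -` S) = ennreal t * area S"
proof -
  define T where "T = (\<lambda>z::complex. 0 + (\<Sum>b\<in>Basis. ((if b = 1 then 1 else t) * (z \<bullet> b)) *\<^sub>R b))"
  have T: "T = stretch t"
    by (rule ext) (simp add: T_def Basis_complex_def complex_eq_iff)
  have "(lborel :: complex measure) = density (distr lborel borel T) (\<lambda>_. (\<Prod>b\<in>Basis. \<bar>if b = (1::complex) then 1 else t\<bar>))"
    unfolding T_def by (rule lborel_affine_euclidean[of "\<lambda>b. if b = 1 then 1 else t" 0]) (use assms in simp)
  also have "(\<Prod>b\<in>Basis. \<bar>if b = (1::complex) then 1 else t\<bar>) = t"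
    using assms by (simp add: Basis_complex_def complex_eq_iff)
  finally have L: "(lborel :: complex measure) = density (distr lborel borel (stretch t)) (\<lambda>_. ennreal t)"
    unfolding T .
  have V: "stretch t -` S \<in> sets borel"
    using measurable_sets[OF stretch_measurable assms(2)] by simp
  have "area S = (\<integral>\<^sup>+z. ennreal (1 / (Im z)\<^sup>2) * indicator S z \<partial>lborel)"
    unfolding area_def hyperbolic_area_def using assms by (subst emeasure_density) auto
  also have "\<dots> = (\<integral>\<^sup>+z. ennreal t * (ennreal (1 / (Im (stretch t z))\<^sup>2) * indicator S (stretch t z)) \<partial>lborel)"
    using assms(2) by (subst L, subst nn_integral_density, simp, simp, subst nn_integral_distr) auto
  also have "\<dots> = (\<integral>\<^sup>+z. ennreal (1 / t) * (ennreal (1 / (Im z)\<^sup>2) * indicator (stretch t -` S) z) \<partial>lborel)"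
  proof (rule nn_integral_cong)
    fix z :: complex
    have "t * (1 / (t * Im z)\<^sup>2) = 1 / t * (1 / (Im z)\<^sup>2)"
      using assms(1) by (simp add: power2_eq_square)
    then have "ennreal t * ennreal (1 / (t * Im z)\<^sup>2) = ennreal (1 / t) * ennreal (1 / (Im z)\<^sup>2)"
      using assms(1) by (simp add: ennreal_mult[symmetric])
    then show "ennreal t * (ennreal (1 / (Im (stretch t z))\<^sup>2) * indicator S (stretch t z)) =
       ennreal (1 / t) * (ennreal (1 / (Im z)\<^sup>2) * indicator (stretch t -` S) z)"
      by (simp add: mult.assoc[symmetric] indicator_def)
  qed
  also have "\<dots> = ennreal (1 / t) * (\<integral>\<^sup>+z. ennreal (1 / (Im z)\<^sup>2) * indicator (stretch t -` S) z \<partial>lborel)"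
    using V by (intro nn_integral_cmult borel_measurable_times_ennreal borel_measurable_indicator) simp_all
  also have "(\<integral>\<^sup>+z. ennreal (1 / (Im z)\<^sup>2) * indicator (stretch t -` S) z \<partial>lborel) = area (stretch t -` S)"
    unfolding area_def hyperbolic_area_def using V by (subst emeasure_density) auto
  finally have "ennreal t * area S = (ennreal t * ennreal (1 / t)) * area (stretch t -` S)"
    by (simp add: mult.assoc)
  also have "ennreal t * ennreal (1 / t) = 1"
    using assms(1) by (simp add: ennreal_mult[symmetric])
  finally show ?thesis by simp
qed

lemma mob_upper_triangular:
  assumes "det A = 1" "A$2$1 = 0"
  shows "mob A \<tau> = of_real ((A$1$1)\<^sup>2) * \<tau> + of_real (A$1$1 * A$1$2)"
proof -
  have ad: "A$1$1 * A$2$2 = 1" using det_one_entries[OF assms(1)] assms(2) by simp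
  then have "complex_of_real (A$1$1) * of_real (A$2$2) = 1" by (metis of_real_1 of_real_mult)
  moreover from this have nz: "complex_of_real (A$2$2) \<noteq> 0" by auto
  ultimately have "1 / complex_of_real (A$2$2) = of_real (A$1$1)" by (simp add: divide_eq_eq)
  then have "x / complex_of_real (A$2$2) = of_real (A$1$1) * x" for x by (metis divide_inverse inverse_eq_divide mult.commute)
  then show ?thesis by (simp add: mob_eq j_def assms(2) power2_eq_square algebra_simps)
qed

lemma mob_stretch:
  assumes "det A = 1" "A$2$1 = 0"
  shows "mob A (stretch t \<tau>) = stretch t (mob A \<tau>)"
  unfolding mob_upper_triangular[OF assms] by (simp add: complex_eq_iff power2_eq_square)

context discrete_group
begin

text \<open>Equality of \<open>X \<gamma> \<tau>\<close> and \<open>X r \<tau>\<close> means that the bottom rows of \<open>\<gamma>\<close> and \<open>r\<close> are proportional, that is, \<open>\<gamma> r\<^sup>-\<^sup>1\<close> is upper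
  triangular. With finitely many representatives \<open>r\<close>, the set \<open>F0 = (\<Union>r. r F)\<close> has finite area and covers the
  half-plane modulo the upper triangular subgroup \<open>G0\<close>. So does every preimage of \<open>F0\<close> under a stretch,
  and such preimages have arbitrarily small area, while a box of positive area meets each orbit boundedly often.\<close>

lemma infinite_X_values:
  assumes F: "F \<subseteq> upper_half_plane" "F \<in> sets borel" "area F < \<infinity>"
    and cover: "\<And>\<tau>. \<tau> \<in> upper_half_plane \<Longrightarrow> \<exists>\<gamma>\<in>G. mob \<gamma> \<tau> \<in> F"
    and t0: "0 < Im \<tau>0"
  shows "infinite ((\<lambda>\<gamma>. X \<gamma> \<tau>0) ` G)"
proof
  assume fin: "finite ((\<lambda>\<gamma>. X \<gamma> \<tau>0) ` G)"
  then obtain R where R: "finite R" "R \<subseteq> G" "(\<lambda>\<gamma>. X \<gamma> \<tau>0) ` G = (\<lambda>\<gamma>. X \<gamma> \<tau>0) ` R"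
    using finite_subset_image[OF fin subset_refl] by blast
  define F0 where "F0 = (\<Union>r\<in>R. mob r ` F)"
  define G0 where "G0 = {\<gamma>\<in>G. \<gamma>$2$1 = 0}"
  have F0: "F0 \<subseteq> upper_half_plane" "F0 \<in> sets borel" "area F0 < \<infinity>"
  proof -
    have RG: "det r = 1" if "r \<in> R" for r using R(2) det_G that by blast
    show "F0 \<subseteq> upper_half_plane" unfolding F0_def upper_half_plane_def
      using F(1) Im_mob_pos[OF RG] by (auto simp: upper_half_plane_def)
    show "F0 \<in> sets borel" unfolding F0_def
      using mob_image_borel[OF RG F(1,2)] R(1) by (intro sets.finite_UN) auto
    have "area F0 \<le> (\<Sum>r\<in>R. area (mob r ` F))"
      unfolding F0_def area_def using mob_image_borel[OF RG F(1,2)] R(1)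
      by (intro emeasure_subadditive_finite) auto
    also have "\<dots> = of_nat (card R) * area F"
      using area_mob_image[OF RG F] by simp
    also have "\<dots> < \<infinity>" using F(3) by (simp add: ennreal_mult_less_top of_nat_less_top)
    finally show "area F0 < \<infinity>" .
  qed
  have cover0: "\<exists>\<gamma>\<in>G0. mob \<gamma> \<tau> \<in> F0" if t: "\<tau> \<in> upper_half_plane" for \<tau>
  proof -
    obtain \<gamma> where g: "\<gamma> \<in> G" "mob \<gamma> \<tau> \<in> F" using cover[OF t] by blast
    have "X (adj \<gamma>) \<tau>0 \<in> (\<lambda>\<gamma>. X \<gamma> \<tau>0) ` R" using R(3) adj_G[OF g(1)] by blast
    then obtain r where r: "r \<in> R" "X (adj \<gamma>) \<tau>0 = X r \<tau>0" by blast
    have rG: "r \<in> G" using r R by blast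
    have nz: "j (adj \<gamma>) \<tau>0 \<noteq> 0" "j r \<tau>0 \<noteq> 0"
      using j_nonzero[OF det_G t0] adj_G[OF g(1)] rG by blast+
    have "of_real ((adj \<gamma>)$2$1) * j r \<tau>0 = of_real (r$2$1) * j (adj \<gamma>) \<tau>0"
      using r(2) unfolding X_def frac_eq_eq[OF nz] .
    then have "complex_of_real ((adj \<gamma>)$2$1 * r$2$2) = of_real (r$2$1 * (adj \<gamma>)$2$2)"
      unfolding j_def by (simp add: algebra_simps)
    then have e: "(adj \<gamma>)$2$1 * r$2$2 = r$2$1 * (adj \<gamma>)$2$2" by (simp only: of_real_eq_iff)
    have "r ** \<gamma> \<in> G" using rG g mult_G by blast
    moreover have "(r ** \<gamma>)$2$1 = 0" using e by (simp add: mult.commute)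
    moreover have "mob (r ** \<gamma>) \<tau> \<in> F0"
      using mob_mult[OF det_G[OF rG] det_G[OF g(1)], of \<tau>] t g(2) r(1) unfolding F0_def upper_half_plane_def by auto
    ultimately show ?thesis unfolding G0_def by blast
  qed
  have G0: "countable G0" "\<And>\<gamma>. \<gamma> \<in> G0 \<Longrightarrow> det \<gamma> = 1"
    using countable_G det_G unfolding G0_def by (auto intro: countable_subset)
  let ?near = "{A\<in>framed \<i>. norm A \<le> 7}"
  have frame_i: "frame \<i> = mat 1" by (simp add: frame_def mat2_eq_iff)
  have fin7: "finite ?near" using finite_norm_le[of 7] unfolding framed_def frame_i by simp
  have key: "area (box_at \<i>) \<le> of_nat (card ?near) * (ennreal s * area F0)" if s: "0 < s" for s
  proof -
    have V: "stretch s -` F0 \<subseteq> upper_half_plane" "stretch s -` F0 \<in> sets borel"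
      using F0(1) s measurable_sets[OF stretch_measurable F0(2)]
      by (auto simp: upper_half_plane_def subset_iff zero_less_mult_iff dest: spec)
    have "area (box_at \<i>) \<le> of_nat (card ?near) * area (stretch s -` F0)"
    proof (rule area_le_of_bounded_multiplicity[OF G0 V])
      show "area (stretch s -` F0) < \<infinity>"
        unfolding area_stretch_vimage[OF s F0(2)] using F0(3) by (simp add: ennreal_mult_less_top)
      show "box_at \<i> \<subseteq> upper_half_plane" "box_at \<i> \<in> sets borel" using box_at_properties[of \<i>] by simp_all
      show "\<exists>\<gamma>\<in>G0. mob \<gamma> \<tau> \<in> stretch s -` F0" if "\<tau> \<in> upper_half_plane" for \<tau>
      proof -
        have "stretch s \<tau> \<in> upper_half_plane" using that s by (simp add: upper_half_plane_def)
        then obtain \<gamma> where g: "\<gamma> \<in> G0" "mob \<gamma> (stretch s \<tau>) \<in> F0" using cover0 by blast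
        moreover have "mob \<gamma> (stretch s \<tau>) = stretch s (mob \<gamma> \<tau>)"
          using mob_stretch G0(2)[OF g(1)] g(1) unfolding G0_def by blast
        ultimately show ?thesis by auto
      qed
      fix u assume u: "u \<in> upper_half_plane"
      have "finite {\<gamma>\<in>G. u \<in> mob \<gamma> ` box_at \<i>} \<and> card {\<gamma>\<in>G. u \<in> mob \<gamma> ` box_at \<i>} \<le> card ?near"
        by (rule box_at_multiplicity[OF _ u fin7]) simp
      moreover have "{\<gamma>\<in>G0. u \<in> mob \<gamma> ` box_at \<i>} \<subseteq> {\<gamma>\<in>G. u \<in> mob \<gamma> ` box_at \<i>}" unfolding G0_def by blast
      ultimately show "finite {\<gamma>\<in>G0. u \<in> mob \<gamma> ` box_at \<i>} \<and> card {\<gamma>\<in>G0. u \<in> mob \<gamma> ` box_at \<i>} \<le> card ?near"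
        by (meson card_mono finite_subset order_trans)
    qed
    then show ?thesis unfolding area_stretch_vimage[OF s F0(2)] .
  qed
  obtain a where a: "0 < a" "area (box_at \<i>) = ennreal a"
  proof -
    have "0 < area (box_at \<i>)" "area (box_at \<i>) < \<infinity>" using area_unit_box box_at_properties(1)[of \<i>] by simp_all
    then show thesis using that by (cases "area (box_at \<i>)") auto
  qed
  obtain q where q: "0 \<le> q" "area F0 = ennreal q" using F0(3) by (cases "area F0") auto
  define n where "n = real (card ?near)"
  have "a \<le> n * (s * q)" if "0 < s" for s
  proof -
    have "ennreal a \<le> ennreal (n * (s * q))"
      using key[OF that] that q unfolding a(2) q(2) n_def
      by (simp add: ennreal_mult ennreal_of_nat_eq_real_of_nat)
    moreover have "0 \<le> n * (s * q)" using that q by (simp add: n_def)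
    ultimately show ?thesis by (simp add: ennreal_le_iff)
  qed
  \<comment> \<open>A stretch factor that makes the right-hand side at most \<open>a / 2\<close>.\<close>
  from this[of "a / (2 * (n * q + 1))"] have *: "a \<le> n * (a / (2 * (n * q + 1)) * q)"
    using a q by (simp add: n_def add_nonneg_pos)
  have nq: "0 \<le> n * q" using q by (simp add: n_def)
  have "n * (a / (2 * (n * q + 1)) * q) = a * ((n * q) / (2 * (n * q + 1)))" by simp
  also have "\<dots> \<le> a * (1/2)" using a nq by (intro mult_left_mono) (simp_all add: divide_le_eq)
  finally have "n * (a / (2 * (n * q + 1)) * q) \<le> a * (1/2)" .
  from order_trans[OF * this] show False using a by simp
qed

end

section \<open>Thin components\<close>

text \<open>With \<open>a = A - 1\<close> and \<open>b = B - 1\<close> the commutator minus 1 is \<open>(ab - ba) A\<^sup>-\<^sup>1 B\<^sup>-\<^sup>1\<close>, which is of second order in \<open>a\<close> and \<open>b\<close>.\<close>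

lemma norm_commutator_less:
  fixes A B :: "real^2^2"
  assumes d: "det A = 1" "det B = 1" and n: "norm (A - mat 1) \<le> 1/8" "norm (B - mat 1) \<le> 1/8" and "A \<noteq> mat 1"
  shows "norm (A ** B ** adj A ** adj B - mat 1) < norm (A - mat 1)"
proof -
  let ?a = "A - mat 1" and ?b = "B - mat 1"
  have "A ** B ** adj A ** adj B - mat 1 = (A ** B - B ** A) ** adj A ** adj B"
  proof -
    have "(A ** B - B ** A) ** (adj A ** adj B) = A ** B ** (adj A ** adj B) - B ** A ** (adj A ** adj B)"
      by (simp add: mat2_eq_iff algebra_simps)
    also have "B ** A ** (adj A ** adj B) = B ** (A ** (adj A ** adj B))" by (simp only: matrix_mul_assoc)
    also have "\<dots> = mat 1" unfolding mult_adj_assoc(1)[OF d(1)] by (rule mult_adj(1)[OF d(2)])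
    finally show ?thesis by (simp only: matrix_mul_assoc)
  qed
  also have "A ** B - B ** A = ?a ** ?b - ?b ** ?a"
    by (simp add: mat2_eq_iff algebra_simps)
  finally have e: "A ** B ** adj A ** adj B - mat 1 = (?a ** ?b - ?b ** ?a) ** adj A ** adj B" .
  \<comment> \<open>The constant 1/8 is small enough because \<open>1/4 * 1.55\<^sup>2 < 1\<close>.\<close>
  have s2: "sqrt 2 \<le> 1.42" by (rule real_le_lsqrt) (simp_all add: power2_eq_square)
  have nA: "norm A \<le> 1.55" "norm B \<le> 1.55"
    using norm_triangle_ineq[of ?a "mat 1"] norm_triangle_ineq[of ?b "mat 1"] n s2 by (simp_all add: norm_mat_1)
  have "norm (?a ** ?b - ?b ** ?a) \<le> norm ?a * norm ?b + norm ?b * norm ?a"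
    using norm_triangle_ineq4[of "?a ** ?b" "?b ** ?a"] norm_mat2_mult[of ?a ?b] norm_mat2_mult[of ?b ?a] by linarith
  also have "\<dots> \<le> norm ?a * (1/4)" using mult_left_mono[OF n(2) norm_ge_zero[of ?a]] by (simp add: mult.commute)
  finally have c: "norm (?a ** ?b - ?b ** ?a) \<le> norm ?a * (1/4)" .
  have "norm ((?a ** ?b - ?b ** ?a) ** adj A ** adj B) \<le> norm (?a ** ?b - ?b ** ?a) * norm A * norm B"
    using norm_mat2_mult[of "(?a ** ?b - ?b ** ?a) ** adj A" "adj B"] norm_mat2_mult[of "?a ** ?b - ?b ** ?a" "adj A"]
    by (simp add: order_trans mult_right_mono)
  also have "\<dots> \<le> norm ?a * (1/4) * 1.55 * 1.55"
    using c nA by (intro mult_mono) auto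
  also have "\<dots> < norm ?a"
    using \<open>A \<noteq> mat 1\<close> by simp
  finally show ?thesis unfolding e .
qed

text \<open>The quadratic form \<open>j A \<tau> * (\<tau> - mob A \<tau>)\<close>, whose zeros are the fixed points of \<open>A\<close>.\<close>

definition fixed_form :: "real^2^2 \<Rightarrow> complex \<Rightarrow> complex" where
  "fixed_form A \<tau> = of_real (A$2$1) * \<tau>\<^sup>2 + of_real (A$2$2 - A$1$1) * \<tau> - of_real (A$1$2)"

text \<open>A matrix that commutes with a non-scalar \<open>A\<close> is a linear combination of \<open>1\<close> and \<open>A\<close>, and scalars have zero fixed form.\<close>

lemma commuting_fixed_form_proportional:
  fixes A B :: "real^2^2"
  assumes "det A = 1" "A \<noteq> mat 1" "A \<noteq> - mat 1" "A ** B = B ** A"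
  shows "\<exists>l. B$2$1 = l * A$2$1 \<and> B$2$2 - B$1$1 = l * (A$2$2 - A$1$1) \<and> B$1$2 = l * A$1$2"
proof -
  have e: "A$1$1 * B$1$1 + A$1$2 * B$2$1 = B$1$1 * A$1$1 + B$1$2 * A$2$1"
      "A$1$1 * B$1$2 + A$1$2 * B$2$2 = B$1$1 * A$1$2 + B$1$2 * A$2$2"
      "A$2$1 * B$1$1 + A$2$2 * B$2$1 = B$2$1 * A$1$1 + B$2$2 * A$2$1"
    using assms(4) unfolding mat2_eq_iff mat2_mult_entries by simp_all
  consider "A$2$1 \<noteq> 0" | "A$1$2 \<noteq> 0" | "A$2$2 - A$1$1 \<noteq> 0" | "A$2$1 = 0" "A$1$2 = 0" "A$2$2 = A$1$1" by fastforce
  then show ?thesis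
  proof cases
    case 1
    then show ?thesis using e by (intro exI[of _ "B$2$1 / A$2$1"]) (simp add: field_simps)
  next
    case 2
    then show ?thesis using e by (intro exI[of _ "B$1$2 / A$1$2"]) (simp add: field_simps)
  next
    case 3
    then show ?thesis using e by (intro exI[of _ "(B$2$2 - B$1$1) / (A$2$2 - A$1$1)"]) (simp add: field_simps)
  next
    case 4
    then have "(A$1$1)\<^sup>2 = 1" using det_one_entries[OF assms(1)] by (simp add: power2_eq_square)
    then have "A$1$1 = 1 \<or> A$1$1 = - 1" by (simp add: power2_eq_1_iff)
    then show ?thesis using 4 assms(2,3) by (auto simp: mat2_eq_iff)
  qed
qed

lemma finite_attains_min:
  fixes f :: "'a \<Rightarrow> real"
  assumes "finite S" "S \<noteq> {}"
  shows "\<exists>a\<in>S. \<forall>c\<in>S. f a \<le> f c"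
proof -
  have "Min (f ` S) \<in> f ` S" using assms by (intro Min_in) auto
  then obtain a where a: "a \<in> S" "Min (f ` S) = f a" by (rule imageE) simp
  have "f a \<le> f c" if "c \<in> S" for c
    unfolding a(2)[symmetric] using assms(1) that by (intro Min_le) auto
  then show ?thesis using a(1) by (intro bexI[of _ a] ballI)
qed

context discrete_group
begin

text \<open>As a function of \<open>\<tau>\<close> the displacement depends only on \<open>|fixed_form A \<tau>| / Im \<tau>\<close>; the trace contributes a constant.\<close>

lemma displacement_sq:
  assumes "0 < Im \<tau>" "det A = 1"
  shows "(displacement A \<tau>)\<^sup>2 = (cmod (fixed_form A \<tau>))\<^sup>2 / (Im \<tau>)\<^sup>2 + 4 - 2 * (A$1$1 + A$2$2)"
proof -
  define x y s a b c d where defs: "x = Re \<tau>" "y = Im \<tau>" "s = sqrt (Im \<tau>)" "a = A$1$1" "b = A$1$2" "c = A$2$1" "d = A$2$2"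
  have y: "0 < y" "s * s = y" "s \<noteq> 0" using assms by (simp_all add: defs)
  define p where "p = c * x\<^sup>2 + (d - a) * x - b"
  define M where "M = adj (frame \<tau>) ** A ** frame \<tau>"
  have M: "M$1$1 = a - x * c" "M$1$2 = - p / y" "M$2$1 = c * y" "M$2$2 = c * x + d"
  proof -
    have "M$1$1 = (1 / s * a + - (x / s) * c) * s" "M$1$2 = (1 / s * a + - (x / s) * c) * (x / s) + (1 / s * b + - (x / s) * d) * (1 / s)"
       "M$2$1 = s * c * s" "M$2$2 = s * c * (x / s) + s * d * (1 / s)"
      by (simp_all add: M_def frame_def defs)
    moreover have "(1 / s * a + - (x / s) * c) * s = a - x * c" "s * c * (x / s) + s * d * (1 / s) = c * x + d"
      using y(3) by (simp_all add: field_simps)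
    moreover have "(1 / s * a + - (x / s) * c) * (x / s) + (1 / s * b + - (x / s) * d) * (1 / s) = - p / (s * s)"
      using y(3) by (simp add: p_def divide_simps) (simp add: algebra_simps power2_eq_square)
    moreover have "s * c * s = c * (s * s)" by simp
    ultimately show "M$1$1 = a - x * c" "M$1$2 = - p / y" "M$2$1 = c * y" "M$2$2 = c * x + d"
      unfolding y(2) by simp_all
  qed
  have det: "(a - x * c) * (c * x + d) + p * c = 1"
  proof -
    have "(a - x * c) * (c * x + d) + p * c = a * d - b * c" by (simp add: p_def algebra_simps power2_eq_square)
    then show ?thesis using det_one_entries[OF assms(2)] by (simp add: defs)
  qed
  have Q: "Re (fixed_form A \<tau>) = p - c * y\<^sup>2" "Im (fixed_form A \<tau>) = y * (2 * c * x + d - a)"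
    by (simp_all add: fixed_form_def p_def defs power2_eq_square algebra_simps)
  have "(cmod (fixed_form A \<tau>))\<^sup>2 / y\<^sup>2 = ((p - c * y\<^sup>2) / y)\<^sup>2 + (2 * c * x + d - a)\<^sup>2"
    unfolding cmod_power2 Q using y(1) by (simp add: add_divide_distrib power_mult_distrib power_divide)
  also have "((p - c * y\<^sup>2) / y)\<^sup>2 = (- p / y)\<^sup>2 - 2 * p * c + (c * y)\<^sup>2"
    using y by (simp add: field_simps power2_eq_square)
  finally have q2: "(cmod (fixed_form A \<tau>))\<^sup>2 / y\<^sup>2 = (- p / y)\<^sup>2 - 2 * p * c + (c * y)\<^sup>2 + (2 * c * x + d - a)\<^sup>2" .
  have "(displacement A \<tau>)\<^sup>2 = (a - x * c - 1)\<^sup>2 + (- p / y)\<^sup>2 + (c * y)\<^sup>2 + (c * x + d - 1)\<^sup>2"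
    unfolding displacement_def M_def[symmetric] norm_mat2_sq by (simp add: M)
  also have "(a - x * c - 1)\<^sup>2 + (- p / y)\<^sup>2 + (c * y)\<^sup>2 + (c * x + d - 1)\<^sup>2
     = (- p / y)\<^sup>2 + (c * y)\<^sup>2 + (2 * c * x + d - a)\<^sup>2 + 2 * ((a - x * c) * (c * x + d)) - 2 * (a + d) + 2"
    by (simp add: algebra_simps power2_eq_square)
  also have "\<dots> = (cmod (fixed_form A \<tau>))\<^sup>2 / y\<^sup>2 + 4 - 2 * (a + d)"
    unfolding q2 using det by simp
  finally show ?thesis unfolding defs .
qed

lemma displacement_nonneg [simp]: "0 \<le> displacement A \<tau>" by (simp add: displacement_def)

lemma displacement_minus_one: "0 < Im \<tau> \<Longrightarrow> 1/8 < displacement (- mat 1) \<tau>"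
proof (rule ccontr)
  assume t: "0 < Im \<tau>" and "\<not> 1/8 < displacement (- mat 1) \<tau>"
  then have "(displacement (- mat 1) \<tau>)\<^sup>2 \<le> (1/8)\<^sup>2" by (intro power_mono) auto
  moreover have "(displacement (- mat 1) \<tau>)\<^sup>2 = 8"
    using t by (subst displacement_sq) (simp_all add: fixed_form_def det_2)
  ultimately show False by (simp add: power_divide)
qed

lemma finite_short:
  assumes "0 < Im \<tau>"
  shows "finite {\<gamma>\<in>G. \<gamma> \<noteq> mat 1 \<and> displacement \<gamma> \<tau> \<le> 1/8}"
proof (rule finite_subset[OF _ finite_norm_le])
  show "{\<gamma>\<in>G. \<gamma> \<noteq> mat 1 \<and> displacement \<gamma> \<tau> \<le> 1/8} \<subseteq> {\<gamma>\<in>G. norm \<gamma> \<le> norm (frame \<tau>) * 2 * norm (frame \<tau>)}"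
  proof
    fix \<gamma> assume g: "\<gamma> \<in> {\<gamma>\<in>G. \<gamma> \<noteq> mat 1 \<and> displacement \<gamma> \<tau> \<le> 1/8}"
    let ?M = "adj (frame \<tau>) ** \<gamma> ** frame \<tau>"
    have d: "det (frame \<tau>) = 1" using assms by simp
    have "sqrt 2 \<le> 1.42" by (rule real_le_lsqrt) (simp_all add: power2_eq_square)
    then have M: "norm ?M \<le> 2"
      using norm_triangle_ineq[of "?M - mat 1" "mat 1"] g by (simp add: norm_mat_1 displacement_def)
    have "frame \<tau> ** ?M ** adj (frame \<tau>) = \<gamma>"
      using mult_adj_assoc(1)[OF d, of "\<gamma> ** frame \<tau> ** adj (frame \<tau>)"] mult_adj_assoc(3)[OF d, of \<gamma>]
      by (simp add: matrix_mul_assoc)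
    then have "norm \<gamma> \<le> norm (frame \<tau> ** ?M) * norm (frame \<tau>)"
      using norm_mat2_mult[of "frame \<tau> ** ?M" "adj (frame \<tau>)"] by simp
    also have "\<dots> \<le> (norm (frame \<tau>) * norm ?M) * norm (frame \<tau>)"
      by (intro mult_right_mono norm_mat2_mult norm_ge_zero)
    also have "\<dots> \<le> (norm (frame \<tau>) * 2) * norm (frame \<tau>)"
      by (intro mult_right_mono mult_left_mono M norm_ge_zero)
    finally show "\<gamma> \<in> {\<gamma>\<in>G. norm \<gamma> \<le> norm (frame \<tau>) * 2 * norm (frame \<tau>)}" using g by simp
  qed
qed

text \<open>The commutator is shorter than the shortest nontrivial element, so it is trivial.\<close>

lemma short_commute_with_shortest:
  assumes t: "0 < Im \<tau>" and A: "A \<in> G" "A \<noteq> mat 1" "displacement A \<tau> \<le> 1/8" and B: "B \<in> G" "displacement B \<tau> \<le> 1/8"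
    and min: "\<forall>C\<in>G. C \<noteq> mat 1 \<longrightarrow> displacement C \<tau> \<le> 1/8 \<longrightarrow> displacement A \<tau> \<le> displacement C \<tau>"
  shows "A ** B = B ** A"
proof -
  let ?c = "\<lambda>M. adj (frame \<tau>) ** M ** frame \<tau>"
  have d: "det (frame \<tau>) = 1" "det A = 1" "det B = 1" using t A B det_G by simp_all
  have c_mult: "?c M ** ?c N = ?c (M ** N)" for M N
    using mult_adj_assoc(1)[OF d(1), of "N ** frame \<tau>"] by (metis matrix_mul_assoc)
  have c_adj: "adj (?c M) = ?c (adj M)" for M
    by (simp add: adj_mult matrix_mul_assoc)
  have "?c A \<noteq> mat 1"
  proof
    assume "?c A = mat 1"
    then have "displacement A \<tau> = 0" by (simp add: displacement_def)
    have "frame \<tau> ** ?c A ** adj (frame \<tau>) = A"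
      using mult_adj_assoc(1)[OF d(1), of "A ** frame \<tau> ** adj (frame \<tau>)"] mult_adj_assoc(3)[OF d(1), of A]
      by (simp add: matrix_mul_assoc)
    then show False using \<open>?c A = mat 1\<close> A(2) mult_adj(1)[OF d(1)] by simp
  qed
  then have "norm (?c A ** ?c B ** adj (?c A) ** adj (?c B) - mat 1) < norm (?c A - mat 1)"
    using A B d by (intro norm_commutator_less) (simp_all add: det_mul displacement_def)
  then have lt: "displacement (A ** B ** adj A ** adj B) \<tau> < displacement A \<tau>"
    unfolding c_adj c_mult by (simp add: displacement_def)
  have "A ** B ** adj A ** adj B \<in> G" using A B mult_G adj_G by simp
  then have "A ** B ** adj A ** adj B = mat 1" using min lt A(3) by fastforce
  then have "A ** B ** adj A ** adj B ** B ** A = B ** A" by simp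
  moreover have "A ** B ** adj A ** adj B ** B ** A = A ** B"
    using mult_adj_assoc(4)[OF d(3)] mult_adj_assoc(4)[OF d(2)] by simp
  ultimately show ?thesis by simp
qed

lemma shortest_exists:
  assumes "0 < Im \<tau>" "B \<in> G" "B \<noteq> mat 1" "displacement B \<tau> \<le> 1/8"
  shows "\<exists>A\<in>G. A \<noteq> mat 1 \<and> A \<noteq> - mat 1 \<and> displacement A \<tau> \<le> 1/8 \<and>
    (\<forall>C\<in>G. C \<noteq> mat 1 \<longrightarrow> displacement C \<tau> \<le> 1/8 \<longrightarrow> displacement A \<tau> \<le> displacement C \<tau>)"
proof -
  let ?S = "{\<gamma>\<in>G. \<gamma> \<noteq> mat 1 \<and> displacement \<gamma> \<tau> \<le> 1/8}"
  have "?S \<noteq> {}" using assms by blast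
  from finite_attains_min[OF finite_short[OF assms(1)] this, of "\<lambda>C. displacement C \<tau>"]
  obtain A where A: "A \<in> ?S" "\<forall>C\<in>?S. displacement A \<tau> \<le> displacement C \<tau>" by (rule bexE)
  have "A \<noteq> - mat 1" using A(1) displacement_minus_one[OF assms(1)] by auto
  then show ?thesis using A by (intro bexI[of _ A]) simp_all
qed

text \<open>The short elements at \<open>\<tau>0\<close> commute with a shortest one \<open>A\<close>, so their fixed forms are multiples of that of \<open>A\<close>, and the region
  where such an element \<open>C\<close> is short has the form \<open>\<rho> < rad C\<close> with \<open>\<rho> = |fixed_form A|\<^sup>2 / Im\<^sup>2\<close>. The witness \<open>B\<close> is an
  element for which this region is largest. If some \<open>C\<close> were short at a boundary point of the region of \<open>B\<close>, then \<open>B\<close> and \<open>C\<close>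
  would commute with a shortest element at that point, so the fixed form of \<open>C\<close> would again be a multiple of that of
  \<open>A\<close>; then \<open>C\<close> is short at \<open>\<tau>0\<close> too and has a larger region than \<open>B\<close>.\<close>

lemma thin_component:
  assumes t0: "0 < Im \<tau>0" and e: "0 < e" "e \<le> 1/8" and thin: "\<not> thick e \<tau>0"
  shows "\<exists>B\<in>G. B \<noteq> mat 1 \<and> B \<noteq> - mat 1 \<and> displacement B \<tau>0 < e \<and> (\<forall>\<tau>1. 0 < Im \<tau>1 \<longrightarrow> displacement B \<tau>1 = e \<longrightarrow> thick e \<tau>1)"
proof -
  obtain B0 where B0: "B0 \<in> G" "B0 \<noteq> mat 1" "displacement B0 \<tau>0 < e"
    using thin t0 unfolding thick_def by force
  have "displacement B0 \<tau>0 \<le> 1/8" using B0(3) e by linarith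
  from shortest_exists[OF t0 B0(1,2) this]
  obtain A where A: "A \<in> G" "A \<noteq> mat 1" "A \<noteq> - mat 1" "displacement A \<tau>0 \<le> 1/8"
    and Amin: "\<forall>C\<in>G. C \<noteq> mat 1 \<longrightarrow> displacement C \<tau>0 \<le> 1/8 \<longrightarrow> displacement A \<tau>0 \<le> displacement C \<tau>0"
    by (elim bexE conjE)
  define parallel where "parallel = (\<lambda>l A' (B::real^2^2). B$2$1 = l * A'$2$1 \<and> B$2$2 - B$1$1 = l * (A'$2$2 - A'$1$1) \<and> B$1$2 = l * (A'::real^2^2)$1$2)"
  have fixed_form_parallel: "fixed_form B \<tau> = of_real l * fixed_form A' \<tau>" if "parallel l A' B" for l A' B \<tau>
    using that unfolding parallel_def fixed_form_def by (simp only: of_real_mult) (simp add: algebra_simps)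
  have parallel_nonzero: "l \<noteq> 0" if "parallel l A' B" "det B = 1" "B \<noteq> mat 1" "B \<noteq> - mat 1" for l A' B
  proof
    assume "l = 0"
    then have z: "B$2$1 = 0" "B$1$2 = 0" "B$2$2 = B$1$1" using that(1) by (simp_all add: parallel_def)
    then have "(B$1$1)\<^sup>2 = 1" using det_one_entries[OF that(2)] by (simp add: power2_eq_square)
    then have "B$1$1 = 1 \<or> B$1$1 = - 1" by (simp add: power2_eq_1_iff)
    then show False using z that(3,4) by (auto simp: mat2_eq_iff)
  qed
  have parallel_ex: "\<exists>l. parallel l A B" if "B \<in> G" "displacement B \<tau>0 \<le> 1/8" for B
    using commuting_fixed_form_proportional[OF det_G[OF A(1)] A(2,3)] short_commute_with_shortest[OF t0 A(1,2,4) that Amin]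
    unfolding parallel_def by blast
  define S where "S = {\<gamma>\<in>G. \<gamma> \<noteq> mat 1 \<and> displacement \<gamma> \<tau>0 < e}"
  have "S \<subseteq> {\<gamma>\<in>G. \<gamma> \<noteq> mat 1 \<and> displacement \<gamma> \<tau>0 \<le> 1/8}" using e unfolding S_def by auto
  then have finS: "finite S" using finite_short[OF t0] by (rule finite_subset)
  define lam where "lam = (\<lambda>B. SOME l. parallel l A B)"
  have lam: "parallel (lam B) A B" if "B \<in> S" for B
  proof -
    have "B \<in> G" "displacement B \<tau>0 \<le> 1/8" using that e by (simp_all add: S_def)
    then show ?thesis unfolding lam_def by (rule someI_ex[OF parallel_ex])
  qed
  \<comment> \<open>The value of \<open>\<rho>\<close> on the boundary of the region where the displacement of \<open>B\<close> is less than \<open>e\<close>.\<close>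
  define rad where "rad = (\<lambda>B. (e\<^sup>2 - 4 + 2 * (B$1$1 + B$2$2)) / (lam B)\<^sup>2)"
  have "B0 \<in> S" using B0 by (simp add: S_def)
  then have "S \<noteq> {}" by blast
  from finite_attains_min[OF finS this, of "\<lambda>B. - rad B"]
  obtain B where B: "B \<in> S" and Bmax': "\<forall>C\<in>S. - rad B \<le> - rad C" by (rule bexE)
  then have Bmax: "\<And>C. C \<in> S \<Longrightarrow> rad C \<le> rad B" by simp
  have BG: "B \<in> G" "B \<noteq> mat 1" "displacement B \<tau>0 < e" using B by (simp_all add: S_def)
  have Bm: "B \<noteq> - mat 1" using displacement_minus_one[OF t0] BG(3) e by auto
  note dB = det_G[OF BG(1)]
  have lB: "lam B \<noteq> 0" using parallel_nonzero[OF lam[OF B] dB BG(2) Bm] .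
  define \<rho> where "\<rho> = (\<lambda>\<tau>. (cmod (fixed_form A \<tau>))\<^sup>2 / (Im \<tau>)\<^sup>2)"
  have displacement_rho: "(displacement C \<tau>)\<^sup>2 = l\<^sup>2 * \<rho> \<tau> + 4 - 2 * (C$1$1 + C$2$2)"
    if "0 < Im \<tau>" "det C = 1" "parallel l A C" for C \<tau> l
    unfolding displacement_sq[OF that(1,2)] fixed_form_parallel[OF that(3)] \<rho>_def by (simp add: norm_mult power_mult_distrib)
  have rho0: "\<rho> \<tau>0 < rad B"
  proof -
    have "(displacement B \<tau>0)\<^sup>2 < e\<^sup>2" using BG(3) by (intro power_strict_mono) auto
    then have "(lam B)\<^sup>2 * \<rho> \<tau>0 < e\<^sup>2 - 4 + 2 * (B$1$1 + B$2$2)" unfolding displacement_rho[OF t0 dB lam[OF B]] by simp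
    then show ?thesis unfolding rad_def using lB by (simp add: pos_less_divide_eq mult.commute)
  qed
  have "thick e \<tau>1" if t1: "0 < Im \<tau>1" and bd: "displacement B \<tau>1 = e" for \<tau>1
  proof (rule ccontr)
    assume "\<not> thick e \<tau>1"
    then obtain C where C: "C \<in> G" "C \<noteq> mat 1" "displacement C \<tau>1 < e" using t1 unfolding thick_def by force
    note dC = det_G[OF C(1)]
    have Cm: "C \<noteq> - mat 1" using displacement_minus_one[OF t1] C(3) e by auto
    have short1: "displacement B \<tau>1 \<le> 1/8" "displacement C \<tau>1 \<le> 1/8" using bd C e by simp_all
    from shortest_exists[OF t1 BG(1,2) short1(1)]
    obtain A1 where A1: "A1 \<in> G" "A1 \<noteq> mat 1" "A1 \<noteq> - mat 1" "displacement A1 \<tau>1 \<le> 1/8"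
      and A1min: "\<forall>C\<in>G. C \<noteq> mat 1 \<longrightarrow> displacement C \<tau>1 \<le> 1/8 \<longrightarrow> displacement A1 \<tau>1 \<le> displacement C \<tau>1"
      by (elim bexE conjE)
    obtain b where b: "parallel b A1 B"
      using commuting_fixed_form_proportional[OF det_G[OF A1(1)] A1(2,3) short_commute_with_shortest[OF t1 A1(1,2,4) BG(1) short1(1) A1min]]
      unfolding parallel_def by blast
    obtain c where c: "parallel c A1 C"
      using commuting_fixed_form_proportional[OF det_G[OF A1(1)] A1(2,3) short_commute_with_shortest[OF t1 A1(1,2,4) C(1) short1(2) A1min]]
      unfolding parallel_def by blast
    have b0: "b \<noteq> 0" using parallel_nonzero[OF b dB BG(2) Bm] .
    define l where "l = c / b * lam B"
    have l: "parallel l A C"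
    proof -
      have "C$2$1 = c / b * B$2$1" "C$2$2 - C$1$1 = c / b * (B$2$2 - B$1$1)" "C$1$2 = c / b * B$1$2"
        using b c b0 by (simp_all add: parallel_def)
      then show ?thesis using lam[OF B] by (simp add: parallel_def l_def)
    qed
    have l0: "l \<noteq> 0" using parallel_nonzero[OF l dC C(2) Cm] .
    have "(lam B)\<^sup>2 * \<rho> \<tau>1 = e\<^sup>2 - 4 + 2 * (B$1$1 + B$2$2)" using displacement_rho[OF t1 dB lam[OF B]] bd by simp
    then have r1: "\<rho> \<tau>1 = rad B" unfolding rad_def using lB by (simp add: field_simps)
    have "(displacement C \<tau>1)\<^sup>2 < e\<^sup>2" using C(3) by (intro power_strict_mono) auto
    then have lt: "l\<^sup>2 * rad B < e\<^sup>2 - 4 + 2 * (C$1$1 + C$2$2)" unfolding displacement_rho[OF t1 dC l] r1 by simp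
    have "l\<^sup>2 * \<rho> \<tau>0 \<le> l\<^sup>2 * rad B" using rho0 by (intro mult_left_mono) auto
    then have "(displacement C \<tau>0)\<^sup>2 < e\<^sup>2" unfolding displacement_rho[OF t0 dC l] using lt by simp
    then have "displacement C \<tau>0 < e" by (rule power2_less_imp_less) (use e in simp)
    then have CS: "C \<in> S" using C by (simp add: S_def)
    have "lam C = l"
    proof -
      have "A$2$1 \<noteq> 0 \<or> A$2$2 - A$1$1 \<noteq> 0 \<or> A$1$2 \<noteq> 0"
        using parallel_nonzero[OF l dC C(2) Cm] parallel_nonzero[of 0 A C] l dC C(2) Cm unfolding parallel_def by auto
      then show ?thesis using lam[OF CS] l unfolding parallel_def by auto
    qed
    then have "rad C = (e\<^sup>2 - 4 + 2 * (C$1$1 + C$2$2)) / l\<^sup>2" by (simp add: rad_def)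
    moreover have "rad B < (e\<^sup>2 - 4 + 2 * (C$1$1 + C$2$2)) / l\<^sup>2"
      using lt l0 by (simp add: pos_less_divide_eq mult.commute)
    ultimately show False using Bmax[OF CS] by simp
  qed
  then show ?thesis using BG Bm by blast
qed

end

section \<open>Vanishing in negative weight\<close>

text \<open>The square of the invariant norm of a form of weight \<open>- w\<close>.\<close>

definition petersson :: "nat \<Rightarrow> (complex \<Rightarrow> complex) \<Rightarrow> complex \<Rightarrow> real" where
  "petersson w f \<tau> = (cmod (f \<tau>))\<^sup>2 / Im \<tau> ^ w"

lemma petersson_slash:
  assumes "det \<sigma> = 1" "0 < Im \<tau>"
  shows "petersson w (slash (- int w) \<sigma> f) \<tau> = petersson w f (mob \<sigma> \<tau>)"
proof -
  have nz: "cmod (j \<sigma> \<tau>) \<noteq> 0" using j_nonzero[OF assms] by simp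
  have "cmod (slash (- int w) \<sigma> f \<tau>) = cmod (j \<sigma> \<tau>) ^ w * cmod (f (mob \<sigma> \<tau>))"
    by (simp add: slash_def norm_mult norm_power)
  then show ?thesis
    unfolding petersson_def Im_mob[OF assms] using nz
    by (simp add: power_mult_distrib power_divide power2_eq_square field_simps)
qed

lemma continuous_on_petersson:
  assumes "f holomorphic_on upper_half_plane"
  shows "continuous_on upper_half_plane (petersson w f)"
proof -
  have "continuous_on upper_half_plane f" using assms by (rule holomorphic_on_imp_continuous_on)
  moreover have "\<forall>\<tau>\<in>upper_half_plane. Im \<tau> ^ w \<noteq> 0" by (simp add: upper_half_plane_def)
  ultimately show ?thesis unfolding petersson_def by (intro continuous_intros) simp_all
qed

lemma cmod_diff_cnj_sq: "(cmod (\<tau> - cnj z))\<^sup>2 = (cmod (\<tau> - z))\<^sup>2 + 4 * Im \<tau> * Im z"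
  unfolding cmod_power2 by (simp add: power2_eq_square algebra_simps)

text \<open>The function \<open>h = f / (\<tau> - cnj z)\<^sup>w\<close> is holomorphic, and \<open>|h|\<^sup>2\<close> is \<open>petersson w f\<close> times \<open>(Im \<tau> / |\<tau> - cnj z|\<^sup>2)\<^sup>w\<close>. The
  second factor has its strict maximum at \<open>\<tau> = z\<close>, so a positive local maximum of the first at \<open>z\<close> would be a strict
  local maximum of \<open>|h|\<close>.\<close>

lemma petersson_no_local_max:
  assumes f: "f holomorphic_on upper_half_plane" and w: "0 < w"
    and U: "open U" "U \<subseteq> upper_half_plane" "z \<in> U" and max: "\<And>\<tau>. \<tau> \<in> U \<Longrightarrow> petersson w f \<tau> \<le> petersson w f z"
  shows "f z = 0"
proof (rule ccontr)
  assume fz: "f z \<noteq> 0"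
  obtain r where r: "0 < r" "ball z r \<subseteq> U" using U by (auto simp: open_contains_ball)
  have posU: "0 < Im \<tau>" if "\<tau> \<in> U" for \<tau> using U(2) that by (auto simp: upper_half_plane_def)
  have z: "0 < Im z" by (rule posU[OF U(3)])
  define h where "h = (\<lambda>\<tau>. f \<tau> / (\<tau> - cnj z) ^ w)"
  have nz: "\<tau> - cnj z \<noteq> 0" if "0 < Im \<tau>" for \<tau>
  proof
    assume "\<tau> - cnj z = 0"
    then have "Im (\<tau> - cnj z) = 0" by simp
    then show False using z that by simp
  qed
  have "h holomorphic_on upper_half_plane"
    unfolding h_def by (intro holomorphic_intros f) (auto simp: upper_half_plane_def dest: nz)
  then have hU: "h holomorphic_on ball z r" using U(2) r(2) by (meson holomorphic_on_subset subset_trans)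
  have hsq: "(cmod (h \<tau>))\<^sup>2 = petersson w f \<tau> * (Im \<tau> / (cmod (\<tau> - cnj z))\<^sup>2) ^ w" if "0 < Im \<tau>" for \<tau>
    using that nz[OF that] by (simp add: h_def petersson_def norm_divide norm_power power_divide power_mult[symmetric] mult.commute)
  have hz: "(cmod (h z))\<^sup>2 = petersson w f z * (1 / (4 * Im z)) ^ w"
    unfolding hsq[OF z] cmod_diff_cnj_sq using z by simp
  have ratio: "Im \<tau> / (cmod (\<tau> - cnj z))\<^sup>2 < 1 / (4 * Im z)" if "0 < Im \<tau>" "\<tau> \<noteq> z" for \<tau>
  proof -
    have "0 < (cmod (\<tau> - z))\<^sup>2" using that(2) by simp
    moreover have "0 < 4 * Im \<tau> * Im z" using that z by simp
    moreover have "4 * Im z > 0" using z by simp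
    ultimately have "Im \<tau> * (4 * Im z) < 1 * (cmod (\<tau> - cnj z))\<^sup>2" "0 < (cmod (\<tau> - cnj z))\<^sup>2"
      unfolding cmod_diff_cnj_sq by (simp_all only: add_pos_pos) simp
    then show ?thesis using z by (simp add: frac_less_eq mult_less_0_iff divide_less_0_iff)
  qed
  have pz: "0 < petersson w f z" using fz z by (simp add: petersson_def)
  have lt: "(cmod (h \<tau>))\<^sup>2 < (cmod (h z))\<^sup>2" if "\<tau> \<in> U" "\<tau> \<noteq> z" for \<tau>
  proof -
    have p: "0 < Im \<tau>" by (rule posU[OF that(1)])
    have "(cmod (h \<tau>))\<^sup>2 \<le> petersson w f z * (Im \<tau> / (cmod (\<tau> - cnj z))\<^sup>2) ^ w"
      unfolding hsq[OF p] using p by (intro mult_right_mono max that) simp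
    also have "\<dots> < petersson w f z * (1 / (4 * Im z)) ^ w"
      using p by (intro mult_strict_left_mono power_strict_mono ratio that w pz divide_nonneg_nonneg zero_le_power2 less_imp_le[OF p] p)
    finally show ?thesis unfolding hz .
  qed
  have le: "cmod (h \<tau>) \<le> cmod (h z)" if "\<tau> \<in> ball z r" for \<tau>
  proof (cases "\<tau> = z")
    case False
    then have "(cmod (h \<tau>))\<^sup>2 \<le> (cmod (h z))\<^sup>2" using lt that r by (meson less_imp_le subsetD)
    then show ?thesis by (rule power2_le_imp_le) simp
  qed simp
  have "h constant_on ball z r"
    using maximum_modulus_principle[OF hU open_ball connected_ball open_ball subset_refl _ le] r by simp
  then obtain c where c: "\<And>\<tau>. \<tau> \<in> ball z r \<Longrightarrow> h \<tau> = c" unfolding constant_on_def by metis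
  let ?t = "z + of_real (r/2)"
  have t: "?t \<in> ball z r" "z \<in> ball z r" "?t \<noteq> z" using r(1) by (simp_all add: dist_norm)
  have "h ?t = h z" using c[OF t(1)] c[OF t(2)] by simp
  then show False using lt[of ?t] t r by auto
qed

context discrete_group
begin

lemma continuous_on_fixed_form: "continuous_on S (fixed_form A)"
  unfolding fixed_form_def by (intro continuous_intros)

lemma continuous_on_displacement:
  assumes "det A = 1"
  shows "continuous_on upper_half_plane (displacement A)"
proof -
  have "continuous_on upper_half_plane (\<lambda>\<tau>. sqrt ((cmod (fixed_form A \<tau>))\<^sup>2 / (Im \<tau>)\<^sup>2 + 4 - 2 * (A$1$1 + A$2$2)))"
    by (intro continuous_intros continuous_on_fixed_form) (simp add: upper_half_plane_def)
  moreover have "displacement A \<tau> = sqrt ((cmod (fixed_form A \<tau>))\<^sup>2 / (Im \<tau>)\<^sup>2 + 4 - 2 * (A$1$1 + A$2$2))" if "\<tau> \<in> upper_half_plane" for \<tau>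
    using displacement_sq[of \<tau> A] that assms by (simp add: upper_half_plane_def real_sqrt_unique)
  ultimately show ?thesis by (simp cong: continuous_on_cong)
qed

text \<open>The fixed form is a form of weight -2 for simultaneous conjugation of the matrix, and the trace is invariant.\<close>

lemma displacement_conj:
  assumes "det \<sigma> = 1" "det A = 1" "0 < Im \<tau>"
  shows "displacement (adj \<sigma> ** A ** \<sigma>) \<tau> = displacement A (mob \<sigma> \<tau>)"
proof -
  let ?B = "adj \<sigma> ** A ** \<sigma>"
  have q: "fixed_form C z = j C z * (z - mob C z)" if "det C = 1" "0 < Im z" for C z
  proof -
    have "j C z * mob C z = of_real (C$1$1) * z + of_real (C$1$2)"
      using j_nonzero[OF that] by (simp add: mob_eq)
    then have "j C z * (z - mob C z) = j C z * z - (of_real (C$1$1) * z + of_real (C$1$2))"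
      by (simp add: right_diff_distrib)
    then show ?thesis by (simp add: fixed_form_def j_def power2_eq_square algebra_simps)
  qed
  have dB: "det ?B = 1" using assms by (simp add: det_mul)
  define u where "u = mob ?B \<tau>"
  have u: "0 < Im u" unfolding u_def by (rule Im_mob_pos[OF dB assms(3)])
  have sB: "\<sigma> ** ?B = A ** \<sigma>"
    using mult_adj_assoc(1)[OF assms(1), of "A ** \<sigma>"] by (simp only: matrix_mul_assoc)
  have su: "mob \<sigma> u = mob A (mob \<sigma> \<tau>)"
    unfolding u_def using mob_mult[OF assms(1) dB assms(3)] mob_mult[OF assms(2,1,3)] sB by simp
  have ju: "j \<sigma> u * j ?B \<tau> = j A (mob \<sigma> \<tau>) * j \<sigma> \<tau>"
    unfolding u_def using j_mult[OF dB assms(3), of \<sigma>] j_mult[OF assms(1,3), of A] sB by simp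
  have nz: "j \<sigma> u \<noteq> 0" "j \<sigma> \<tau> \<noteq> 0" using j_nonzero[OF assms(1)] u assms(3) by auto
  have diff: "(mob \<sigma> \<tau> - mob \<sigma> u) * (j \<sigma> \<tau> * j \<sigma> u) = \<tau> - u"
  proof -
    have d: "complex_of_real (\<sigma>$1$1) * of_real (\<sigma>$2$2) = 1 + of_real (\<sigma>$1$2) * of_real (\<sigma>$2$1)"
      using arg_cong[OF det_one_entries[OF assms(1)], of complex_of_real] by simp
    have "(mob \<sigma> \<tau> - mob \<sigma> u) * (j \<sigma> \<tau> * j \<sigma> u) =
      (of_real (\<sigma>$1$1) * \<tau> + of_real (\<sigma>$1$2)) * j \<sigma> u - (of_real (\<sigma>$1$1) * u + of_real (\<sigma>$1$2)) * j \<sigma> \<tau>"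
      unfolding mob_eq using nz by (simp add: field_simps)
    also have "\<dots> = (of_real (\<sigma>$1$1) * of_real (\<sigma>$2$2) - of_real (\<sigma>$1$2) * of_real (\<sigma>$2$1)) * (\<tau> - u)"
      by (simp add: j_def algebra_simps)
    also have "\<dots> = \<tau> - u" unfolding d by simp
    finally show ?thesis .
  qed
  have "fixed_form ?B \<tau> = j ?B \<tau> * (\<tau> - u)" unfolding q[OF dB assms(3)] u_def by simp
  also have "\<dots> = (j \<sigma> u * j ?B \<tau>) * (mob \<sigma> \<tau> - mob \<sigma> u) * j \<sigma> \<tau>"
    unfolding diff[symmetric] by simp
  also have "\<dots> = fixed_form A (mob \<sigma> \<tau>) * (j \<sigma> \<tau>)\<^sup>2"
    unfolding ju q[OF assms(2) Im_mob_pos[OF assms(1,3)]] su by (simp add: power2_eq_square)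
  finally have fq: "fixed_form ?B \<tau> = fixed_form A (mob \<sigma> \<tau>) * (j \<sigma> \<tau>)\<^sup>2" .
  have tr: "?B$1$1 + ?B$2$2 = A$1$1 + A$2$2"
  proof -
    have "?B$1$1 + ?B$2$2 = (A$1$1 + A$2$2) * (\<sigma>$1$1 * \<sigma>$2$2 - \<sigma>$1$2 * \<sigma>$2$1)"
      by (simp add: algebra_simps)
    then show ?thesis using det_one_entries[OF assms(1)] by simp
  qed
  have "(displacement ?B \<tau>)\<^sup>2 = (displacement A (mob \<sigma> \<tau>))\<^sup>2"
    unfolding displacement_sq[OF assms(3) dB] displacement_sq[OF Im_mob_pos[OF assms(1,3)] assms(2)] tr fq Im_mob[OF assms(1,3)]
    using nz by (simp add: norm_mult norm_power power_mult_distrib power_divide flip: power_mult)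
  then show ?thesis by (simp add: power2_eq_iff_nonneg)
qed

text \<open>The maximum principle on a region that need not be compact: every value above \<open>M\<close> that occurs in it also
  occurs in the compact set \<open>K\<close>, so a maximum above \<open>M\<close> would be attained, and in the interior.\<close>

lemma petersson_le_on_sublevel:
  assumes f: "f holomorphic_on upper_half_plane" and w: "0 < w" and dB: "det B = 1" and M: "0 \<le> M"
    and bd: "\<And>\<tau>. 0 < Im \<tau> \<Longrightarrow> displacement B \<tau> = e \<Longrightarrow> petersson w f \<tau> \<le> M"
    and K: "compact K" "K \<subseteq> upper_half_plane"
    and red: "\<And>\<tau>. 0 < Im \<tau> \<Longrightarrow> displacement B \<tau> \<le> e \<Longrightarrow> M < petersson w f \<tau> \<Longrightarrow> \<exists>\<tau>'\<in>K. displacement B \<tau>' \<le> e \<and> petersson w f \<tau>' = petersson w f \<tau>"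
    and t: "0 < Im \<tau>" "displacement B \<tau> \<le> e"
  shows "petersson w f \<tau> \<le> M"
proof (rule ccontr)
  assume "\<not> petersson w f \<tau> \<le> M"
  then have big: "M < petersson w f \<tau>" by simp
  define L where "L = K \<inter> {\<tau>\<in>upper_half_plane. displacement B \<tau> \<le> e}"
  have "closedin (top_of_set K) (K \<inter> displacement B -` {..e})"
    by (rule continuous_closedin_preimage) (use continuous_on_subset[OF continuous_on_displacement[OF dB] K(2)] in auto)
  moreover have "L = K \<inter> displacement B -` {..e}" using K(2) by (auto simp: L_def)
  ultimately have L: "compact L" using K(1) closedin_compact by metis
  have LH: "L \<subseteq> upper_half_plane" by (auto simp: L_def)
  from red[OF t big] have "L \<noteq> {}" using K(2) by (auto simp: L_def)
  moreover have "continuous_on L (petersson w f)" using continuous_on_petersson[OF f] LH by (rule continuous_on_subset)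
  ultimately obtain z where z: "z \<in> L" "\<forall>u\<in>L. petersson w f u \<le> petersson w f z"
    using continuous_attains_sup[OF L] by blast
  have all: "petersson w f u \<le> petersson w f z" if "0 < Im u" "displacement B u \<le> e" "M < petersson w f u" for u
  proof -
    from red[OF that] obtain u' where u': "u' \<in> K" "displacement B u' \<le> e" "petersson w f u' = petersson w f u" by (elim bexE conjE)
    then have "u' \<in> L" using K(2) by (auto simp: L_def)
    then show ?thesis using z(2) u'(3) by metis
  qed
  have zM: "M < petersson w f z" using all[OF t big] big by simp
  have zH: "0 < Im z" and ze: "displacement B z \<le> e" using z(1) by (simp_all add: L_def upper_half_plane_def)
  have "displacement B z \<noteq> e" using bd[OF zH] zM by auto
  then have zU: "z \<in> upper_half_plane \<inter> displacement B -` {..<e}" using ze zH by (simp add: upper_half_plane_def)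
  have "open (upper_half_plane \<inter> displacement B -` {..<e})"
    by (rule continuous_open_preimage[OF continuous_on_displacement[OF dB] open_upper_half_plane]) simp
  moreover have "petersson w f u \<le> petersson w f z" if "u \<in> upper_half_plane \<inter> displacement B -` {..<e}" for u
  proof (cases "M < petersson w f u")
    case True then show ?thesis using all that by (simp add: upper_half_plane_def)
  next
    case False then show ?thesis using zM by simp
  qed
  ultimately have "f z = 0" using petersson_no_local_max[OF f w _ _ zU] by blast
  then show False using zM M w by (simp add: petersson_def)
qed

lemma displacement_le_iff:
  assumes "0 < Im \<tau>" "det A = 1" "0 \<le> e"
  shows "displacement A \<tau> \<le> e \<longleftrightarrow> (cmod (fixed_form A \<tau>))\<^sup>2 \<le> (e\<^sup>2 - 4 + 2 * (A$1$1 + A$2$2)) * (Im \<tau>)\<^sup>2"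
proof -
  have "displacement A \<tau> \<le> e \<longleftrightarrow> (displacement A \<tau>)\<^sup>2 \<le> e\<^sup>2" using assms(3) by (simp add: power2_le_iff_abs_le)
  also have "\<dots> \<longleftrightarrow> (cmod (fixed_form A \<tau>))\<^sup>2 / (Im \<tau>)\<^sup>2 \<le> e\<^sup>2 - 4 + 2 * (A$1$1 + A$2$2)"
    unfolding displacement_sq[OF assms(1,2)] by linarith
  also have "\<dots> \<longleftrightarrow> (cmod (fixed_form A \<tau>))\<^sup>2 \<le> (e\<^sup>2 - 4 + 2 * (A$1$1 + A$2$2)) * (Im \<tau>)\<^sup>2"
    using assms(1) by (simp add: pos_divide_le_eq)
  finally show ?thesis .
qed

text \<open>On the real axis the inequality forces the fixed form to vanish, which is impossible for negative
  discriminant; hence the sublevel set, closed and bounded, stays away from the axis.\<close>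

lemma elliptic_sublevel_compact:
  assumes dB: "det B = 1" and tr: "(B$1$1 + B$2$2)\<^sup>2 < 4"
  shows "compact {\<tau>. 0 \<le> Im \<tau> \<and> (cmod (fixed_form B \<tau>))\<^sup>2 \<le> \<kappa> * (Im \<tau>)\<^sup>2}" (is "compact ?K")
    and "{\<tau>. 0 \<le> Im \<tau> \<and> (cmod (fixed_form B \<tau>))\<^sup>2 \<le> \<kappa> * (Im \<tau>)\<^sup>2} \<subseteq> upper_half_plane"
proof -
  define a b c d where defs: "a = B$1$1" "b = B$1$2" "c = B$2$1" "d = B$2$2"
  have ad: "a * d = 1 + b * c" using det_one_entries[OF dB] by (simp add: defs)
  have disc: "(d - a)\<^sup>2 + 4 * b * c < 0"
  proof -
    have "(d - a)\<^sup>2 + 4 * b * c = (a + d)\<^sup>2 - 4 * (a * d - b * c)" by (simp add: power2_eq_square algebra_simps)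
    then show ?thesis using tr ad by (simp add: defs)
  qed
  then have c: "c \<noteq> 0" by auto
  show "?K \<subseteq> upper_half_plane"
  proof
    fix \<tau> assume t: "\<tau> \<in> ?K"
    have "Im \<tau> \<noteq> 0"
    proof
      assume 0: "Im \<tau> = 0"
      then have "fixed_form B \<tau> = 0" using t by simp
      moreover have "\<tau> = of_real (Re \<tau>)" using 0 by (simp add: complex_eq_iff)
      ultimately have "fixed_form B (of_real (Re \<tau>)) = 0" by metis
      then have "complex_of_real (c * (Re \<tau>)\<^sup>2 + (d - a) * Re \<tau> - b) = 0"
        by (simp add: fixed_form_def defs)
      then have "c * (Re \<tau>)\<^sup>2 + (d - a) * Re \<tau> - b = 0" by (simp only: of_real_eq_0_iff)
      moreover have "(2 * c * Re \<tau> + (d - a))\<^sup>2 = 4 * c * (c * (Re \<tau>)\<^sup>2 + (d - a) * Re \<tau> - b) + ((d - a)\<^sup>2 + 4 * b * c)"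
        by (simp add: power2_eq_square algebra_simps)
      ultimately have "(2 * c * Re \<tau> + (d - a))\<^sup>2 < 0" using disc by simp
      then show False by (simp add: not_less[symmetric])
    qed
    then show "\<tau> \<in> upper_half_plane" using t by (simp add: upper_half_plane_def)
  qed
  show "compact ?K"
    unfolding compact_eq_bounded_closed
  proof
    show "closed ?K"
      by (intro closed_Collect_conj closed_Collect_le continuous_intros continuous_on_fixed_form)
    define L where "L = sqrt \<bar>\<kappa>\<bar> + \<bar>d - a\<bar>"
    have "cmod \<tau> \<le> max 1 ((L + \<bar>b\<bar>) / \<bar>c\<bar>)" if "\<tau> \<in> ?K" for \<tau>
    proof (cases "cmod \<tau> \<le> 1")
      case False
      then have t1: "1 \<le> cmod \<tau>" by simp
      have "(cmod (fixed_form B \<tau>))\<^sup>2 \<le> \<bar>\<kappa>\<bar> * (cmod \<tau>)\<^sup>2"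
      proof -
        have "(Im \<tau>)\<^sup>2 \<le> (cmod \<tau>)\<^sup>2" by (simp add: cmod_power2)
        then have "\<kappa> * (Im \<tau>)\<^sup>2 \<le> \<bar>\<kappa>\<bar> * (cmod \<tau>)\<^sup>2" by (intro mult_mono) auto
        then show ?thesis using that by simp
      qed
      also have "\<dots> = (sqrt \<bar>\<kappa>\<bar> * cmod \<tau>)\<^sup>2" by (simp add: power_mult_distrib)
      finally have q: "cmod (fixed_form B \<tau>) \<le> sqrt \<bar>\<kappa>\<bar> * cmod \<tau>" by (rule power2_le_imp_le) simp
      have e: "of_real c * \<tau>\<^sup>2 = fixed_form B \<tau> - of_real (d - a) * \<tau> + of_real b"
        by (simp add: fixed_form_def defs)
      have "\<bar>c\<bar> * (cmod \<tau>)\<^sup>2 = cmod (of_real c * \<tau>\<^sup>2)" by (simp add: norm_mult norm_power)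
      also have "\<dots> \<le> cmod (fixed_form B \<tau>) + cmod (of_real (d - a) * \<tau>) + cmod (of_real b)"
        unfolding e by (rule order_trans[OF norm_triangle_ineq add_right_mono[OF norm_triangle_ineq4]])
      also have "\<dots> \<le> sqrt \<bar>\<kappa>\<bar> * cmod \<tau> + \<bar>d - a\<bar> * cmod \<tau> + \<bar>b\<bar> * cmod \<tau>"
      proof -
        have "\<bar>b\<bar> * 1 \<le> \<bar>b\<bar> * cmod \<tau>" using t1 by (intro mult_left_mono) auto
        moreover have "cmod (of_real (d - a) * \<tau>) = \<bar>d - a\<bar> * cmod \<tau>" "cmod (of_real b) = \<bar>b\<bar>"
          unfolding norm_mult norm_of_real by simp_all
        ultimately show ?thesis using q by linarith
      qed
      also have "\<dots> = (L + \<bar>b\<bar>) * cmod \<tau>" by (simp add: L_def algebra_simps)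
      finally have "(\<bar>c\<bar> * cmod \<tau>) * cmod \<tau> \<le> (L + \<bar>b\<bar>) * cmod \<tau>" by (simp add: power2_eq_square mult.assoc)
      then have "\<bar>c\<bar> * cmod \<tau> \<le> L + \<bar>b\<bar>" by (rule mult_right_le_imp_le) (use t1 in linarith)
      then have "cmod \<tau> \<le> (L + \<bar>b\<bar>) / \<bar>c\<bar>" using c by (simp add: pos_le_divide_eq mult.commute)
      then show ?thesis by simp
    qed simp
    then show "bounded ?K" unfolding bounded_iff by blast
  qed
qed

end

lemma scale_into_annulus:
  fixes A r :: real
  assumes "1 < A" "0 < r"
  shows "\<exists>n::nat. (1 \<le> r / A ^ n \<and> r / A ^ n \<le> A) \<or> (1 \<le> r * A ^ n \<and> r * A ^ n \<le> A)"
proof -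
  define k where "k = \<lfloor>log A r\<rfloor>"
  have "A powr k \<le> A powr log A r" "A powr log A r \<le> A powr (k + 1)"
    using assms(1) unfolding k_def by (auto intro!: powr_mono)
  then have k: "A powr k \<le> r" "r \<le> A * A powr k" using assms by (simp_all add: powr_add mult.commute)
  show ?thesis
  proof (cases "0 \<le> k")
    case True
    then have "A powr k = A ^ nat k" using assms by (simp add: powr_real_of_int)
    then have "1 \<le> r / A ^ nat k" "r / A ^ nat k \<le> A" using k assms by (simp_all add: le_divide_eq divide_le_eq)
    then show ?thesis by blast
  next
    case False
    then have e: "A powr k = 1 / A ^ nat (- k)" using assms by (simp add: powr_real_of_int field_simps)
    have p: "0 < A ^ nat (- k)" using assms by simp
    have "1 \<le> r * A ^ nat (- k)" "r * A ^ nat (- k) \<le> A" using k p unfolding e by (simp_all add: field_simps)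
    then show ?thesis by blast
  qed
qed

text \<open>A hyperbolic region is a sector at the fixed point \<open>x0\<close>, and the dilation brings each of its points into an annulus.\<close>

lemma dilation_orbit_meets_annulus:
  fixes g :: "complex \<Rightarrow> real" and x0 A :: real
  assumes A: "0 < A" "A \<noteq> 1" and inv: "\<And>\<tau>. 0 < Im \<tau> \<Longrightarrow> g (of_real x0 + of_real A * (\<tau> - of_real x0)) = g \<tau>"
    and t: "0 < Im \<tau>"
  shows "\<exists>s>0. g (of_real x0 + of_real s * (\<tau> - of_real x0)) = g \<tau> \<and>
     1 \<le> s * cmod (\<tau> - of_real x0) \<and> s * cmod (\<tau> - of_real x0) \<le> max A (1/A)"
proof -
  have r: "0 < cmod (\<tau> - of_real x0)"
  proof -
    have "Im (\<tau> - of_real x0) \<noteq> 0" using t by simp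
    then have "\<tau> - of_real x0 \<noteq> 0" by (metis zero_complex.simps(2))
    then show ?thesis by simp
  qed
  have main: "\<exists>s>0. g (of_real x0 + of_real s * (\<tau> - of_real x0)) = g \<tau> \<and>
      1 \<le> s * cmod (\<tau> - of_real x0) \<and> s * cmod (\<tau> - of_real x0) \<le> B"
    if B: "1 < B" and invB: "\<And>\<tau>. 0 < Im \<tau> \<Longrightarrow> g (of_real x0 + of_real B * (\<tau> - of_real x0)) = g \<tau>" for B
  proof -
    have up: "g (of_real x0 + of_real (B ^ n) * (\<tau> - of_real x0)) = g \<tau>" if "0 < Im \<tau>" for n \<tau>
    proof (induction n)
      case (Suc n)
      let ?t = "of_real x0 + of_real (B ^ n) * (\<tau> - of_real x0)"
      have "0 < Im ?t" using that B by simp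
      from invB[OF this] show ?case using Suc by (simp add: mult.assoc)
    qed simp
    from scale_into_annulus[OF B r] obtain n where
      "(1 \<le> cmod (\<tau> - of_real x0) / B ^ n \<and> cmod (\<tau> - of_real x0) / B ^ n \<le> B) \<or>
       (1 \<le> cmod (\<tau> - of_real x0) * B ^ n \<and> cmod (\<tau> - of_real x0) * B ^ n \<le> B)" by (elim exE)
    then show ?thesis
    proof
      assume n: "1 \<le> cmod (\<tau> - of_real x0) / B ^ n \<and> cmod (\<tau> - of_real x0) / B ^ n \<le> B"
      let ?t = "of_real x0 + of_real (1 / B ^ n) * (\<tau> - of_real x0)"
      have "0 < Im ?t" using t B by simp
      from up[OF this, of n] have "g ?t = g \<tau>" using B by simp
      then show ?thesis using n B by (intro exI[of _ "1 / B ^ n"]) simp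
    next
      assume "1 \<le> cmod (\<tau> - of_real x0) * B ^ n \<and> cmod (\<tau> - of_real x0) * B ^ n \<le> B"
      then show ?thesis using up[OF t, of n] B by (intro exI[of _ "B ^ n"]) (simp add: mult.commute)
    qed
  qed
  show ?thesis
  proof (cases "1 < A")
    case True
    show ?thesis using main[OF True inv] by (meson max.coboundedI1)
  next
    case False
    then have A1: "1 < 1 / A" using A by simp
    have "g (of_real x0 + of_real (1 / A) * (z - of_real x0)) = g z" if "0 < Im z" for z
    proof -
      have "0 < Im (of_real x0 + of_real (1 / A) * (z - of_real x0))" using that A by simp
      from inv[OF this] show ?thesis using A by simp
    qed
    from main[OF A1 this] show ?thesis by (meson max.coboundedI2)
  qed
qed

text \<open>A parabolic region is a horodisc, and the translation brings each of its points into a vertical strip.\<close>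

lemma translation_orbit_meets_strip:
  fixes g :: "complex \<Rightarrow> real" and h :: real
  assumes h: "h \<noteq> 0" and inv: "\<And>\<tau>. 0 < Im \<tau> \<Longrightarrow> g (\<tau> + of_real h) = g \<tau>" and t: "0 < Im \<tau>"
  shows "\<exists>s::real. g (\<tau> + of_real s) = g \<tau> \<and> 0 \<le> Re \<tau> + s \<and> Re \<tau> + s \<le> \<bar>h\<bar>"
proof -
  have up: "g (\<tau> + of_real (real n * h)) = g \<tau>" if "0 < Im \<tau>" for n \<tau>
  proof (induction n)
    case (Suc n)
    let ?t = "\<tau> + of_real (real n * h)"
    have "0 < Im ?t" using that by simp
    from inv[OF this] show ?case using Suc by (simp add: algebra_simps)
  qed simp
  have down: "g (\<tau> + of_real (- real n * h)) = g \<tau>" for n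
  proof -
    have "0 < Im (\<tau> + of_real (- real n * h))" using t by simp
    from up[OF this, of n] show ?thesis by simp
  qed
  have int_shift: "g (\<tau> + of_real (of_int k * h)) = g \<tau>" for k :: int
  proof (cases "0 \<le> k")
    case True
    then show ?thesis using up[OF t, of "nat k"] by simp
  next
    case False
    then show ?thesis using down[of "nat (- k)"] by simp
  qed
  define k where "k = \<lfloor>Re \<tau> / \<bar>h\<bar>\<rfloor>"
  have "of_int k \<le> Re \<tau> / \<bar>h\<bar>" "Re \<tau> / \<bar>h\<bar> \<le> of_int k + 1" unfolding k_def by linarith+
  then have k: "of_int k * \<bar>h\<bar> \<le> Re \<tau>" "Re \<tau> \<le> (of_int k + 1) * \<bar>h\<bar>"
    using h by (simp_all add: pos_le_divide_eq pos_divide_le_eq)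
  have "g (\<tau> + of_real (- (of_int k * \<bar>h\<bar>))) = g \<tau>"
  proof (cases "0 < h")
    case True
    then show ?thesis using int_shift[of "- k"] by simp
  next
    case False
    then show ?thesis using int_shift[of k] by simp
  qed
  then show ?thesis using k by (intro exI[of _ "- (of_int k * \<bar>h\<bar>)"]) (simp add: algebra_simps)
qed

text \<open>The first column of \<open>\<sigma>\<close> is a real eigenvector of \<open>B\<close>; it is real because the discriminant \<open>trace\<^sup>2 - 4\<close> is not negative.\<close>

lemma upper_triangular_conjugate:
  assumes dB: "det B = 1" and tr: "4 \<le> (B$1$1 + B$2$2)\<^sup>2"
  shows "\<exists>\<sigma>. det \<sigma> = 1 \<and> (adj \<sigma> ** B ** \<sigma>)$2$1 = 0"
proof (cases "B$2$1 = 0")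
  case True
  then show ?thesis by (intro exI[of _ "mat 1"]) simp
next
  case False
  define t where "t = B$1$1 + B$2$2"
  define x where "x = (B$1$1 - B$2$2 + sqrt (t\<^sup>2 - 4)) / (2 * B$2$1)"
  have "(2 * B$2$1 * x - (B$1$1 - B$2$2))\<^sup>2 = t\<^sup>2 - 4"
    using False tr by (simp add: x_def t_def)
  then have "4 * B$2$1 * (B$2$1 * x\<^sup>2 + (B$2$2 - B$1$1) * x - B$1$2) = t\<^sup>2 - 4 - (B$2$2 - B$1$1)\<^sup>2 - 4 * (B$1$2 * B$2$1)"
    by (simp add: power2_eq_square algebra_simps)
  also have "\<dots> = 4 * (B$1$1 * B$2$2 - 1 - B$1$2 * B$2$1)"
    by (simp add: t_def power2_eq_square algebra_simps)
  also have "\<dots> = 0" using det_one_entries[OF dB] by simp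
  finally have root: "B$2$1 * x\<^sup>2 + (B$2$2 - B$1$1) * x - B$1$2 = 0" using False by simp
  have "(adj (mat2 x (- 1) 1 0) ** B ** mat2 x (- 1) 1 0)$2$1 = 0"
    using root by (simp add: power2_eq_square algebra_simps)
  moreover have "det (mat2 x (- 1) 1 0) = 1" by (simp add: det_2)
  ultimately show ?thesis by blast
qed

lemma slash_holomorphic:
  assumes "det \<sigma> = 1" "f holomorphic_on upper_half_plane"
  shows "slash k \<sigma> f holomorphic_on upper_half_plane"
proof -
  have j: "j \<sigma> holomorphic_on upper_half_plane" unfolding j_def by (intro holomorphic_intros)
  have nz: "j \<sigma> \<tau> \<noteq> 0" if "\<tau> \<in> upper_half_plane" for \<tau>
    using j_nonzero[OF assms(1)] that by (simp add: upper_half_plane_def)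
  have "f \<circ> mob \<sigma> holomorphic_on upper_half_plane"
    using Im_mob_pos[OF assms(1)]
    by (intro holomorphic_on_compose_gen[OF mob_holomorphic[OF assms(1)] assms(2)]) (auto simp: upper_half_plane_def)
  then have "(\<lambda>\<tau>. j \<sigma> \<tau> powi (- k) * (f \<circ> mob \<sigma>) \<tau>) holomorphic_on upper_half_plane"
    by (intro holomorphic_intros j) (simp_all add: nz o_def)
  then show ?thesis by (simp add: slash_def[abs_def])
qed

context discrete_group
begin

text \<open>An elliptic \<open>B\<close> has a compact region. Otherwise conjugate \<open>B\<close> to an upper triangular \<open>C\<close>. If its diagonal entries
  differ, \<open>C\<close> acts as a dilation and its sector is compact modulo \<open>C\<close>. If they agree, \<open>C\<close> is a translation and the region is a
  horodisc; there the growth condition at the cusp, divided by \<open>Im\<^sup>w\<close>, disposes of the points high up, and the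
  rest is compact modulo \<open>C\<close>.\<close>

lemma petersson_le_on_thin_component:
  assumes f: "f holomorphic_on upper_half_plane" and w: "0 < w"
    and B: "B \<in> G" "B \<noteq> mat 1" "B \<noteq> - mat 1" and M: "0 < M" and e: "0 < e" "e \<le> 1/8"
    and inv: "\<And>\<tau>. 0 < Im \<tau> \<Longrightarrow> petersson w f (mob B \<tau>) = petersson w f \<tau>"
    and cusp: "\<And>\<sigma> h. det \<sigma> = 1 \<Longrightarrow> h \<noteq> 0 \<Longrightarrow> adj \<sigma> ** B ** \<sigma> = mat2 1 h 0 1 \<Longrightarrow>
      \<exists>Y>0. \<exists>C. \<forall>\<tau>. Re \<tau> \<in> {0..\<bar>h\<bar>} \<and> Im \<tau> > Y \<longrightarrow> cmod (slash (- int w) \<sigma> f \<tau>) \<le> C"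
    and bd: "\<And>\<tau>. 0 < Im \<tau> \<Longrightarrow> displacement B \<tau> = e \<Longrightarrow> petersson w f \<tau> \<le> M"
    and t: "0 < Im \<tau>" "displacement B \<tau> \<le> e"
  shows "petersson w f \<tau> \<le> M"
proof -
  note dB = det_G[OF B(1)]
  define \<kappa> where "\<kappa> = e\<^sup>2 - 4 + 2 * (B$1$1 + B$2$2)"
  have le_iff: "displacement C u \<le> e \<longleftrightarrow> (cmod (fixed_form C u))\<^sup>2 \<le> (e\<^sup>2 - 4 + 2 * (C$1$1 + C$2$2)) * (Im u)\<^sup>2"
    if "0 < Im u" "det C = 1" for C u
    using displacement_le_iff[OF that] e by simp
  have trace_pos: "0 < B$1$1 + B$2$2"
  proof -
    have "0 \<le> \<kappa> * (Im \<tau>)\<^sup>2" using le_iff[OF t(1) dB] t(2) unfolding \<kappa>_def by (meson order_trans zero_le_power2)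
    then have "0 \<le> \<kappa>" using t(1) by (simp add: zero_le_mult_iff)
    moreover have "e\<^sup>2 \<le> (1/8)\<^sup>2" using e by (intro power_mono) auto
    ultimately show ?thesis unfolding \<kappa>_def by (simp add: power_divide)
  qed
  show ?thesis
  proof (cases "(B$1$1 + B$2$2)\<^sup>2 < 4")
    case True
    show ?thesis
    proof (rule petersson_le_on_sublevel[OF f w dB less_imp_le[OF M] bd elliptic_sublevel_compact[OF dB True, of \<kappa>] _ t])
      fix u assume u: "0 < Im u" "displacement B u \<le> e"
      then have "u \<in> {\<tau>. 0 \<le> Im \<tau> \<and> (cmod (fixed_form B \<tau>))\<^sup>2 \<le> \<kappa> * (Im \<tau>)\<^sup>2}"
        using le_iff[OF u(1) dB] by (simp add: \<kappa>_def)
      then show "\<exists>u'\<in>{\<tau>. 0 \<le> Im \<tau> \<and> (cmod (fixed_form B \<tau>))\<^sup>2 \<le> \<kappa> * (Im \<tau>)\<^sup>2}. displacement B u' \<le> e \<and> petersson w f u' = petersson w f u"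
        using u(2) by (intro bexI[of _ u] conjI refl)
    qed
  next
    case False
    then obtain \<sigma> where \<sigma>: "det \<sigma> = 1" "(adj \<sigma> ** B ** \<sigma>)$2$1 = 0"
      using upper_triangular_conjugate[OF dB] by auto
    define C where "C = adj \<sigma> ** B ** \<sigma>"
    define f' where "f' = slash (- int w) \<sigma> f"
    have dC: "det C = 1" using \<sigma>(1) dB by (simp add: C_def det_mul)
    have f': "f' holomorphic_on upper_half_plane" unfolding f'_def by (rule slash_holomorphic[OF \<sigma>(1) f])
    have petersson': "petersson w f' u = petersson w f (mob \<sigma> u)" if "0 < Im u" for u
      unfolding f'_def by (rule petersson_slash[OF \<sigma>(1) that])
    have displacement': "displacement C u = displacement B (mob \<sigma> u)" if "0 < Im u" for u
      unfolding C_def by (rule displacement_conj[OF \<sigma>(1) dB that])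
    have sC: "\<sigma> ** C = B ** \<sigma>"
      unfolding C_def using mult_adj_assoc(1)[OF \<sigma>(1), of "B ** \<sigma>"] by (simp only: matrix_mul_assoc)
    have inv': "petersson w f' (mob C u) = petersson w f' u" if "0 < Im u" for u
    proof -
      have "mob \<sigma> (mob C u) = mob B (mob \<sigma> u)"
        using mob_mult[OF \<sigma>(1) dC that] mob_mult[OF dB \<sigma>(1) that] sC by simp
      then show ?thesis using petersson'[OF that] petersson'[OF Im_mob_pos[OF dC that]] inv[OF Im_mob_pos[OF \<sigma>(1) that]] by simp
    qed
    have bd': "petersson w f' u \<le> M" if "0 < Im u" "displacement C u = e" for u
      using bd[OF Im_mob_pos[OF \<sigma>(1) that(1)]] petersson'[OF that(1)] displacement'[OF that(1)] that(2) by simp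
    define a b d where abd: "a = C$1$1" "b = C$1$2" "d = C$2$2"
    have c0: "C$2$1 = 0" using \<sigma>(2) by (simp add: C_def)
    have ad: "a * d = 1" using det_one_entries[OF dC] c0 by (simp add: abd)
    have C_eq: "C = mat2 a b 0 d" using c0 by (simp add: mat2_eq_iff abd)
    have tr: "a + d = B$1$1 + B$2$2"
    proof -
      have "C$1$1 + C$2$2 = (B$1$1 + B$2$2) * (\<sigma>$1$1 * \<sigma>$2$2 - \<sigma>$1$2 * \<sigma>$2$1)"
        by (simp add: C_def algebra_simps)
      then show ?thesis using det_one_entries[OF \<sigma>(1)] by (simp add: abd)
    qed
    have fixC: "fixed_form C u = of_real (d - a) * u - of_real b" for u
      by (simp add: fixed_form_def c0 abd)
    have sub: "(cmod (fixed_form C u))\<^sup>2 \<le> \<kappa> * (Im u)\<^sup>2 \<longleftrightarrow> displacement C u \<le> e" if "0 < Im u" for u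
      unfolding le_iff[OF that dC] using tr by (simp only: \<kappa>_def abd)
    have mobC: "mob C u = of_real (a\<^sup>2) * u + of_real (a * b)" for u
      using mob_upper_triangular[OF dC c0] by (simp add: abd)
    have C1: "C \<noteq> mat 1" "C \<noteq> - mat 1"
    proof -
      have sCs: "\<sigma> ** C ** adj \<sigma> = B" unfolding sC by (rule mult_adj_assoc(3)[OF \<sigma>(1)])
      show "C \<noteq> mat 1" using sCs B(2) mult_adj(1)[OF \<sigma>(1)] by auto
      show "C \<noteq> - mat 1"
      proof
        assume "C = - mat 1"
        then have "B = \<sigma> ** (- mat 1) ** adj \<sigma>" using sCs by simp
        also have "\<dots> = - (\<sigma> ** adj \<sigma>)" by (simp add: mat2_eq_iff)
        finally show False using B(3) mult_adj(1)[OF \<sigma>(1)] by simp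
      qed
    qed
    have goal': "petersson w f' u \<le> M" if u: "0 < Im u" "displacement C u \<le> e" for u
    proof (cases "d = a")
      case False
      define x0 where "x0 = b / (d - a)"
      have fix0: "fixed_form C v = of_real (d - a) * (v - of_real x0)" for v
      proof -
        have "of_real (d - a) * complex_of_real x0 = of_real b"
          unfolding x0_def of_real_mult[symmetric] using False by simp
        then show ?thesis unfolding fixC by (simp add: right_diff_distrib)
      qed
      have a0: "a \<noteq> 0" using ad by auto
      have a1: "0 < a\<^sup>2" "a\<^sup>2 \<noteq> 1"
      proof -
        show "0 < a\<^sup>2" using a0 by simp
        show "a\<^sup>2 \<noteq> 1"
        proof
          assume "a\<^sup>2 = 1"
          then have "a * a = a * d" using ad by (simp add: power2_eq_square)
          then show False using a0 False by simp
        qed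
      qed
      have x0: "a\<^sup>2 * x0 + a * b = x0"
      proof -
        have "a * b * (d - a) = b * (1 - a\<^sup>2)" using ad by (simp add: power2_eq_square algebra_simps)
        then have "a * b = x0 * (1 - a\<^sup>2)" using False by (simp add: x0_def field_simps)
        then show ?thesis by (simp add: algebra_simps)
      qed
      have mob0: "mob C v = of_real x0 + of_real (a\<^sup>2) * (v - of_real x0)" for v
      proof -
        have "of_real x0 + of_real (a\<^sup>2) * (v - of_real x0) = of_real (a\<^sup>2) * v + of_real (x0 - a\<^sup>2 * x0)"
          by (simp add: algebra_simps)
        also have "x0 - a\<^sup>2 * x0 = a * b" using x0 by simp
        finally show ?thesis unfolding mobC ..
      qed
      define R where "R = max (a\<^sup>2) (1 / a\<^sup>2)"
      define K where "K = {v. 0 \<le> Im v \<and> 1 \<le> cmod (v - of_real x0) \<and> cmod (v - of_real x0) \<le> R \<and> (cmod (fixed_form C v))\<^sup>2 \<le> \<kappa> * (Im v)\<^sup>2}"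
      have "closed K" unfolding K_def
        by (intro closed_Collect_conj closed_Collect_le continuous_intros continuous_on_fixed_form)
      moreover have "bounded K"
      proof (rule bounded_subset[OF bounded_cball[of "of_real x0" R]])
        show "K \<subseteq> cball (of_real x0) R" by (auto simp: K_def dist_norm norm_minus_commute)
      qed
      ultimately have K: "compact K" by (simp add: compact_eq_bounded_closed)
      have KH: "K \<subseteq> upper_half_plane"
      proof
        fix v assume v: "v \<in> K"
        have "Im v \<noteq> 0"
        proof
          assume "Im v = 0"
          then have "fixed_form C v = 0" using v by (simp add: K_def)
          then have "v - of_real x0 = 0" unfolding fix0 using False by (simp flip: of_real_diff)
          then show False using v by (simp add: K_def)
        qed
        then show "v \<in> upper_half_plane" using v by (simp add: K_def upper_half_plane_def)
      qed
      show ?thesis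
      proof (rule petersson_le_on_sublevel[OF f' w dC less_imp_le[OF M] bd' K KH _ u])
        fix v assume v: "0 < Im v" "displacement C v \<le> e"
        have invg: "petersson w f' (of_real x0 + of_real (a\<^sup>2) * (u - of_real x0)) = petersson w f' u" if "0 < Im u" for u
          using inv'[OF that] unfolding mob0 .
        have "\<exists>s>0. petersson w f' (of_real x0 + of_real s * (v - of_real x0)) = petersson w f' v \<and>
            1 \<le> s * cmod (v - of_real x0) \<and> s * cmod (v - of_real x0) \<le> R"
          unfolding R_def by (rule dilation_orbit_meets_annulus[of "a\<^sup>2" "petersson w f'" x0, OF a1 invg v(1)])
        then obtain s where s: "0 < s" "petersson w f' (of_real x0 + of_real s * (v - of_real x0)) = petersson w f' v"
          "1 \<le> s * cmod (v - of_real x0)" "s * cmod (v - of_real x0) \<le> R" by (elim exE conjE)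
        define v' where "v' = of_real x0 + of_real s * (v - of_real x0)"
        have v': "v' - of_real x0 = of_real s * (v - of_real x0)" "Im v' = s * Im v" by (simp_all add: v'_def)
        have n: "cmod (v' - of_real x0) = s * cmod (v - of_real x0)" unfolding v' using s(1) by (simp add: norm_mult)
        have "fixed_form C v' = of_real s * fixed_form C v" unfolding fix0 v' by simp
        then have "(cmod (fixed_form C v'))\<^sup>2 = s\<^sup>2 * (cmod (fixed_form C v))\<^sup>2" by (simp add: norm_mult power_mult_distrib)
        also have "\<dots> \<le> s\<^sup>2 * (\<kappa> * (Im v)\<^sup>2)" using v sub[OF v(1)] by (intro mult_left_mono) auto
        also have "\<dots> = \<kappa> * (Im v')\<^sup>2" unfolding v' by (simp add: power_mult_distrib)
        finally have q: "(cmod (fixed_form C v'))\<^sup>2 \<le> \<kappa> * (Im v')\<^sup>2" .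
        have iv: "0 < Im v'" unfolding v' using s(1) v(1) by simp
        have "v' \<in> K" unfolding K_def using q iv s n by simp
        moreover have "displacement C v' \<le> e" using q sub[OF iv] by simp
        ultimately show "\<exists>v'\<in>K. displacement C v' \<le> e \<and> petersson w f' v' = petersson w f' v"
          using s(2) unfolding v'_def by blast
      qed
    next
      case True
      then have "a\<^sup>2 = 1" using ad by (simp add: power2_eq_square)
      moreover have "0 < a" using True tr trace_pos by simp
      ultimately have a1: "a = 1" by (simp add: power2_eq_1_iff)
      then have Cb: "C = mat2 1 b 0 1" using C_eq True by simp
      have b0: "b \<noteq> 0"
      proof
        assume "b = 0"
        then have "C = mat 1" using Cb by (simp add: mat2_eq_iff)
        then show False using C1 by simp
      qed
      from cusp[OF \<sigma>(1) b0 Cb[unfolded C_def]] obtain Y c where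
        Y: "0 < Y" "\<forall>\<tau>. Re \<tau> \<in> {0..\<bar>b\<bar>} \<and> Im \<tau> > Y \<longrightarrow> cmod (f' \<tau>) \<le> c"
        unfolding f'_def by (elim exE conjE)
      \<comment> \<open>Above height \<open>Z\<close> the bound \<open>c\<^sup>2 / Im\<^sup>w\<close> is already below \<open>M\<close>.\<close>
      define Z where "Z = max (max Y 1) (c\<^sup>2 / M)"
      have decay: "petersson w f' v \<le> M" if "0 \<le> Re v" "Re v \<le> \<bar>b\<bar>" "Z < Im v" for v
      proof -
        have v: "Y < Im v" "1 < Im v" "c\<^sup>2 / M < Im v" using that(3) by (simp_all add: Z_def)
        have "cmod (f' v) \<le> c" using Y(2) that v by simp
        then have "(cmod (f' v))\<^sup>2 \<le> c\<^sup>2" by (intro power_mono) auto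
        also have "\<dots> \<le> M * Im v" using v(3) M by (simp add: pos_divide_less_eq mult.commute)
        also have "\<dots> \<le> M * Im v ^ w"
          using v(2) w M by (intro mult_left_mono self_le_power) auto
        finally show ?thesis using v(2) by (simp add: petersson_def divide_le_eq)
      qed
      have mobb: "mob C v = v + of_real b" for v unfolding mobC a1 by simp
      define K where "K = {v. 0 \<le> Im v \<and> Im v \<le> Z \<and> 0 \<le> Re v \<and> Re v \<le> \<bar>b\<bar> \<and> (cmod (fixed_form C v))\<^sup>2 \<le> \<kappa> * (Im v)\<^sup>2}"
      have "closed K" unfolding K_def
        by (intro closed_Collect_conj closed_Collect_le continuous_intros continuous_on_fixed_form)
      moreover have "bounded K"
      proof (rule bounded_subset[OF bounded_cbox[of "Complex 0 0" "Complex \<bar>b\<bar> Z"]])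
        show "K \<subseteq> cbox (Complex 0 0) (Complex \<bar>b\<bar> Z)" by (auto simp: K_def in_cbox_complex_iff)
      qed
      ultimately have K: "compact K" by (simp add: compact_eq_bounded_closed)
      have KH: "K \<subseteq> upper_half_plane"
      proof
        fix v assume v: "v \<in> K"
        have "Im v \<noteq> 0"
        proof
          assume "Im v = 0"
          then have "fixed_form C v = 0" using v by (simp add: K_def)
          then show False unfolding fixC using True b0 by simp
        qed
        then show "v \<in> upper_half_plane" using v by (simp add: K_def upper_half_plane_def)
      qed
      show ?thesis
      proof (rule petersson_le_on_sublevel[OF f' w dC less_imp_le[OF M] bd' K KH _ u])
        fix v assume v: "0 < Im v" "displacement C v \<le> e" "M < petersson w f' v"
        have invg: "petersson w f' (u + of_real b) = petersson w f' u" if "0 < Im u" for u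
          using inv'[OF that] unfolding mobb .
        have "\<exists>s::real. petersson w f' (v + of_real s) = petersson w f' v \<and> 0 \<le> Re v + s \<and> Re v + s \<le> \<bar>b\<bar>"
          by (rule translation_orbit_meets_strip[of b "petersson w f'", OF b0 invg v(1)])
        then obtain s where s: "petersson w f' (v + of_real s) = petersson w f' v" "0 \<le> Re v + s" "Re v + s \<le> \<bar>b\<bar>" by (elim exE conjE)
        let ?v = "v + of_real s"
        have "Im ?v \<le> Z"
        proof (rule ccontr)
          assume "\<not> Im ?v \<le> Z"
          then have "petersson w f' ?v \<le> M" using decay[of ?v] s by simp
          then show False using s(1) v(3) by simp
        qed
        moreover have "fixed_form C ?v = fixed_form C v" unfolding fixC using True by simp
        ultimately have "?v \<in> K" unfolding K_def using s v sub[OF v(1)] by simp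
        moreover have "displacement C ?v \<le> e"
        proof -
          have "0 < Im ?v" using v(1) by simp
          from sub[OF this] show ?thesis using \<open>?v \<in> K\<close> by (simp add: K_def)
        qed
        ultimately show "\<exists>v'\<in>K. displacement C v' \<le> e \<and> petersson w f' v' = petersson w f' v"
          using s(1) by blast
      qed
    qed
    have p: "0 < Im (mob (adj \<sigma>) \<tau>)" using Im_mob_pos[of "adj \<sigma>"] \<sigma>(1) t(1) by simp
    have "displacement C (mob (adj \<sigma>) \<tau>) \<le> e"
      unfolding displacement'[OF p] mob_adj(2)[OF \<sigma>(1) t(1)] by (rule t(2))
    from goal'[OF p this] show ?thesis unfolding petersson'[OF p] mob_adj(2)[OF \<sigma>(1) t(1)] .
  qed
qed

text \<open>The norm \<open>petersson w f\<close> is bounded on the thick part by its maximum \<open>M\<close> over a compact set, and by the same \<open>M\<close> on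
  each thin region. So \<open>M\<close> is a global maximum that is attained, hence zero. The point \<open>\<tau>0\<close> is added to the compact set to make
  \<open>M\<close> positive.\<close>

theorem negative_weight_vanishes:
  assumes F: "F \<subseteq> upper_half_plane" "F \<in> sets borel" "area F < \<infinity>"
    and cover: "\<And>\<tau>. \<tau> \<in> upper_half_plane \<Longrightarrow> \<exists>\<gamma>\<in>G. mob \<gamma> \<tau> \<in> F"
    and f: "f holomorphic_on upper_half_plane" and w: "0 < w"
    and inv: "\<And>\<gamma> \<tau>. \<gamma> \<in> G \<Longrightarrow> 0 < Im \<tau> \<Longrightarrow> slash (- int w) \<gamma> f \<tau> = f \<tau>"
    and cusp: "\<And>B \<sigma> h. B \<in> G \<Longrightarrow> det \<sigma> = 1 \<Longrightarrow> h \<noteq> 0 \<Longrightarrow> adj \<sigma> ** B ** \<sigma> = mat2 1 h 0 1 \<Longrightarrow>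
      \<exists>Y>0. \<exists>C. \<forall>\<tau>. Re \<tau> \<in> {0..\<bar>h\<bar>} \<and> Im \<tau> > Y \<longrightarrow> cmod (slash (- int w) \<sigma> f \<tau>) \<le> C"
    and t: "0 < Im \<tau>0"
  shows "f \<tau>0 = 0"
proof (rule ccontr)
  assume nz: "f \<tau>0 \<noteq> 0"
  have pinv: "petersson w f (mob \<gamma> \<tau>) = petersson w f \<tau>" if "\<gamma> \<in> G" "0 < Im \<tau>" for \<gamma> \<tau>
    using petersson_slash[OF det_G[OF that(1)] that(2), of w f] inv[OF that] by (simp add: petersson_def)
  from thick_part_compact_mod_G[OF F cover, of "1/8"] obtain K where
    K: "compact K" "K \<subseteq> upper_half_plane" "\<forall>\<tau>. thick (1/8) \<tau> \<longrightarrow> (\<exists>\<gamma>\<in>G. mob \<gamma> \<tau> \<in> K)"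
    by auto
  have K': "compact (insert \<tau>0 K)" "insert \<tau>0 K \<subseteq> upper_half_plane" "insert \<tau>0 K \<noteq> {}"
    using K t by (auto simp: upper_half_plane_def intro: compact_insert)
  from continuous_attains_sup[OF K'(1,3) continuous_on_subset[OF continuous_on_petersson[OF f] K'(2)]]
  obtain z where z: "z \<in> insert \<tau>0 K" "\<forall>u\<in>insert \<tau>0 K. petersson w f u \<le> petersson w f z" by (rule bexE)
  define M where "M = petersson w f z"
  have zH: "0 < Im z" using z(1) K'(2) by (auto simp: upper_half_plane_def)
  have "0 < petersson w f \<tau>0" using nz t by (simp add: petersson_def)
  also have "\<dots> \<le> M" using z(2) by (simp add: M_def)
  finally have M: "0 < M" .
  have thick_le: "petersson w f \<tau> \<le> M" if "thick (1/8) \<tau>" for \<tau>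
  proof -
    from K(3)[rule_format, OF that] obtain \<gamma> where "\<gamma> \<in> G" "mob \<gamma> \<tau> \<in> K" by (rule bexE)
    moreover have "0 < Im \<tau>" using that by (simp add: thick_def)
    ultimately show ?thesis using pinv[of \<gamma> \<tau>] z(2) unfolding M_def by (metis insertI2)
  qed
  have all_le: "petersson w f \<tau> \<le> M" if tt: "0 < Im \<tau>" for \<tau>
  proof (cases "thick (1/8) \<tau>")
    case False
    from thin_component[OF tt _ _ False] obtain B where
      B: "B \<in> G" "B \<noteq> mat 1" "B \<noteq> - mat 1" "displacement B \<tau> < 1/8"
      and bd: "\<forall>\<tau>1. 0 < Im \<tau>1 \<longrightarrow> displacement B \<tau>1 = 1/8 \<longrightarrow> thick (1/8) \<tau>1" by auto
    show ?thesis
      by (rule petersson_le_on_thin_component[OF f w B(1,2,3) M _ _ pinv[OF B(1)] cusp[OF B(1)] _ tt, of "1/8"])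
         (use B(4) bd thick_le in auto)
  qed (rule thick_le)
  have "f z = 0"
    by (rule petersson_no_local_max[OF f w open_upper_half_plane subset_refl])
       (use zH all_le in \<open>auto simp: upper_half_plane_def M_def\<close>)
  then show False using M w by (simp add: M_def petersson_def)
qed

end

section \<open>Fuchsian groups of the first kind, the slash operator and growth at cusps\<close>

lemma minus_mat_1_mult: "(- mat 1) ** A = - (A :: real^2^2)" "A ** (- mat 1) = - (A :: real^2^2)"
  by (simp_all add: mat2_eq_iff)

lemma group_SL2R: "group SL2R"
proof (rule groupI)
  fix x assume "x \<in> carrier SL2R"
  then have "adj x \<in> carrier SL2R \<and> adj x \<otimes>\<^bsub>SL2R\<^esub> x = \<one>\<^bsub>SL2R\<^esub>"
    by (simp add: SL2R_def mult_adj)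
  then show "\<exists>y\<in>carrier SL2R. y \<otimes>\<^bsub>SL2R\<^esub> x = \<one>\<^bsub>SL2R\<^esub>" by blast
qed (simp_all add: SL2R_def det_mul matrix_mul_assoc)

lemma inv_SL2R: "det A = 1 \<Longrightarrow> inv\<^bsub>SL2R\<^esub> A = adj A"
  by (rule group.inv_equality[OF group_SL2R]) (simp_all add: SL2R_def mult_adj)

lemma normal_center: "{mat 1, - mat 1} \<lhd> SL2R"
  unfolding group.normal_inv_iff[OF group_SL2R]
proof (intro conjI ballI)
  have d: "det (- mat 1 :: real^2^2) = 1" by (simp add: det_2)
  show "subgroup {mat 1, - mat 1} SL2R"
  proof (rule group.subgroupI[OF group_SL2R])
    have "adj (- mat 1) = - mat 1" by (simp add: mat2_eq_iff)
    then show "inv\<^bsub>SL2R\<^esub> a \<in> {mat 1, - mat 1}" if "a \<in> {mat 1, - mat 1}" for a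
      using that d inv_SL2R by auto
  qed (use d in \<open>auto simp: SL2R_def minus_mat_1_mult\<close>)
  fix x h assume x: "x \<in> carrier SL2R" and h: "h \<in> {mat 1, - mat 1 :: real^2^2}"
  then have dx: "det x = 1" by (simp add: SL2R_def)
  have "x ** (- mat 1) ** adj x = - (x ** adj x)" by (simp add: mat2_eq_iff)
  then have "x ** h ** adj x \<in> {mat 1, - mat 1}" using h mult_adj(1)[OF dx] by auto
  then show "x \<otimes>\<^bsub>SL2R\<^esub> h \<otimes>\<^bsub>SL2R\<^esub> inv\<^bsub>SL2R\<^esub> x \<in> {mat 1, - mat 1}"
    unfolding inv_SL2R[OF dx] by (simp add: SL2R_def)
qed

text \<open>The members of \<open>\<Gamma>\<close> are cosets \<open>{A, -A}\<close>; the group laws pass to their union, and a neighbourhood that isolates \<open>mat 1\<close>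
  contains a ball.\<close>

lemma discrete_group_lift:
  assumes sub: "subgroup \<Gamma> PSL2R" and disc: "discrete (lift \<Gamma>)"
  shows "discrete_group (lift \<Gamma>)"
proof
  have carr: "C \<in> carrier (SL2R Mod {mat 1, - mat 1})" if "C \<in> \<Gamma>" for C
    using subgroup.subset[OF sub] that by (auto simp: PSL2R_def)
  show det1: "det \<gamma> = 1" if "\<gamma> \<in> lift \<Gamma>" for \<gamma>
  proof -
    from that obtain C where C: "C \<in> \<Gamma>" "\<gamma> \<in> C" unfolding lift_def by (rule UnionE)
    from carr[OF C(1)] have "C \<in> (\<Union>a\<in>carrier SL2R. {{mat 1, - mat 1} #>\<^bsub>SL2R\<^esub> a})"
      by (simp add: FactGroup_def RCOSETS_def)
    then obtain a where a: "a \<in> carrier SL2R" "C = {mat 1, - mat 1} #>\<^bsub>SL2R\<^esub> a" by blast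
    then have "\<gamma> = mat 1 ** a \<or> \<gamma> = (- mat 1) ** a" using C(2) by (simp add: r_coset_def SL2R_def) blast
    moreover have "det (- mat 1 :: real^2^2) = 1" by (simp add: det_2)
    ultimately show ?thesis using a(1) by (elim disjE) (simp_all only: det_mul, simp_all add: SL2R_def)
  qed
  show one: "mat 1 \<in> lift \<Gamma>"
    using subgroup.one_closed[OF sub] by (auto simp: lift_def PSL2R_def)
  show "\<gamma> ** \<delta> \<in> lift \<Gamma>" if "\<gamma> \<in> lift \<Gamma>" "\<delta> \<in> lift \<Gamma>" for \<gamma> \<delta>
  proof -
    from that(1) obtain C where C: "C \<in> \<Gamma>" "\<gamma> \<in> C" unfolding lift_def by (rule UnionE)
    from that(2) obtain D where D: "D \<in> \<Gamma>" "\<delta> \<in> D" unfolding lift_def by (rule UnionE)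
    note C D
    moreover from C D have "C <#>\<^bsub>SL2R\<^esub> D \<in> \<Gamma>"
      using subgroup.m_closed[OF sub, of C D] by (simp add: PSL2R_def)
    moreover have "\<gamma> ** \<delta> = \<gamma> \<otimes>\<^bsub>SL2R\<^esub> \<delta>" by (simp add: SL2R_def)
    ultimately show ?thesis unfolding lift_def set_mult_def by blast
  qed
  show "adj \<gamma> \<in> lift \<Gamma>" if "\<gamma> \<in> lift \<Gamma>" for \<gamma>
  proof -
    from that obtain C where C: "C \<in> \<Gamma>" "\<gamma> \<in> C" unfolding lift_def by (rule UnionE)
    have "inv\<^bsub>SL2R Mod {mat 1, - mat 1}\<^esub> C \<in> \<Gamma>"
      using subgroup.m_inv_closed[OF sub C(1)] by (simp add: PSL2R_def)
    then have "set_inv\<^bsub>SL2R\<^esub> C \<in> \<Gamma>"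
      unfolding normal.inv_FactGroup[OF normal_center carr[OF C(1)]] .
    moreover have "adj \<gamma> \<in> set_inv\<^bsub>SL2R\<^esub> C"
      using C(2) inv_SL2R[OF det1[OF that]] by (force simp: SET_INV_def)
    ultimately show ?thesis by (auto simp: lift_def)
  qed
  obtain T where T: "open T" "T \<inter> lift \<Gamma> = {mat 1}"
    using discreteD[OF disc one] by (auto simp: isolated_in_def)
  then obtain e where e: "0 < e" "ball (mat 1) e \<subseteq> T" by (metis Int_iff insertI1 open_contains_ball)
  show "\<exists>e>0. \<forall>\<gamma>\<in>lift \<Gamma>. \<gamma> \<noteq> mat 1 \<longrightarrow> e \<le> norm (\<gamma> - mat 1)"
  proof (intro exI[of _ e] conjI e(1) ballI impI)
    fix \<gamma> assume g: "\<gamma> \<in> lift \<Gamma>" "\<gamma> \<noteq> mat 1"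
    then have "\<gamma> \<notin> ball (mat 1) e" using T(2) e(2) by blast
    then show "e \<le> norm (\<gamma> - mat 1)" by (simp add: dist_norm norm_minus_commute)
  qed
qed

text \<open>The first column of \<open>\<sigma>\<close> is fixed by \<open>B\<close>, because \<open>axis 1 1\<close> is fixed by the translation.\<close>

lemma cusp_of_parabolic:
  assumes B: "B \<in> lift \<Gamma>" "det B = 1" and s: "det \<sigma> = 1" and h: "h \<noteq> 0" and e: "adj \<sigma> ** B ** \<sigma> = mat2 1 h 0 1"
  shows "cusp \<Gamma> (\<sigma> *v axis 1 1)"
proof -
  have Bs: "B ** \<sigma> = \<sigma> ** mat2 1 h 0 1"
    unfolding e[symmetric] using mult_adj_assoc(1)[OF s, of "B ** \<sigma>"] by (simp only: matrix_mul_assoc)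
  have Be: "B = \<sigma> ** mat2 1 h 0 1 ** adj \<sigma>"
    unfolding Bs[symmetric] by (rule mult_adj_assoc(3)[OF s, symmetric])
  have "(adj \<sigma> ** B ** \<sigma>)$1$1 + (adj \<sigma> ** B ** \<sigma>)$2$2 = (B$1$1 + B$2$2) * (\<sigma>$1$1 * \<sigma>$2$2 - \<sigma>$1$2 * \<sigma>$2$1)"
    by (simp add: algebra_simps)
  then have tr: "trace B = 2" unfolding e using det_one_entries[OF s] by (simp add: trace_2)
  have "B \<noteq> mat 1"
  proof
    assume "B = mat 1"
    then have "mat 1 = mat2 1 h 0 1" using e mult_adj(2)[OF s] by simp
    then show False using h by (simp add: mat2_eq_iff)
  qed
  moreover have "B \<noteq> - mat 1"
  proof
    assume "B = - mat 1"
    then show False using tr by (simp add: trace_2)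
  qed
  ultimately have par: "parabolic B" using B tr by (simp add: parabolic_def)
  have fix1: "mat2 1 h 0 1 *v axis 1 1 = (axis 1 1 :: real^2)"
    by (simp add: vec2_eq_iff matrix_vector_mult_def sum_2 axis_def)
  have "B *v (\<sigma> *v axis 1 1) = 1 *\<^sub>R (\<sigma> *v axis 1 1)"
    unfolding matrix_vector_mul_assoc Bs unfolding matrix_vector_mul_assoc[symmetric] fix1 by simp
  moreover have "\<sigma> *v axis 1 1 \<noteq> 0"
  proof
    assume "\<sigma> *v axis 1 1 = (0 :: real^2)"
    then have "(\<sigma> *v axis 1 1)$1 = 0" "(\<sigma> *v axis 1 1)$2 = 0" by simp_all
    then have "\<sigma>$1$1 = 0" "\<sigma>$2$1 = 0" by (simp_all add: matrix_vector_mult_def sum_2 axis_def)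
    then show False using det_one_entries[OF s] by simp
  qed
  ultimately show ?thesis unfolding cusp_def using B(1) par by blast
qed

lemma slash_mult:
  assumes "det A = 1" "det B = 1" "0 < Im \<tau>"
  shows "slash k (A ** B) f \<tau> = slash k B (slash k A f) \<tau>"
  unfolding slash_def j_mult[OF assms(2,3)] mob_mult[OF assms] by (simp add: power_int_mult_distrib)

lemma slash_times:
  assumes "det A = 1" "0 < Im \<tau>"
  shows "slash (k + l) A (\<lambda>\<tau>. f \<tau> * g \<tau>) \<tau> = slash k A f \<tau> * slash l A g \<tau>"
  using j_nonzero[OF assms] by (simp add: slash_def power_int_add[of "j A \<tau>" "- k" "- l", simplified])

lemma slash_power:
  assumes "det A = 1" "0 < Im \<tau>"
  shows "slash (k * int n) A (\<lambda>\<tau>. f \<tau> ^ n) \<tau> = slash k A f \<tau> ^ n"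
proof (induction n)
  case 0
  show ?case by (simp add: slash_def)
next
  case (Suc n)
  have "slash (k * int (Suc n)) A (\<lambda>\<tau>. f \<tau> ^ Suc n) \<tau> = slash (k + k * int n) A (\<lambda>\<tau>. f \<tau> * f \<tau> ^ n) \<tau>"
    by (simp add: algebra_simps)
  also have "\<dots> = slash k A f \<tau> * slash k A f \<tau> ^ n"
    unfolding slash_times[OF assms] Suc.IH ..
  finally show ?case by simp
qed

lemma slash_sum: "slash k A (\<lambda>\<tau>. \<Sum>i\<in>I. f i \<tau>) \<tau> = (\<Sum>i\<in>I. slash k A (f i) \<tau>)"
  by (simp add: slash_def sum_distrib_left)

lemma slash_add: "slash k A (\<lambda>\<tau>. f \<tau> + g \<tau>) \<tau> = slash k A f \<tau> + slash k A g \<tau>"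
  by (simp add: slash_def distrib_left)

lemma slash_cmult: "slash k A (\<lambda>\<tau>. c * f \<tau>) \<tau> = c * slash k A f \<tau>"
  by (simp add: slash_def)

lemma slash_cong:
  assumes "det A = 1" "0 < Im \<tau>" "\<And>\<tau>. \<tau> \<in> upper_half_plane \<Longrightarrow> f \<tau> = g \<tau>"
  shows "slash k A f \<tau> = slash k A g \<tau>"
  using assms(3)[of "mob A \<tau>"] Im_mob_pos[OF assms(1,2)] by (simp add: slash_def upper_half_plane_def)

lemma bounded_at_cuspsI:
  assumes "\<And>\<sigma> K. det \<sigma> = 1 \<Longrightarrow> cusp \<Gamma> (\<sigma> *v axis 1 1) \<Longrightarrow> compact K \<Longrightarrow>
     \<exists>Y>0. \<exists>B. \<forall>\<tau>. Re \<tau> \<in> K \<and> Im \<tau> > Y \<longrightarrow> cmod (slash k \<sigma> f \<tau>) \<le> B"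
  shows "bounded_at_cusps \<Gamma> k f"
  using assms unfolding bounded_at_cusps_def by (simp add: SL2R_def)

lemma bounded_at_cuspsE:
  assumes "bounded_at_cusps \<Gamma> k f" "det \<sigma> = 1" "cusp \<Gamma> (\<sigma> *v axis 1 1)" "compact K"
  shows "\<exists>Y>0. \<exists>B. \<forall>\<tau>. Re \<tau> \<in> K \<and> Im \<tau> > Y \<longrightarrow> cmod (slash k \<sigma> f \<tau>) \<le> B"
  using assms unfolding bounded_at_cusps_def by (simp add: SL2R_def)

lemma bounded_above_heightI:
  assumes "0 < Y" "\<And>\<tau>. Re \<tau> \<in> K \<Longrightarrow> Im \<tau> > Y \<Longrightarrow> cmod (F \<tau>) \<le> B"
  shows "\<exists>Y>0. \<exists>B. \<forall>\<tau>. Re \<tau> \<in> K \<and> Im \<tau> > Y \<longrightarrow> cmod (F \<tau>) \<le> B"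
  using assms by blast

lemma bounded_at_cusps_mult:
  assumes f: "bounded_at_cusps \<Gamma> k f" and g: "bounded_at_cusps \<Gamma> l g"
  shows "bounded_at_cusps \<Gamma> (k + l) (\<lambda>\<tau>. f \<tau> * g \<tau>)"
proof (rule bounded_at_cuspsI)
  fix \<sigma> :: "real^2^2" and K :: "real set" assume s: "det \<sigma> = 1" "cusp \<Gamma> (\<sigma> *v axis 1 1)" "compact K"
  from bounded_at_cuspsE[OF f s] obtain Y B where Y: "0 < Y" "\<forall>\<tau>. Re \<tau> \<in> K \<and> Im \<tau> > Y \<longrightarrow> cmod (slash k \<sigma> f \<tau>) \<le> B" by (elim exE conjE)
  from bounded_at_cuspsE[OF g s] obtain Z C where Z: "0 < Z" "\<forall>\<tau>. Re \<tau> \<in> K \<and> Im \<tau> > Z \<longrightarrow> cmod (slash l \<sigma> g \<tau>) \<le> C" by (elim exE conjE)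
  show "\<exists>Y>0. \<exists>B. \<forall>\<tau>. Re \<tau> \<in> K \<and> Im \<tau> > Y \<longrightarrow> cmod (slash (k + l) \<sigma> (\<lambda>\<tau>. f \<tau> * g \<tau>) \<tau>) \<le> B"
  proof (rule bounded_above_heightI[of "max Y Z" _ _ "B * C"])
    show "0 < max Y Z" using Y(1) by simp
    fix \<tau> assume t: "Re \<tau> \<in> K" "Im \<tau> > max Y Z"
    then have b: "cmod (slash k \<sigma> f \<tau>) \<le> B" "cmod (slash l \<sigma> g \<tau>) \<le> C" using Y Z by auto
    have p: "0 < Im \<tau>" using t Y(1) by simp
    have "cmod (slash k \<sigma> f \<tau>) * cmod (slash l \<sigma> g \<tau>) \<le> B * C"
      using b by (intro mult_mono order_trans[OF norm_ge_zero b(1)]) auto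
    then show "cmod (slash (k + l) \<sigma> (\<lambda>\<tau>. f \<tau> * g \<tau>) \<tau>) \<le> B * C"
      unfolding slash_times[OF s(1) p] norm_mult .
  qed
qed

lemma bounded_at_cusps_add:
  assumes f: "bounded_at_cusps \<Gamma> k f" and g: "bounded_at_cusps \<Gamma> k g"
  shows "bounded_at_cusps \<Gamma> k (\<lambda>\<tau>. f \<tau> + g \<tau>)"
proof (rule bounded_at_cuspsI)
  fix \<sigma> :: "real^2^2" and K :: "real set" assume s: "det \<sigma> = 1" "cusp \<Gamma> (\<sigma> *v axis 1 1)" "compact K"
  from bounded_at_cuspsE[OF f s] obtain Y B where Y: "0 < Y" "\<forall>\<tau>. Re \<tau> \<in> K \<and> Im \<tau> > Y \<longrightarrow> cmod (slash k \<sigma> f \<tau>) \<le> B" by (elim exE conjE)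
  from bounded_at_cuspsE[OF g s] obtain Z C where Z: "0 < Z" "\<forall>\<tau>. Re \<tau> \<in> K \<and> Im \<tau> > Z \<longrightarrow> cmod (slash k \<sigma> g \<tau>) \<le> C" by (elim exE conjE)
  show "\<exists>Y>0. \<exists>B. \<forall>\<tau>. Re \<tau> \<in> K \<and> Im \<tau> > Y \<longrightarrow> cmod (slash k \<sigma> (\<lambda>\<tau>. f \<tau> + g \<tau>) \<tau>) \<le> B"
  proof (rule bounded_above_heightI[of "max Y Z" _ _ "B + C"])
    show "0 < max Y Z" using Y(1) by simp
    fix \<tau> assume t: "Re \<tau> \<in> K" "Im \<tau> > max Y Z"
    then have b: "cmod (slash k \<sigma> f \<tau>) \<le> B" "cmod (slash k \<sigma> g \<tau>) \<le> C" using Y Z by auto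
    then show "cmod (slash k \<sigma> (\<lambda>\<tau>. f \<tau> + g \<tau>) \<tau>) \<le> B + C"
      unfolding slash_add using norm_triangle_ineq[of "slash k \<sigma> f \<tau>" "slash k \<sigma> g \<tau>"] by linarith
  qed
qed

lemma bounded_at_cusps_const: "bounded_at_cusps \<Gamma> 0 (\<lambda>\<tau>. c)"
proof (rule bounded_at_cuspsI)
  show "\<exists>Y>0. \<exists>B. \<forall>\<tau>. Re \<tau> \<in> K \<and> Im \<tau> > Y \<longrightarrow> cmod (slash 0 \<sigma> (\<lambda>\<tau>. c) \<tau>) \<le> B" for \<sigma> K
    by (rule bounded_above_heightI[of 1 _ _ "cmod c"]) (simp_all add: slash_def)
qed

lemma bounded_at_cusps_zero: "bounded_at_cusps \<Gamma> k (\<lambda>\<tau>. 0)"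
proof (rule bounded_at_cuspsI)
  show "\<exists>Y>0. \<exists>B. \<forall>\<tau>. Re \<tau> \<in> K \<and> Im \<tau> > Y \<longrightarrow> cmod (slash k \<sigma> (\<lambda>\<tau>. 0) \<tau>) \<le> B" for \<sigma> K
    by (rule bounded_above_heightI[of 1 _ _ 0]) (simp_all add: slash_def)
qed

lemma bounded_at_cusps_cmult: "bounded_at_cusps \<Gamma> k f \<Longrightarrow> bounded_at_cusps \<Gamma> k (\<lambda>\<tau>. c * f \<tau>)"
  using bounded_at_cusps_mult[OF bounded_at_cusps_const, of \<Gamma> k f c] by simp

lemma bounded_at_cusps_power: "bounded_at_cusps \<Gamma> k f \<Longrightarrow> bounded_at_cusps \<Gamma> (k * int n) (\<lambda>\<tau>. f \<tau> ^ n)"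
proof (induction n)
  case 0
  show ?case using bounded_at_cusps_const[of \<Gamma> 1] by simp
next
  case (Suc n)
  have "bounded_at_cusps \<Gamma> (k + k * int n) (\<lambda>\<tau>. f \<tau> * f \<tau> ^ n)"
    by (rule bounded_at_cusps_mult[OF Suc.prems Suc.IH[OF Suc.prems]])
  moreover have "k + k * int n = k * int (Suc n)" by (simp add: algebra_simps)
  ultimately show ?case by simp
qed

lemma bounded_at_cusps_sum:
  "finite I \<Longrightarrow> (\<And>i. i \<in> I \<Longrightarrow> bounded_at_cusps \<Gamma> k (f i)) \<Longrightarrow> bounded_at_cusps \<Gamma> k (\<lambda>\<tau>. \<Sum>i\<in>I. f i \<tau>)"
proof (induction rule: finite_induct)
  case empty
  show ?case using bounded_at_cusps_zero by simp
next
  case (insert x I)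
  have "bounded_at_cusps \<Gamma> k (\<lambda>\<tau>. f x \<tau> + (\<Sum>i\<in>I. f i \<tau>))"
    using insert by (intro bounded_at_cusps_add) simp_all
  then show ?case using insert.hyps by simp
qed

lemma bounded_at_cusps_cong:
  assumes f: "bounded_at_cusps \<Gamma> k f" and fg: "\<And>\<tau>. \<tau> \<in> upper_half_plane \<Longrightarrow> f \<tau> = g \<tau>"
  shows "bounded_at_cusps \<Gamma> k g"
proof (rule bounded_at_cuspsI)
  fix \<sigma> :: "real^2^2" and K :: "real set" assume s: "det \<sigma> = 1" "cusp \<Gamma> (\<sigma> *v axis 1 1)" "compact K"
  from bounded_at_cuspsE[OF f s] obtain Y B where Y: "0 < Y" "\<forall>\<tau>. Re \<tau> \<in> K \<and> Im \<tau> > Y \<longrightarrow> cmod (slash k \<sigma> f \<tau>) \<le> B" by (elim exE conjE)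
  show "\<exists>Y>0. \<exists>B. \<forall>\<tau>. Re \<tau> \<in> K \<and> Im \<tau> > Y \<longrightarrow> cmod (slash k \<sigma> g \<tau>) \<le> B"
  proof (rule bounded_above_heightI[of "Y" _ _ "B"])
    fix \<tau> assume t: "Re \<tau> \<in> K" "Im \<tau> > Y"
    then have "0 < Im \<tau>" using Y(1) by simp
    then have "slash k \<sigma> f \<tau> = slash k \<sigma> g \<tau>" by (rule slash_cong[OF s(1)]) (rule fg)
    moreover have "cmod (slash k \<sigma> f \<tau>) \<le> B" using Y(2) t by simp
    ultimately show "cmod (slash k \<sigma> g \<tau>) \<le> B" by simp
  qed (rule Y(1))
qed

section \<open>Spaces of quasimodular and modular forms\<close>

text \<open>A coefficient family extended by zero beyond the depth, so that families of different depths can be added and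
  convolved.\<close>

definition padded_coeffs :: "(real^2^2) set set \<Rightarrow> int \<Rightarrow> (complex \<Rightarrow> complex) \<Rightarrow> nat \<Rightarrow> (nat \<Rightarrow> complex \<Rightarrow> complex) \<Rightarrow> bool" where
  "padded_coeffs \<Gamma> k f s Q \<longleftrightarrow>
     (\<forall>\<tau>\<in>upper_half_plane. Q 0 \<tau> = f \<tau>) \<and> (\<forall>m. Q m holomorphic_on upper_half_plane) \<and>
     (\<forall>m. bounded_at_cusps \<Gamma> (k - 2 * int m) (Q m)) \<and> (\<forall>m>s. \<forall>\<tau>. Q m \<tau> = 0) \<and>
     (\<forall>\<gamma>\<in>lift \<Gamma>. \<forall>\<tau>\<in>upper_half_plane. slash k \<gamma> f \<tau> = (\<Sum>m\<le>s. X \<gamma> \<tau> ^ m * Q m \<tau>))"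

lemma padded_coeffsD:
  assumes "padded_coeffs \<Gamma> k f s Q"
  shows "\<And>\<tau>. \<tau> \<in> upper_half_plane \<Longrightarrow> Q 0 \<tau> = f \<tau>" "\<And>m. Q m holomorphic_on upper_half_plane"
    "\<And>m. bounded_at_cusps \<Gamma> (k - 2 * int m) (Q m)" "\<And>m \<tau>. s < m \<Longrightarrow> Q m \<tau> = 0"
    "\<And>\<gamma> \<tau>. \<gamma> \<in> lift \<Gamma> \<Longrightarrow> \<tau> \<in> upper_half_plane \<Longrightarrow> slash k \<gamma> f \<tau> = (\<Sum>m\<le>s. X \<gamma> \<tau> ^ m * Q m \<tau>)"
  using assms unfolding padded_coeffs_def by simp_all

lemma padded_coeffs_of_quasimodular:
  assumes "quasimodular_coeffs \<Gamma> k f s Q"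
  shows "padded_coeffs \<Gamma> k f s (\<lambda>m \<tau>. if m \<le> s then Q m \<tau> else 0)"
  unfolding padded_coeffs_def
proof (intro conjI allI ballI impI)
  fix m
  have "(\<lambda>\<tau>. if m \<le> s then Q m \<tau> else 0) = (if m \<le> s then Q m else (\<lambda>\<tau>. 0))" by simp
  moreover have "(if m \<le> s then Q m else (\<lambda>\<tau>. 0)) holomorphic_on upper_half_plane"
    using assms by (simp add: quasimodular_coeffs_def)
  moreover have "bounded_at_cusps \<Gamma> (k - 2 * int m) (if m \<le> s then Q m else (\<lambda>\<tau>. 0))"
    using assms bounded_at_cusps_zero by (simp add: quasimodular_coeffs_def)
  ultimately show "(\<lambda>\<tau>. if m \<le> s then Q m \<tau> else 0) holomorphic_on upper_half_plane"
    "bounded_at_cusps \<Gamma> (k - 2 * int m) (\<lambda>\<tau>. if m \<le> s then Q m \<tau> else 0)" by simp_all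
qed (use assms in \<open>simp_all add: quasimodular_coeffs_def\<close>)

lemma padded_coeffs_mono:
  assumes "padded_coeffs \<Gamma> k f s Q" "s \<le> t"
  shows "padded_coeffs \<Gamma> k f t Q"
proof -
  have "(\<Sum>m\<le>s. X \<gamma> \<tau> ^ m * Q m \<tau>) = (\<Sum>m\<le>t. X \<gamma> \<tau> ^ m * Q m \<tau>)" for \<gamma> \<tau>
    using assms(2) padded_coeffsD(4)[OF assms(1)] by (intro sum.mono_neutral_left) auto
  then show ?thesis using assms unfolding padded_coeffs_def by simp
qed

lemma Q_space_iff:
  "f \<in> Q_space \<Gamma> k \<longleftrightarrow> (\<forall>\<tau>. \<tau> \<notin> upper_half_plane \<longrightarrow> f \<tau> = 0) \<and> f holomorphic_on upper_half_plane \<and>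
     (\<exists>s Q. padded_coeffs \<Gamma> k f s Q)"
proof -
  have "quasimodular_coeffs \<Gamma> k f s Q" if "padded_coeffs \<Gamma> k f s Q" for s Q
    using that by (simp add: quasimodular_coeffs_def padded_coeffs_def)
  then have "(\<exists>s Q. quasimodular_coeffs \<Gamma> k f s Q) \<longleftrightarrow> (\<exists>s Q. padded_coeffs \<Gamma> k f s Q)"
    by (intro iffI; elim exE) (intro exI, erule padded_coeffs_of_quasimodular, intro exI, assumption)
  then show ?thesis by (simp add: Q_space_def)
qed

lemma Q_spaceE:
  assumes "f \<in> Q_space \<Gamma> k"
  obtains s Q where "padded_coeffs \<Gamma> k f s Q" "f holomorphic_on upper_half_plane" "\<And>\<tau>. \<tau> \<notin> upper_half_plane \<Longrightarrow> f \<tau> = 0"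
  using assms unfolding Q_space_iff by blast

lemma Q_spaceI:
  assumes "padded_coeffs \<Gamma> k f s Q" "f holomorphic_on upper_half_plane" "\<And>\<tau>. \<tau> \<notin> upper_half_plane \<Longrightarrow> f \<tau> = 0"
  shows "f \<in> Q_space \<Gamma> k"
  using assms unfolding Q_space_iff by blast

lemma Q_space_outside: "f \<in> Q_space \<Gamma> k \<Longrightarrow> \<tau> \<notin> upper_half_plane \<Longrightarrow> f \<tau> = 0"
  by (simp add: Q_space_def)

text \<open>For an invariant function the one-term family consisting of the function itself is a coefficient family; in
  general \<open>f\<close> inherits its growth from \<open>Q 0\<close>.\<close>

lemma M_space_iff:
  "f \<in> M_space \<Gamma> k \<longleftrightarrow> (\<forall>\<tau>. \<tau> \<notin> upper_half_plane \<longrightarrow> f \<tau> = 0) \<and> f holomorphic_on upper_half_plane \<and>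
     bounded_at_cusps \<Gamma> k f \<and> (\<forall>\<gamma>\<in>lift \<Gamma>. \<forall>\<tau>\<in>upper_half_plane. slash k \<gamma> f \<tau> = f \<tau>)" (is "?L \<longleftrightarrow> ?R")
proof
  assume L: ?L
  then have "f \<in> Q_space \<Gamma> k" by (simp add: M_space_def)
  then obtain s Q where Q: "padded_coeffs \<Gamma> k f s Q" "f holomorphic_on upper_half_plane" "\<And>\<tau>. \<tau> \<notin> upper_half_plane \<Longrightarrow> f \<tau> = 0"
    by (rule Q_spaceE) blast
  have "bounded_at_cusps \<Gamma> k (Q 0)" using padded_coeffsD(3)[OF Q(1), of 0] by simp
  then have "bounded_at_cusps \<Gamma> k f" by (rule bounded_at_cusps_cong) (rule padded_coeffsD(1)[OF Q(1)])
  then show ?R using Q(2,3) L by (simp add: M_space_def)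
next
  assume R: ?R
  have "padded_coeffs \<Gamma> k f 0 (\<lambda>m \<tau>. if m \<le> 0 then (\<lambda>_::nat. f) m \<tau> else 0)"
    by (rule padded_coeffs_of_quasimodular) (use R in \<open>simp add: quasimodular_coeffs_def\<close>)
  then have "f \<in> Q_space \<Gamma> k" by (rule Q_spaceI) (use R in simp_all)
  then show ?L using R by (simp add: M_space_def)
qed

lemma M_space_outside: "f \<in> M_space \<Gamma> k \<Longrightarrow> \<tau> \<notin> upper_half_plane \<Longrightarrow> f \<tau> = 0"
  by (simp add: M_space_iff)

lemma M_space_subset_Q_space: "M_space \<Gamma> k \<subseteq> Q_space \<Gamma> k"
  by (auto simp: M_space_def)

lemma Q_space_zero: "(\<lambda>\<tau>. 0) \<in> Q_space \<Gamma> k" and M_space_zero: "(\<lambda>\<tau>. 0) \<in> M_space \<Gamma> k"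
proof -
  show "(\<lambda>\<tau>. 0) \<in> M_space \<Gamma> k"
    unfolding M_space_iff by (simp add: bounded_at_cusps_zero slash_def)
  then show "(\<lambda>\<tau>. 0) \<in> Q_space \<Gamma> k" using M_space_subset_Q_space by blast
qed

lemma Q_space_add:
  assumes "f \<in> Q_space \<Gamma> k" "g \<in> Q_space \<Gamma> k"
  shows "(\<lambda>\<tau>. f \<tau> + g \<tau>) \<in> Q_space \<Gamma> k"
proof -
  obtain s Q where Q: "padded_coeffs \<Gamma> k f s Q" "f holomorphic_on upper_half_plane" "\<And>\<tau>. \<tau> \<notin> upper_half_plane \<Longrightarrow> f \<tau> = 0"
    using assms(1) by (rule Q_spaceE) blast
  obtain t R where R: "padded_coeffs \<Gamma> k g t R" "g holomorphic_on upper_half_plane" "\<And>\<tau>. \<tau> \<notin> upper_half_plane \<Longrightarrow> g \<tau> = 0"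
    using assms(2) by (rule Q_spaceE) blast
  note Q' = padded_coeffsD[OF padded_coeffs_mono[OF Q(1) max.cobounded1[of s t]]]
  note R' = padded_coeffsD[OF padded_coeffs_mono[OF R(1) max.cobounded2[of t s]]]
  have "padded_coeffs \<Gamma> k (\<lambda>\<tau>. f \<tau> + g \<tau>) (max s t) (\<lambda>m \<tau>. Q m \<tau> + R m \<tau>)"
    unfolding padded_coeffs_def
    by (intro conjI allI ballI impI holomorphic_intros Q'(2) R'(2) bounded_at_cusps_add Q'(3) R'(3))
       (simp_all add: Q' R' slash_add distrib_left sum.distrib)
  then show ?thesis by (rule Q_spaceI) (use Q R in \<open>auto intro: holomorphic_intros\<close>)
qed

lemma Q_space_cmult:
  assumes "f \<in> Q_space \<Gamma> k"
  shows "(\<lambda>\<tau>. c * f \<tau>) \<in> Q_space \<Gamma> k"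
proof -
  obtain s Q where Q: "padded_coeffs \<Gamma> k f s Q" "f holomorphic_on upper_half_plane" "\<And>\<tau>. \<tau> \<notin> upper_half_plane \<Longrightarrow> f \<tau> = 0"
    using assms(1) by (rule Q_spaceE) blast
  note Q' = padded_coeffsD[OF Q(1)]
  have "padded_coeffs \<Gamma> k (\<lambda>\<tau>. c * f \<tau>) s (\<lambda>m \<tau>. c * Q m \<tau>)"
    unfolding padded_coeffs_def
    by (intro conjI allI ballI impI holomorphic_intros Q'(2) bounded_at_cusps_cmult Q'(3))
       (simp_all add: Q' slash_cmult sum_distrib_left mult_ac)
  then show ?thesis by (rule Q_spaceI) (use Q in \<open>auto intro: holomorphic_intros\<close>)
qed

lemma M_space_add:
  assumes "f \<in> M_space \<Gamma> k" "g \<in> M_space \<Gamma> k"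
  shows "(\<lambda>\<tau>. f \<tau> + g \<tau>) \<in> M_space \<Gamma> k"
  using assms unfolding M_space_iff by (auto simp: slash_add intro: holomorphic_intros bounded_at_cusps_add)

lemma M_space_cmult:
  assumes "f \<in> M_space \<Gamma> k"
  shows "(\<lambda>\<tau>. c * f \<tau>) \<in> M_space \<Gamma> k"
  using assms unfolding M_space_iff by (auto simp: slash_cmult intro: holomorphic_intros bounded_at_cusps_cmult)

locale fuchsian =
  fixes \<Gamma> :: "(real^2^2) set set"
  assumes fuchsian: "fuchsian_first_kind \<Gamma>"

sublocale fuchsian \<subseteq> discrete_group "lift \<Gamma>"
  using fuchsian discrete_group_lift unfolding fuchsian_first_kind_def by blast

context fuchsian
begin

lemma finite_area_cover:
  obtains F where "F \<subseteq> upper_half_plane" "F \<in> sets borel" "area F < \<infinity>"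
    "\<And>\<tau>. \<tau> \<in> upper_half_plane \<Longrightarrow> \<exists>\<gamma>\<in>lift \<Gamma>. mob \<gamma> \<tau> \<in> F"
  using fuchsian unfolding fuchsian_first_kind_def fundamental_domain_def area_def by blast

lemma infinite_X: "\<tau> \<in> upper_half_plane \<Longrightarrow> infinite ((\<lambda>\<gamma>. X \<gamma> \<tau>) ` lift \<Gamma>)"
  by (rule finite_area_cover) (rule infinite_X_values, simp_all add: upper_half_plane_def)

lemma M_space_negative:
  assumes f: "f \<in> M_space \<Gamma> k" and k: "k < 0"
  shows "f = (\<lambda>\<tau>. 0)"
proof (rule ext)
  fix \<tau>
  define w where "w = nat (- k)"
  have w: "0 < w" "k = - int w" using k by (simp_all add: w_def)
  note M = f[unfolded M_space_iff w(2)]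
  show "f \<tau> = 0"
  proof (cases "\<tau> \<in> upper_half_plane")
    case True
    obtain F where F: "F \<subseteq> upper_half_plane" "F \<in> sets borel" "area F < \<infinity>"
      "\<And>\<tau>. \<tau> \<in> upper_half_plane \<Longrightarrow> \<exists>\<gamma>\<in>lift \<Gamma>. mob \<gamma> \<tau> \<in> F"
      by (rule finite_area_cover) blast
    show ?thesis
    proof (rule negative_weight_vanishes[where f = f, OF F _ w(1)])
      show "f holomorphic_on upper_half_plane" using M by simp
      show "slash (- int w) \<gamma> f \<tau> = f \<tau>" if "\<gamma> \<in> lift \<Gamma>" "0 < Im \<tau>" for \<gamma> \<tau>
        using M that by (simp add: upper_half_plane_def)
      show "0 < Im \<tau>" using True by (simp add: upper_half_plane_def)
      fix B \<sigma> :: "real^2^2" and h :: real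
      assume B: "B \<in> lift \<Gamma>" "det \<sigma> = 1" "h \<noteq> 0" "adj \<sigma> ** B ** \<sigma> = mat2 1 h 0 1"
      have "cusp \<Gamma> (\<sigma> *v axis 1 1)" by (rule cusp_of_parabolic[OF B(1) det_G[OF B(1)] B(2,3,4)])
      moreover have "bounded_at_cusps \<Gamma> (- int w) f" using M by simp
      ultimately show "\<exists>Y>0. \<exists>C. \<forall>\<tau>. Re \<tau> \<in> {0..\<bar>h\<bar>} \<and> Im \<tau> > Y \<longrightarrow> cmod (slash (- int w) \<sigma> f \<tau>) \<le> C"
        using B(2) by (intro bounded_at_cuspsE) simp_all
    qed
  next
    case False
    then show ?thesis using M by simp
  qed
qed

text \<open>The transformation laws are polynomials in \<open>X \<gamma> \<tau>\<close>, so they multiply by convolution of coefficients.\<close>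

lemma Q_space_mult:
  assumes "f \<in> Q_space \<Gamma> k" "g \<in> Q_space \<Gamma> l"
  shows "(\<lambda>\<tau>. f \<tau> * g \<tau>) \<in> Q_space \<Gamma> (k + l)"
proof -
  obtain s Q where Q: "padded_coeffs \<Gamma> k f s Q" "f holomorphic_on upper_half_plane" "\<And>\<tau>. \<tau> \<notin> upper_half_plane \<Longrightarrow> f \<tau> = 0"
    using assms(1) by (rule Q_spaceE) blast
  obtain t R where R: "padded_coeffs \<Gamma> l g t R" "g holomorphic_on upper_half_plane" "\<And>\<tau>. \<tau> \<notin> upper_half_plane \<Longrightarrow> g \<tau> = 0"
    using assms(2) by (rule Q_spaceE) blast
  note Q' = padded_coeffsD[OF Q(1)] and R' = padded_coeffsD[OF R(1)]
  have "padded_coeffs \<Gamma> (k + l) (\<lambda>\<tau>. f \<tau> * g \<tau>) (s + t) (\<lambda>m \<tau>. \<Sum>i\<le>m. Q i \<tau> * R (m - i) \<tau>)"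
    unfolding padded_coeffs_def
  proof (intro conjI allI ballI impI)
    fix m
    show "(\<lambda>\<tau>. \<Sum>i\<le>m. Q i \<tau> * R (m - i) \<tau>) holomorphic_on upper_half_plane"
      by (intro holomorphic_intros Q'(2) R'(2))
    show "bounded_at_cusps \<Gamma> (k + l - 2 * int m) (\<lambda>\<tau>. \<Sum>i\<le>m. Q i \<tau> * R (m - i) \<tau>)"
    proof (rule bounded_at_cusps_sum)
      fix i assume "i \<in> {..m}"
      then have e: "(k - 2 * int i) + (l - 2 * int (m - i)) = k + l - 2 * int m" by (simp add: of_nat_diff)
      show "bounded_at_cusps \<Gamma> (k + l - 2 * int m) (\<lambda>\<tau>. Q i \<tau> * R (m - i) \<tau>)"
        using bounded_at_cusps_mult[OF Q'(3)[of i] R'(3)[of "m - i"]] unfolding e .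
    qed simp
    fix \<tau> assume m: "s + t < m"
    have "Q i \<tau> * R (m - i) \<tau> = 0" for i
    proof (cases "s < i")
      case True
      then show ?thesis by (simp add: Q'(4))
    next
      case False
      then have "t < m - i" using m by linarith
      then show ?thesis by (simp add: R'(4))
    qed
    then show "(\<Sum>i\<le>m. Q i \<tau> * R (m - i) \<tau>) = 0" by (intro sum.neutral ballI)
  next
    fix \<tau> assume "\<tau> \<in> upper_half_plane"
    then show "(\<Sum>i\<le>0. Q i \<tau> * R (0 - i) \<tau>) = f \<tau> * g \<tau>" by (simp add: Q'(1) R'(1))
  next
    fix \<gamma> \<tau> assume g: "\<gamma> \<in> lift \<Gamma>" and t: "\<tau> \<in> upper_half_plane"
    have "slash (k + l) \<gamma> (\<lambda>\<tau>. f \<tau> * g \<tau>) \<tau> = (\<Sum>m\<le>s. Q m \<tau> * X \<gamma> \<tau> ^ m) * (\<Sum>m\<le>t. R m \<tau> * X \<gamma> \<tau> ^ m)"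
      using t by (simp add: slash_times[OF det_G[OF g]] Q'(5)[OF g t] R'(5)[OF g t] upper_half_plane_def mult.commute)
    also have "\<dots> = (\<Sum>m\<le>s + t. (\<Sum>i\<le>m. Q i \<tau> * R (m - i) \<tau>) * X \<gamma> \<tau> ^ m)"
      using Q'(4) R'(4) by (intro polynomial_product)
    finally show "slash (k + l) \<gamma> (\<lambda>\<tau>. f \<tau> * g \<tau>) \<tau> = (\<Sum>m\<le>s + t. X \<gamma> \<tau> ^ m * (\<Sum>i\<le>m. Q i \<tau> * R (m - i) \<tau>))"
      by (simp add: mult.commute)
  qed
  then show ?thesis by (rule Q_spaceI) (use Q R in \<open>auto intro: holomorphic_intros\<close>)
qed

lemma M_space_mult:
  assumes "f \<in> M_space \<Gamma> k" "g \<in> M_space \<Gamma> l"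
  shows "(\<lambda>\<tau>. f \<tau> * g \<tau>) \<in> M_space \<Gamma> (k + l)"
  unfolding M_space_iff
proof (intro conjI ballI allI impI)
  show "(\<lambda>\<tau>. f \<tau> * g \<tau>) holomorphic_on upper_half_plane"
    using assms unfolding M_space_iff by (intro holomorphic_intros) simp_all
  show "bounded_at_cusps \<Gamma> (k + l) (\<lambda>\<tau>. f \<tau> * g \<tau>)"
    using assms unfolding M_space_iff by (intro bounded_at_cusps_mult) simp_all
  show "slash (k + l) \<gamma> (\<lambda>\<tau>. f \<tau> * g \<tau>) \<tau> = f \<tau> * g \<tau>" if "\<gamma> \<in> lift \<Gamma>" "\<tau> \<in> upper_half_plane" for \<gamma> \<tau>
    using assms that unfolding M_space_iff by (simp add: slash_times[OF det_G] upper_half_plane_def)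
qed (use assms in \<open>simp add: M_space_iff\<close>)

lemma M_space_one: "(\<lambda>\<tau>. if \<tau> \<in> upper_half_plane then 1 else 0) \<in> M_space \<Gamma> 0"
  unfolding M_space_iff
proof (intro conjI ballI allI impI)
  have "(\<lambda>\<tau>. 1::complex) holomorphic_on upper_half_plane" by (intro holomorphic_intros)
  then show "(\<lambda>\<tau>. if \<tau> \<in> upper_half_plane then 1 else 0 :: complex) holomorphic_on upper_half_plane"
    by (rule holomorphic_transform) simp
  show "bounded_at_cusps \<Gamma> 0 (\<lambda>\<tau>. if \<tau> \<in> upper_half_plane then 1 else 0)"
    by (rule bounded_at_cusps_cong[OF bounded_at_cusps_const[of \<Gamma> 1]]) simp
  show "slash 0 \<gamma> (\<lambda>\<tau>. if \<tau> \<in> upper_half_plane then 1 else 0) \<tau> = (if \<tau> \<in> upper_half_plane then 1 else 0)"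
    if "\<gamma> \<in> lift \<Gamma>" "\<tau> \<in> upper_half_plane" for \<gamma> \<tau>
    using that Im_mob_pos[OF det_G[OF that(1)]] by (simp add: slash_def upper_half_plane_def)
qed simp

end

section \<open>Expansion in powers of E\<close>

locale weight2_generator = fuchsian +
  fixes E :: "complex \<Rightarrow> complex" and c :: complex
  assumes E_in_Q: "E \<in> Q_space \<Gamma> 2"
    and E_slash: "\<And>\<gamma> \<tau>. \<gamma> \<in> lift \<Gamma> \<Longrightarrow> \<tau> \<in> upper_half_plane \<Longrightarrow> slash 2 \<gamma> E \<tau> = E \<tau> + c * X \<gamma> \<tau>"
    and c_nonzero: "c \<noteq> 0"
begin

lemma E_outside: "\<tau> \<notin> upper_half_plane \<Longrightarrow> E \<tau> = 0"
  using E_in_Q by (rule Q_space_outside)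

lemma E_holomorphic: "E holomorphic_on upper_half_plane"
  using E_in_Q by (simp add: Q_space_def)

lemma E_bounded_at_cusps: "bounded_at_cusps \<Gamma> 2 E"
proof -
  obtain s Q where Q: "padded_coeffs \<Gamma> 2 E s Q"
    using E_in_Q by (rule Q_spaceE) blast
  have "bounded_at_cusps \<Gamma> 2 (Q 0)" using padded_coeffsD(3)[OF Q, of 0] by simp
  then show ?thesis by (rule bounded_at_cusps_cong) (rule padded_coeffsD(1)[OF Q])
qed

text \<open>The values \<open>E \<tau> + c * X \<gamma> \<tau>\<close> of \<open>slash 2 \<gamma> E \<tau>\<close> are infinitely many, too many for the roots of a nonzero polynomial.\<close>

lemma coefficients_vanish:
  assumes t: "\<tau> \<in> upper_half_plane"
    and zero: "\<And>\<gamma>. \<gamma> \<in> lift \<Gamma> \<Longrightarrow> (\<Sum>i\<le>n. a i * slash 2 \<gamma> E \<tau> ^ i) = 0" and i: "i \<le> n"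
  shows "a i = 0"
proof (rule ccontr)
  assume "a i \<noteq> 0"
  then have fin: "finite {z. (\<Sum>i\<le>n. a i * z ^ i) = 0}"
    unfolding polyfun_finite_roots using i by blast
  have "(\<lambda>x. E \<tau> + c * x) ` ((\<lambda>\<gamma>. X \<gamma> \<tau>) ` lift \<Gamma>) \<subseteq> {z. (\<Sum>i\<le>n. a i * z ^ i) = 0}"
  proof (unfold image_image, rule image_subsetI)
    fix \<gamma> assume "\<gamma> \<in> lift \<Gamma>"
    from zero[OF this] show "E \<tau> + c * X \<gamma> \<tau> \<in> {z. (\<Sum>i\<le>n. a i * z ^ i) = 0}"
      unfolding E_slash[OF \<open>\<gamma> \<in> lift \<Gamma>\<close> t] by simp
  qed
  then have "finite ((\<lambda>x. E \<tau> + c * x) ` ((\<lambda>\<gamma>. X \<gamma> \<tau>) ` lift \<Gamma>))" using fin by (rule finite_subset)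
  then have "finite ((\<lambda>\<gamma>. X \<gamma> \<tau>) ` lift \<Gamma>)"
    by (rule finite_imageD) (rule inj_onI, use c_nonzero in simp)
  then show False using infinite_X[OF t] by simp
qed

lemma slash_polynomial:
  assumes "det A = 1" "0 < Im \<tau>"
  shows "slash k A (\<lambda>\<tau>. \<Sum>i\<le>n. h i \<tau> * F \<tau> ^ i) \<tau> = (\<Sum>i\<le>n. slash (k - 2 * int i) A (h i) \<tau> * slash 2 A F \<tau> ^ i)"
  unfolding slash_sum
proof (rule sum.cong[OF refl])
  fix i
  have "slash ((k - 2 * int i) + 2 * int i) A (\<lambda>\<tau>. h i \<tau> * F \<tau> ^ i) \<tau> = slash (k - 2 * int i) A (h i) \<tau> * slash 2 A F \<tau> ^ i"
    unfolding slash_times[OF assms] slash_power[OF assms] ..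
  then show "slash k A (\<lambda>\<tau>. h i \<tau> * F \<tau> ^ i) \<tau> = slash (k - 2 * int i) A (h i) \<tau> * slash 2 A F \<tau> ^ i" by simp
qed

lemma Q_space_mult_power:
  assumes "h \<in> Q_space \<Gamma> l"
  shows "(\<lambda>\<tau>. h \<tau> * E \<tau> ^ i) \<in> Q_space \<Gamma> (l + 2 * int i)"
proof (induction i)
  case (Suc i)
  have "(\<lambda>\<tau>. (h \<tau> * E \<tau> ^ i) * E \<tau>) \<in> Q_space \<Gamma> ((l + 2 * int i) + 2)"
    by (rule Q_space_mult[OF Suc E_in_Q])
  then show ?case by (simp add: algebra_simps)
qed (use assms in simp)

lemma Q_space_sum:
  "finite I \<Longrightarrow> (\<And>i. i \<in> I \<Longrightarrow> f i \<in> Q_space \<Gamma> k) \<Longrightarrow> (\<lambda>\<tau>. \<Sum>i\<in>I. f i \<tau>) \<in> Q_space \<Gamma> k"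
proof (induction rule: finite_induct)
  case (insert x I)
  have "(\<lambda>\<tau>. f x \<tau> + (\<Sum>i\<in>I. f i \<tau>)) \<in> Q_space \<Gamma> k"
    using insert by (intro Q_space_add) simp_all
  then show ?case using insert.hyps by simp
qed (simp add: Q_space_zero)

lemma mult_map_in_Q_space:
  assumes "h \<in> M_sum \<Gamma> k J"
  shows "mult_map E J h \<in> Q_space \<Gamma> (int k)"
  unfolding mult_map_def
proof (rule Q_space_sum)
  fix i assume "i \<in> {..J}"
  then have "h i \<in> Q_space \<Gamma> (int k - 2 * int i)"
    using assms M_space_subset_Q_space by (auto simp: M_sum_def)
  from Q_space_mult_power[OF this, of i] show "(\<lambda>\<tau>. h i \<tau> * E \<tau> ^ i) \<in> Q_space \<Gamma> (int k)" by simp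
qed simp

lemma mult_map_injective: "inj_on (mult_map E J) (M_sum \<Gamma> k J)"
proof (rule inj_onI)
  fix h g assume h: "h \<in> M_sum \<Gamma> k J" and g: "g \<in> M_sum \<Gamma> k J" and e: "mult_map E J h = mult_map E J g"
  have "h i \<tau> = g i \<tau>" for i \<tau>
  proof (cases "i \<le> J \<and> \<tau> \<in> upper_half_plane")
    case True
    then have i: "i \<le> J" and t: "\<tau> \<in> upper_half_plane" by simp_all
    have val: "slash (int k) \<gamma> (mult_map E J u) \<tau> = (\<Sum>i\<le>J. u i \<tau> * slash 2 \<gamma> E \<tau> ^ i)"
      if "\<gamma> \<in> lift \<Gamma>" "u \<in> M_sum \<Gamma> k J" for \<gamma> u
    proof -
      have p: "0 < Im \<tau>" using t by (simp add: upper_half_plane_def)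
      have "slash (int k) \<gamma> (mult_map E J u) \<tau> = (\<Sum>i\<le>J. slash (int k - 2 * int i) \<gamma> (u i) \<tau> * slash 2 \<gamma> E \<tau> ^ i)"
        unfolding mult_map_def by (rule slash_polynomial[OF det_G[OF that(1)] p])
      also have "\<dots> = (\<Sum>i\<le>J. u i \<tau> * slash 2 \<gamma> E \<tau> ^ i)"
      proof (rule sum.cong[OF refl])
        fix i assume "i \<in> {..J}"
        then have "u i \<in> M_space \<Gamma> (int k - 2 * int i)" using that(2) by (simp add: M_sum_def)
        then show "slash (int k - 2 * int i) \<gamma> (u i) \<tau> * slash 2 \<gamma> E \<tau> ^ i = u i \<tau> * slash 2 \<gamma> E \<tau> ^ i"
          using that(1) t by (simp add: M_space_def)
      qed
      finally show ?thesis .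
    qed
    have "h i \<tau> - g i \<tau> = 0"
    proof (rule coefficients_vanish[OF t _ i])
      fix \<gamma> assume \<gamma>: "\<gamma> \<in> lift \<Gamma>"
      show "(\<Sum>i\<le>J. (h i \<tau> - g i \<tau>) * slash 2 \<gamma> E \<tau> ^ i) = 0"
        using val[OF \<gamma> h] val[OF \<gamma> g] e by (simp add: left_diff_distrib sum_subtractf)
    qed
    then show ?thesis by simp
  next
    case False
    have z: "u i \<tau> = 0" if "u \<in> M_sum \<Gamma> k J" for u
    proof (cases "i \<le> J")
      case True
      then have "u i \<in> Q_space \<Gamma> (int k - 2 * int i)" using that by (simp add: M_sum_def M_space_def)
      then show ?thesis using True False by (intro Q_space_outside) simp_all
    next
      case False
      then show ?thesis using that by (simp add: M_sum_def)
    qed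
    show ?thesis using z[OF h] z[OF g] by simp
  qed
  then show "h = g" by (intro ext)
qed

text \<open>\<open>H i\<close> is the coefficient of \<open>Z\<^sup>i\<close> in \<open>(\<Sum>m\<le>s. Q m * ((Z - E) / c)\<^sup>m)\<close>, so that substituting \<open>Z = E + c * X\<close> recovers the
  transformation law of \<open>f\<close>. Invariance of the \<open>h i\<close> follows by evaluating \<open>f\<close> slashed with \<open>\<gamma> \<delta>\<close> in two ways.\<close>

lemma E_expansion:
  assumes f: "f \<in> Q_space \<Gamma> k"
  shows "\<exists>s h. (\<forall>i. h i \<in> M_space \<Gamma> (k - 2 * int i)) \<and> (\<forall>\<tau>. f \<tau> = (\<Sum>i\<le>s. h i \<tau> * E \<tau> ^ i)) \<and> (\<forall>i>s. h i = (\<lambda>\<tau>. 0))"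
proof -
  obtain s Q where Q: "padded_coeffs \<Gamma> k f s Q" "f holomorphic_on upper_half_plane" "\<And>\<tau>. \<tau> \<notin> upper_half_plane \<Longrightarrow> f \<tau> = 0"
    using f by (rule Q_spaceE) blast
  note Q' = padded_coeffsD[OF Q(1)]
  define H where "H = (\<lambda>i \<tau>. \<Sum>m\<le>s. of_nat (m choose i) * (- E \<tau>) ^ (m - i) * (1 / c) ^ m * Q m \<tau>)"
  define h where "h = (\<lambda>i \<tau>. if \<tau> \<in> upper_half_plane then H i \<tau> else 0)"
  have expand: "(\<Sum>i\<le>s. H i \<tau> * (E \<tau> + c * x) ^ i) = (\<Sum>m\<le>s. x ^ m * Q m \<tau>)" for \<tau> x
  proof -
    let ?Z = "E \<tau> + c * x"
    have "(\<Sum>i\<le>s. H i \<tau> * ?Z ^ i) = (\<Sum>i\<le>s. \<Sum>m\<le>s. of_nat (m choose i) * ?Z ^ i * (- E \<tau>) ^ (m - i) * ((1 / c) ^ m * Q m \<tau>))"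
      unfolding H_def sum_distrib_right by (intro sum.cong refl) (simp add: mult_ac)
    also have "\<dots> = (\<Sum>m\<le>s. \<Sum>i\<le>s. of_nat (m choose i) * ?Z ^ i * (- E \<tau>) ^ (m - i) * ((1 / c) ^ m * Q m \<tau>))"
      by (rule sum.swap)
    also have "\<dots> = (\<Sum>m\<le>s. x ^ m * Q m \<tau>)"
    proof (rule sum.cong[OF refl])
      fix m assume m: "m \<in> {..s}"
      have "(\<Sum>i\<le>s. of_nat (m choose i) * ?Z ^ i * (- E \<tau>) ^ (m - i)) = (\<Sum>i\<le>m. of_nat (m choose i) * ?Z ^ i * (- E \<tau>) ^ (m - i))"
        using m by (intro sum.mono_neutral_right) (auto simp: binomial_eq_0)
      also have "\<dots> = (?Z + - E \<tau>) ^ m" by (rule binomial_ring[symmetric])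
      finally have "(\<Sum>i\<le>s. of_nat (m choose i) * ?Z ^ i * (- E \<tau>) ^ (m - i)) = (c * x) ^ m" by simp
      then show "(\<Sum>i\<le>s. of_nat (m choose i) * ?Z ^ i * (- E \<tau>) ^ (m - i) * ((1 / c) ^ m * Q m \<tau>)) = x ^ m * Q m \<tau>"
        unfolding sum_distrib_right[symmetric] using c_nonzero by (simp add: power_mult_distrib power_divide)
    qed
    finally show ?thesis .
  qed
  have f_slash: "slash k \<gamma> f \<tau> = (\<Sum>i\<le>s. h i \<tau> * slash 2 \<gamma> E \<tau> ^ i)" if "\<gamma> \<in> lift \<Gamma>" "\<tau> \<in> upper_half_plane" for \<gamma> \<tau>
    unfolding Q'(5)[OF that] E_slash[OF that] expand[symmetric] using that(2) by (simp add: h_def)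
  have h_zero: "h i = (\<lambda>\<tau>. 0)" if "s < i" for i
    using that by (intro ext) (simp add: h_def H_def binomial_eq_0)
  have h_M: "h i \<in> M_space \<Gamma> (k - 2 * int i)" for i
  proof (cases "i \<le> s")
    case False
    then show ?thesis using h_zero M_space_zero by simp
  next
    case True
    show ?thesis
      unfolding M_space_iff
    proof (intro conjI ballI allI impI)
      show "h i \<tau> = 0" if "\<tau> \<notin> upper_half_plane" for \<tau> using that by (simp add: h_def)
      have "H i holomorphic_on upper_half_plane"
        unfolding H_def by (intro holomorphic_intros E_holomorphic Q'(2))
      then show "h i holomorphic_on upper_half_plane"
        by (rule holomorphic_transform) (simp add: h_def)
      have "bounded_at_cusps \<Gamma> (k - 2 * int i) (H i)"
        unfolding H_def
      proof (rule bounded_at_cusps_sum)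
        fix m assume "m \<in> {..s}"
        show "bounded_at_cusps \<Gamma> (k - 2 * int i) (\<lambda>\<tau>. of_nat (m choose i) * (- E \<tau>) ^ (m - i) * (1 / c) ^ m * Q m \<tau>)"
        proof (cases "i \<le> m")
          case True
          then have e: "2 * int (m - i) + (k - 2 * int m) = k - 2 * int i" by (simp add: of_nat_diff)
          have "bounded_at_cusps \<Gamma> 2 (\<lambda>\<tau>. - E \<tau>)"
            using bounded_at_cusps_cmult[OF E_bounded_at_cusps, of "- 1"] by simp
          from bounded_at_cusps_mult[OF bounded_at_cusps_power[OF this, of "m - i"] Q'(3)[of m]]
          have "bounded_at_cusps \<Gamma> (k - 2 * int i) (\<lambda>\<tau>. (- E \<tau>) ^ (m - i) * Q m \<tau>)" unfolding e .
          from bounded_at_cusps_cmult[OF this, of "of_nat (m choose i) * (1 / c) ^ m"] show ?thesis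
            by (simp add: mult_ac)
        next
          case False
          then show ?thesis using bounded_at_cusps_zero by (simp add: binomial_eq_0)
        qed
      qed simp
      then show "bounded_at_cusps \<Gamma> (k - 2 * int i) (h i)"
        by (rule bounded_at_cusps_cong) (simp add: h_def)
    next
      fix \<delta> \<tau> assume \<delta>: "\<delta> \<in> lift \<Gamma>" and t: "\<tau> \<in> upper_half_plane"
      have p: "0 < Im \<tau>" using t by (simp add: upper_half_plane_def)
      have "slash (k - 2 * int i) \<delta> (h i) \<tau> - h i \<tau> = 0"
      proof (rule coefficients_vanish[OF t _ True])
        fix \<gamma>' assume g': "\<gamma>' \<in> lift \<Gamma>"
        \<comment> \<open>As \<open>\<gamma>\<close> runs through the group, so does \<open>\<gamma> \<delta>\<close>.\<close>
        define \<gamma> where "\<gamma> = \<gamma>' ** adj \<delta>"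
        have \<gamma>: "\<gamma> \<in> lift \<Gamma>" unfolding \<gamma>_def using g' \<delta> mult_G adj_G by simp
        have gd: "\<gamma> ** \<delta> = \<gamma>'" unfolding \<gamma>_def by (rule mult_adj_assoc(4)[OF det_G[OF \<delta>]])
        have "(\<Sum>i\<le>s. h i \<tau> * slash 2 \<gamma>' E \<tau> ^ i) = slash k (\<gamma> ** \<delta>) f \<tau>"
          unfolding gd by (rule f_slash[OF g' t, symmetric])
        also have "\<dots> = slash k \<delta> (slash k \<gamma> f) \<tau>" by (rule slash_mult[OF det_G[OF \<gamma>] det_G[OF \<delta>] p])
        also have "\<dots> = slash k \<delta> (\<lambda>\<tau>. \<Sum>i\<le>s. h i \<tau> * slash 2 \<gamma> E \<tau> ^ i) \<tau>"
          by (rule slash_cong[OF det_G[OF \<delta>] p]) (rule f_slash[OF \<gamma>])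
        also have "\<dots> = (\<Sum>i\<le>s. slash (k - 2 * int i) \<delta> (h i) \<tau> * slash 2 \<delta> (slash 2 \<gamma> E) \<tau> ^ i)"
          by (rule slash_polynomial[OF det_G[OF \<delta>] p])
        also have "slash 2 \<delta> (slash 2 \<gamma> E) \<tau> = slash 2 \<gamma>' E \<tau>"
          unfolding slash_mult[OF det_G[OF \<gamma>] det_G[OF \<delta>] p, symmetric] gd ..
        finally show "(\<Sum>i\<le>s. (slash (k - 2 * int i) \<delta> (h i) \<tau> - h i \<tau>) * slash 2 \<gamma>' E \<tau> ^ i) = 0"
          by (simp add: left_diff_distrib sum_subtractf)
      qed
      then show "slash (k - 2 * int i) \<delta> (h i) \<tau> = h i \<tau>" by simp
    qed
  qed
  have "f \<tau> = (\<Sum>i\<le>s. h i \<tau> * E \<tau> ^ i)" for \<tau>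
  proof (cases "\<tau> \<in> upper_half_plane")
    case True
    have "slash l (mat 1) u \<tau> = u \<tau>" for l u by (simp add: slash_def)
    then show ?thesis using f_slash[OF one_G True] by simp
  next
    case False
    then show ?thesis using Q(3) by (simp add: h_def)
  qed
  then show ?thesis using h_M h_zero by blast
qed

text \<open>In the expansion of \<open>f\<close> the coefficients beyond \<open>k div 2\<close> have negative weight.\<close>

lemma mult_map_surjective:
  assumes f: "f \<in> Q_space \<Gamma> (int k)" and J: "J = k div 2"
  shows "f \<in> mult_map E J ` M_sum \<Gamma> k J"
proof -
  obtain s h where h: "\<forall>i. h i \<in> M_space \<Gamma> (int k - 2 * int i)" "\<forall>\<tau>. f \<tau> = (\<Sum>i\<le>s. h i \<tau> * E \<tau> ^ i)" "\<forall>i>s. h i = (\<lambda>\<tau>. 0)"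
    using E_expansion[OF f] by (elim exE conjE)
  have hJ: "h i = (\<lambda>\<tau>. 0)" if "J < i" for i
  proof -
    have "int k - 2 * int i < 0" using that J by linarith
    then show ?thesis by (rule M_space_negative[OF spec[OF h(1), of i]])
  qed
  have "f = mult_map E J h"
  proof (rule ext)
    fix \<tau>
    have "f \<tau> = (\<Sum>i\<le>s. h i \<tau> * E \<tau> ^ i)" using h(2) by simp
    also have "\<dots> = (\<Sum>i\<le>max s J. h i \<tau> * E \<tau> ^ i)"
      using h(3) by (intro sum.mono_neutral_left) auto
    also have "\<dots> = (\<Sum>i\<le>J. h i \<tau> * E \<tau> ^ i)"
      using hJ by (intro sum.mono_neutral_right) auto
    finally show "f \<tau> = mult_map E J h \<tau>" by (simp add: mult_map_def)
  qed
  moreover have "h \<in> M_sum \<Gamma> k J" using h(1) hJ by (simp add: M_sum_def zero_fun_def)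
  ultimately show ?thesis by (rule image_eqI)
qed

lemma mult_map_bij:
  assumes J: "J = k div 2"
  shows "bij_betw (mult_map E J) (M_sum \<Gamma> k J) (Q_space \<Gamma> (int k))"
  unfolding bij_betw_def
proof (intro conjI mult_map_injective equalityI subsetI)
  fix f assume "f \<in> mult_map E J ` M_sum \<Gamma> k J"
  then show "f \<in> Q_space \<Gamma> (int k)" using mult_map_in_Q_space by blast
next
  fix f assume "f \<in> Q_space \<Gamma> (int k)"
  then show "f \<in> mult_map E J ` M_sum \<Gamma> k J" using J by (rule mult_map_surjective)
qed

end

lemma vector_space_fun_scale: "vector_space fun_scale"
  by unfold_locales (auto simp: fun_scale_def plus_fun_def algebra_simps)

lemma vector_space_fam_scale: "vector_space fam_scale"
  by unfold_locales (auto simp: fam_scale_def fun_scale_def plus_fun_def algebra_simps)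

lemma linear_mult_map: "Vector_Spaces.linear fam_scale fun_scale (mult_map E J)"
  by (intro Vector_Spaces.linear.intro module_hom.intro module_hom_axioms.intro
        vector_space_fun_scale vector_space_fam_scale vector_space_fun_scale[unfolded module_iff_vector_space[symmetric]]
        vector_space_fam_scale[unfolded module_iff_vector_space[symmetric]])
     (simp_all add: mult_map_def fam_scale_def fun_scale_def plus_fun_def algebra_simps sum.distrib sum_distrib_left)

lemma subspace_Q_space: "module.subspace fun_scale (Q_space \<Gamma> k)"
  unfolding module.subspace_def[OF vector_space_fun_scale[unfolded module_iff_vector_space[symmetric]]]
  using Q_space_zero Q_space_add Q_space_cmult by (simp add: zero_fun_def plus_fun_def fun_scale_def)

lemma subspace_M_sum: "module.subspace fam_scale (M_sum \<Gamma> k J)"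
  unfolding module.subspace_def[OF vector_space_fam_scale[unfolded module_iff_vector_space[symmetric]]]
  using M_space_zero M_space_add M_space_cmult
  by (simp add: M_sum_def zero_fun_def plus_fun_def fun_scale_def fam_scale_def)

section \<open>The graded rings\<close>

definition graded :: "(nat \<Rightarrow> (complex \<Rightarrow> complex) set) \<Rightarrow> (nat \<Rightarrow> complex \<Rightarrow> complex) set" where
  "graded V = {F. (\<forall>k. F k \<in> V k) \<and> finite {k. F k \<noteq> 0}}"

lemma gradedI:
  assumes "\<And>k. F k \<in> V k" "\<And>k. n < k \<Longrightarrow> F k = (\<lambda>\<tau>. 0)"
  shows "F \<in> graded V"
proof -
  have "{k. F k \<noteq> 0} \<subseteq> {..n}" using assms(2) by (force simp: zero_fun_def not_less[symmetric])
  then show ?thesis using assms(1) finite_subset unfolding graded_def by blast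
qed

lemma gradedE:
  assumes "F \<in> graded V"
  obtains n where "\<And>k \<tau>. n < k \<Longrightarrow> F k \<tau> = 0"
proof -
  have "finite {k. F k \<noteq> 0}" using assms by (simp add: graded_def)
  then obtain n where n: "\<forall>k\<in>{k. F k \<noteq> 0}. k \<le> n" unfolding finite_nat_set_iff_bounded_le by (rule exE)
  show thesis
  proof (rule that)
    fix k \<tau> assume "n < k"
    then have "F k = 0" using n by (force simp: not_less[symmetric])
    then show "F k \<tau> = 0" by simp
  qed
qed

lemma graded_in: "F \<in> graded V \<Longrightarrow> F k \<in> V k"
  by (simp add: graded_def)

text \<open>The closure properties shared by the quasimodular and the modular forms. \<open>V_outside\<close> makes the indicator of the
  half-plane a unit.\<close>

locale graded_algebra =
  fixes V :: "nat \<Rightarrow> (complex \<Rightarrow> complex) set"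
  assumes V_zero: "(\<lambda>\<tau>. 0) \<in> V k"
    and V_add: "f \<in> V k \<Longrightarrow> g \<in> V k \<Longrightarrow> (\<lambda>\<tau>. f \<tau> + g \<tau>) \<in> V k"
    and V_cmult: "f \<in> V k \<Longrightarrow> (\<lambda>\<tau>. c * f \<tau>) \<in> V k"
    and V_mult: "f \<in> V k \<Longrightarrow> g \<in> V l \<Longrightarrow> (\<lambda>\<tau>. f \<tau> * g \<tau>) \<in> V (k + l)"
    and V_one: "(\<lambda>\<tau>. if \<tau> \<in> upper_half_plane then 1 else 0) \<in> V 0"
    and V_outside: "f \<in> V k \<Longrightarrow> \<tau> \<notin> upper_half_plane \<Longrightarrow> f \<tau> = 0"
begin

lemma V_sum: "finite I \<Longrightarrow> (\<And>i. i \<in> I \<Longrightarrow> f i \<in> V k) \<Longrightarrow> (\<lambda>\<tau>. \<Sum>i\<in>I. f i \<tau>) \<in> V k"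
proof (induction rule: finite_induct)
  case (insert x I)
  have "(\<lambda>\<tau>. f x \<tau> + (\<Sum>i\<in>I. f i \<tau>)) \<in> V k"
    using insert by (intro V_add) simp_all
  then show ?case using insert.hyps by simp
qed (simp add: V_zero)

lemma graded_zero: "(\<lambda>n \<tau>. 0) \<in> graded V"
  by (rule gradedI[of _ _ 0]) (simp_all add: V_zero)

lemma graded_one: "(\<lambda>n \<tau>. if n = 0 \<and> \<tau> \<in> upper_half_plane then 1 else 0) \<in> graded V"
proof (rule gradedI[of _ _ 0])
  fix k :: nat
  show "(\<lambda>\<tau>. if k = 0 \<and> \<tau> \<in> upper_half_plane then 1 else 0) \<in> V k"
    using V_zero V_one by (cases "k = 0") simp_all
qed simp

lemma graded_add:
  assumes F: "F \<in> graded V" and G: "G \<in> graded V"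
  shows "(\<lambda>n \<tau>. F n \<tau> + G n \<tau>) \<in> graded V"
proof -
  obtain a where a: "\<And>k \<tau>. a < k \<Longrightarrow> F k \<tau> = 0" by (rule gradedE[OF F]) blast
  obtain b where b: "\<And>k \<tau>. b < k \<Longrightarrow> G k \<tau> = 0" by (rule gradedE[OF G]) blast
  show ?thesis
    by (rule gradedI[of _ _ "max a b"]) (simp_all add: V_add graded_in[OF F] graded_in[OF G] a b)
qed

lemma graded_uminus:
  assumes F: "F \<in> graded V"
  shows "(\<lambda>n \<tau>. - F n \<tau>) \<in> graded V"
proof -
  obtain a where a: "\<And>k \<tau>. a < k \<Longrightarrow> F k \<tau> = 0" by (rule gradedE[OF F]) blast
  show ?thesis
  proof (rule gradedI[of _ _ a])
    show "(\<lambda>\<tau>. - F k \<tau>) \<in> V k" for k using V_cmult[OF graded_in[OF F], of "- 1"] by simp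
  qed (simp add: a)
qed

lemma graded_mult:
  assumes F: "F \<in> graded V" and G: "G \<in> graded V"
  shows "(\<lambda>n \<tau>. \<Sum>i\<le>n. F i \<tau> * G (n - i) \<tau>) \<in> graded V"
proof -
  obtain a where a: "\<And>k \<tau>. a < k \<Longrightarrow> F k \<tau> = 0" by (rule gradedE[OF F]) blast
  obtain b where b: "\<And>k \<tau>. b < k \<Longrightarrow> G k \<tau> = 0" by (rule gradedE[OF G]) blast
  show ?thesis
  proof (rule gradedI[of _ _ "a + b"])
    fix k
    show "(\<lambda>\<tau>. \<Sum>i\<le>k. F i \<tau> * G (k - i) \<tau>) \<in> V k"
    proof (rule V_sum)
      fix i assume "i \<in> {..k}"
      then have "i + (k - i) = k" by simp
      then show "(\<lambda>\<tau>. F i \<tau> * G (k - i) \<tau>) \<in> V k"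
        using V_mult[OF graded_in[OF F, of i] graded_in[OF G, of "k - i"]] by simp
    qed simp
  next
    fix k assume k: "a + b < k"
    have "F i \<tau> * G (k - i) \<tau> = 0" for i \<tau>
    proof (cases "a < i")
      case False
      then have "b < k - i" using k by linarith
      then show ?thesis by (simp add: b)
    qed (simp add: a)
    then show "(\<lambda>\<tau>. \<Sum>i\<le>k. F i \<tau> * G (k - i) \<tau>) = (\<lambda>\<tau>. 0)" by (intro ext sum.neutral ballI)
  qed
qed

end

text \<open>At each point \<open>\<tau>\<close> a graded family becomes a formal power series, and convolution becomes the product of power
  series; the ring laws are inherited from there.\<close>

definition fps_at :: "(nat \<Rightarrow> complex \<Rightarrow> complex) \<Rightarrow> complex \<Rightarrow> complex fps" where
  "fps_at F \<tau> = Abs_fps (\<lambda>n. F n \<tau>)"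

lemma fps_at_ext: "(\<And>\<tau>. fps_at F \<tau> = fps_at G \<tau>) \<Longrightarrow> F = G"
proof (intro ext)
  fix n \<tau> assume "\<And>\<tau>. fps_at F \<tau> = fps_at G \<tau>"
  then have "fps_nth (fps_at F \<tau>) n = fps_nth (fps_at G \<tau>) n" by simp
  then show "F n \<tau> = G n \<tau>" by (simp add: fps_at_def)
qed

lemma Q_ring_simps:
  "carrier (Q_ring \<Gamma>) = graded (\<lambda>k. Q_space \<Gamma> (int k))"
  "F \<otimes>\<^bsub>Q_ring \<Gamma>\<^esub> G = (\<lambda>n \<tau>. \<Sum>i\<le>n. F i \<tau> * G (n - i) \<tau>)"
  "\<one>\<^bsub>Q_ring \<Gamma>\<^esub> = (\<lambda>n \<tau>. if n = 0 \<and> \<tau> \<in> upper_half_plane then 1 else 0)"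
  "\<zero>\<^bsub>Q_ring \<Gamma>\<^esub> = (\<lambda>n \<tau>. 0)"
  "F \<oplus>\<^bsub>Q_ring \<Gamma>\<^esub> G = (\<lambda>n \<tau>. F n \<tau> + G n \<tau>)"
  by (simp_all add: Q_ring_def graded_def)

lemma fps_at_mult: "fps_at (F \<otimes>\<^bsub>Q_ring \<Gamma>\<^esub> G) \<tau> = fps_at F \<tau> * fps_at G \<tau>"
  by (rule fps_ext) (simp add: fps_at_def fps_mult_nth atLeast0AtMost Q_ring_simps)

lemma fps_at_add: "fps_at (F \<oplus>\<^bsub>Q_ring \<Gamma>\<^esub> G) \<tau> = fps_at F \<tau> + fps_at G \<tau>"
  by (rule fps_ext) (simp add: fps_at_def Q_ring_simps)

lemma M_ring_carrier: "carrier (M_ring \<Gamma>) = graded (\<lambda>k. M_space \<Gamma> (int k))"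
  by (simp add: M_ring_def graded_def)

context fuchsian
begin

lemma graded_algebra_Q: "graded_algebra (\<lambda>k. Q_space \<Gamma> (int k))"
proof
  show "(\<lambda>\<tau>. f \<tau> * g \<tau>) \<in> Q_space \<Gamma> (int (k + l))" if "f \<in> Q_space \<Gamma> (int k)" "g \<in> Q_space \<Gamma> (int l)" for f g k l
    using Q_space_mult[OF that] by simp
  show "(\<lambda>\<tau>. if \<tau> \<in> upper_half_plane then 1 else 0) \<in> Q_space \<Gamma> (int 0)"
    using M_space_one M_space_subset_Q_space by auto
qed (simp_all add: Q_space_zero Q_space_add Q_space_cmult Q_space_outside)

lemma graded_algebra_M: "graded_algebra (\<lambda>k. M_space \<Gamma> (int k))"
proof
  show "(\<lambda>\<tau>. f \<tau> * g \<tau>) \<in> M_space \<Gamma> (int (k + l))" if "f \<in> M_space \<Gamma> (int k)" "g \<in> M_space \<Gamma> (int l)" for f g k l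
    using M_space_mult[OF that] by simp
qed (use M_space_one in \<open>simp_all add: M_space_zero M_space_add M_space_cmult M_space_outside\<close>)

lemma cring_Q_ring: "cring (Q_ring \<Gamma>)"
proof -
  interpret A: graded_algebra "\<lambda>k. Q_space \<Gamma> (int k)" by (rule graded_algebra_Q)
  have one: "fps_at \<one>\<^bsub>Q_ring \<Gamma>\<^esub> \<tau> * fps_at F \<tau> = fps_at F \<tau>"
    if "F \<in> carrier (Q_ring \<Gamma>)" for F \<tau>
  proof (cases "\<tau> \<in> upper_half_plane")
    case True
    then have "fps_at \<one>\<^bsub>Q_ring \<Gamma>\<^esub> \<tau> = 1"
      by (intro fps_ext) (simp add: fps_at_def Q_ring_simps)
    then show ?thesis by simp
  next
    case False
    then have "fps_at F \<tau> = 0"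
      using A.V_outside[OF graded_in[OF that[unfolded Q_ring_simps]]] by (intro fps_ext) (simp add: fps_at_def)
    then show ?thesis by simp
  qed
  show ?thesis
  proof (rule cringI)
    show "abelian_group (Q_ring \<Gamma>)"
    proof (rule abelian_groupI)
      fix F assume F: "F \<in> carrier (Q_ring \<Gamma>)"
      then have "(\<lambda>n \<tau>. - F n \<tau>) \<in> carrier (Q_ring \<Gamma>) \<and> (\<lambda>n \<tau>. - F n \<tau>) \<oplus>\<^bsub>Q_ring \<Gamma>\<^esub> F = \<zero>\<^bsub>Q_ring \<Gamma>\<^esub>"
        unfolding Q_ring_simps using A.graded_uminus by simp
      then show "\<exists>G\<in>carrier (Q_ring \<Gamma>). G \<oplus>\<^bsub>Q_ring \<Gamma>\<^esub> F = \<zero>\<^bsub>Q_ring \<Gamma>\<^esub>" by blast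
    qed (simp_all add: Q_ring_simps A.graded_add A.graded_zero add_ac)
    show "Group.comm_monoid (Q_ring \<Gamma>)"
    proof (rule comm_monoidI)
      fix F G K assume F: "F \<in> carrier (Q_ring \<Gamma>)" and G: "G \<in> carrier (Q_ring \<Gamma>)" and K: "K \<in> carrier (Q_ring \<Gamma>)"
      show "F \<otimes>\<^bsub>Q_ring \<Gamma>\<^esub> G \<in> carrier (Q_ring \<Gamma>)"
        using F G A.graded_mult by (simp add: Q_ring_simps)
      show "F \<otimes>\<^bsub>Q_ring \<Gamma>\<^esub> G \<otimes>\<^bsub>Q_ring \<Gamma>\<^esub> K = F \<otimes>\<^bsub>Q_ring \<Gamma>\<^esub> (G \<otimes>\<^bsub>Q_ring \<Gamma>\<^esub> K)"
        by (rule fps_at_ext) (simp only: fps_at_mult mult.assoc)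
      show "F \<otimes>\<^bsub>Q_ring \<Gamma>\<^esub> G = G \<otimes>\<^bsub>Q_ring \<Gamma>\<^esub> F"
        by (rule fps_at_ext) (simp only: fps_at_mult mult.commute)
      show "\<one>\<^bsub>Q_ring \<Gamma>\<^esub> \<otimes>\<^bsub>Q_ring \<Gamma>\<^esub> F = F"
        by (rule fps_at_ext) (use F one in \<open>simp only: fps_at_mult\<close>)
    qed (simp add: Q_ring_simps A.graded_one)
    fix F G K
    show "(F \<oplus>\<^bsub>Q_ring \<Gamma>\<^esub> G) \<otimes>\<^bsub>Q_ring \<Gamma>\<^esub> K = F \<otimes>\<^bsub>Q_ring \<Gamma>\<^esub> K \<oplus>\<^bsub>Q_ring \<Gamma>\<^esub> G \<otimes>\<^bsub>Q_ring \<Gamma>\<^esub> K"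
      by (rule fps_at_ext) (simp only: fps_at_mult fps_at_add distrib_right)
  qed
qed

lemma subcring_M_ring: "subcring (carrier (M_ring \<Gamma>)) (Q_ring \<Gamma>)"
proof -
  interpret Q: cring "Q_ring \<Gamma>" by (rule cring_Q_ring)
  interpret A: graded_algebra "\<lambda>k. M_space \<Gamma> (int k)" by (rule graded_algebra_M)
  have sub: "carrier (M_ring \<Gamma>) \<subseteq> carrier (Q_ring \<Gamma>)"
    unfolding M_ring_carrier Q_ring_simps graded_def using M_space_subset_Q_space by blast
  show ?thesis
  proof (rule Q.subcringI'[OF Q.subringI[OF sub]])
    show "\<one>\<^bsub>Q_ring \<Gamma>\<^esub> \<in> carrier (M_ring \<Gamma>)"
      unfolding M_ring_carrier Q_ring_simps by (rule A.graded_one)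
    fix F assume F: "F \<in> carrier (M_ring \<Gamma>)"
    then have m: "(\<lambda>n \<tau>. - F n \<tau>) \<in> carrier (M_ring \<Gamma>)" unfolding M_ring_carrier by (rule A.graded_uminus)
    have "\<ominus>\<^bsub>Q_ring \<Gamma>\<^esub> F = (\<lambda>n \<tau>. - F n \<tau>)"
      by (rule Q.minus_equality) (use F m sub in \<open>auto simp: Q_ring_simps(4,5)\<close>)
    then show "\<ominus>\<^bsub>Q_ring \<Gamma>\<^esub> F \<in> carrier (M_ring \<Gamma>)" using m by simp
    fix G assume G: "G \<in> carrier (M_ring \<Gamma>)"
    show "F \<otimes>\<^bsub>Q_ring \<Gamma>\<^esub> G \<in> carrier (M_ring \<Gamma>)" "F \<oplus>\<^bsub>Q_ring \<Gamma>\<^esub> G \<in> carrier (M_ring \<Gamma>)"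
      using F G A.graded_mult A.graded_add unfolding M_ring_carrier Q_ring_simps by blast+
  qed
qed

end

context weight2_generator
begin

lemma homogeneous_mult:
  "F \<otimes>\<^bsub>Q_ring \<Gamma>\<^esub> homogeneous d u = (\<lambda>n \<tau>. if d \<le> n then F (n - d) \<tau> * u \<tau> else 0)"
proof (intro ext)
  fix n \<tau>
  have "(\<Sum>i\<le>n. F i \<tau> * homogeneous d u (n - i) \<tau>) = (\<Sum>i\<in>{i. i \<le> n \<and> n - i = d}. F i \<tau> * u \<tau>)"
    by (rule sum.mono_neutral_cong_right) (auto simp: homogeneous_def)
  also have "{i. i \<le> n \<and> n - i = d} = (if d \<le> n then {n - d} else {})" by auto
  finally show "(F \<otimes>\<^bsub>Q_ring \<Gamma>\<^esub> homogeneous d u) n \<tau> = (if d \<le> n then F (n - d) \<tau> * u \<tau> else 0)"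
    by (simp add: Q_ring_simps)
qed

lemma E_in_Q_ring: "homogeneous 2 E \<in> carrier (Q_ring \<Gamma>)"
  unfolding Q_ring_simps
proof (rule gradedI[of _ _ 2])
  show "homogeneous 2 E k \<in> Q_space \<Gamma> (int k)" for k
    using E_in_Q Q_space_zero by (simp add: homogeneous_def zero_fun_def)
qed (simp add: homogeneous_def zero_fun_def)

lemma E_pow:
  "homogeneous 2 E [^]\<^bsub>Q_ring \<Gamma>\<^esub> (i::nat) = homogeneous (2 * i) (\<lambda>\<tau>. if \<tau> \<in> upper_half_plane then E \<tau> ^ i else 0)"
proof (induction i)
  case 0
  show ?case by (intro ext) (simp add: nat_pow_def Q_ring_simps homogeneous_def)
next
  case (Suc i)
  have "homogeneous 2 E [^]\<^bsub>Q_ring \<Gamma>\<^esub> Suc i = homogeneous (2 * i) (\<lambda>\<tau>. if \<tau> \<in> upper_half_plane then E \<tau> ^ i else 0) \<otimes>\<^bsub>Q_ring \<Gamma>\<^esub> homogeneous 2 E"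
    by (simp add: nat_pow_def Suc[unfolded nat_pow_def])
  also have "\<dots> = homogeneous (2 * Suc i) (\<lambda>\<tau>. if \<tau> \<in> upper_half_plane then E \<tau> ^ Suc i else 0)"
    unfolding homogeneous_mult by (intro ext) (auto simp: homogeneous_def E_outside)
  finally show ?case .
qed

lemma finsum_Q_ring:
  assumes "finite I" "\<And>i. i \<in> I \<Longrightarrow> F i \<in> carrier (Q_ring \<Gamma>)"
  shows "finsum (Q_ring \<Gamma>) F I = (\<lambda>n \<tau>. \<Sum>i\<in>I. F i n \<tau>)"
  using assms
proof (induction rule: finite_induct)
  interpret Q: cring "Q_ring \<Gamma>" by (rule cring_Q_ring)
  case empty
  show ?case by (simp add: Q_ring_simps)
next
  interpret Q: cring "Q_ring \<Gamma>" by (rule cring_Q_ring)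
  case (insert x I)
  have "finsum (Q_ring \<Gamma>) F (insert x I) = F x \<oplus>\<^bsub>Q_ring \<Gamma>\<^esub> finsum (Q_ring \<Gamma>) F I"
    by (rule Q.finsum_insert) (use insert in auto)
  also have "finsum (Q_ring \<Gamma>) F I = (\<lambda>n \<tau>. \<Sum>i\<in>I. F i n \<tau>)" using insert by simp
  finally show ?case using insert.hyps by (simp add: Q_ring_simps)
qed

text \<open>The component of weight \<open>n\<close> of \<open>(\<Sum>i. p i * E\<^sup>i)\<close> is \<open>mult_map E (n div 2)\<close> of the family \<open>i \<mapsto> p i (n - 2 * i)\<close>, called \<open>fam p n\<close>
  below. So evaluation is bijective because \<open>mult_map\<close> is bijective in every weight: the polynomial is recovered
  by \<open>p i m = fam p (m + 2 * i) i\<close>.\<close>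

theorem eval_ring_iso: "eval (M_ring \<Gamma>) (Q_ring \<Gamma>) id (homogeneous 2 E) \<in> ring_iso (UP (M_ring \<Gamma>)) (Q_ring \<Gamma>)"
proof -
  interpret Q: cring "Q_ring \<Gamma>" by (rule cring_Q_ring)
  have sub: "carrier (M_ring \<Gamma>) \<subseteq> carrier (Q_ring \<Gamma>)"
    unfolding M_ring_carrier Q_ring_simps graded_def using M_space_subset_Q_space by blast
  have M_eq: "M_ring \<Gamma> = Q_ring \<Gamma> \<lparr>carrier := carrier (M_ring \<Gamma>)\<rparr>" by (simp add: M_ring_def)
  have cM: "cring (M_ring \<Gamma>)"
    using Q.subcring_iff[OF sub] subcring_M_ring M_eq by simp
  interpret M: cring "M_ring \<Gamma>" by (rule cM)
  have M_ops: "F \<otimes>\<^bsub>M_ring \<Gamma>\<^esub> G = F \<otimes>\<^bsub>Q_ring \<Gamma>\<^esub> G" "F \<oplus>\<^bsub>M_ring \<Gamma>\<^esub> G = F \<oplus>\<^bsub>Q_ring \<Gamma>\<^esub> G"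
    "\<one>\<^bsub>M_ring \<Gamma>\<^esub> = \<one>\<^bsub>Q_ring \<Gamma>\<^esub>" "\<zero>\<^bsub>M_ring \<Gamma>\<^esub> = \<zero>\<^bsub>Q_ring \<Gamma>\<^esub>" for F G
    by (simp_all add: M_ring_def)
  have id_hom: "id \<in> ring_hom (M_ring \<Gamma>) (Q_ring \<Gamma>)"
    by (rule ring_hom_memI) (use sub M_ops in auto)
  interpret UP_pre_univ_prop "M_ring \<Gamma>" "Q_ring \<Gamma>" id "UP (M_ring \<Gamma>)"
    by unfold_locales (rule id_hom)
  let ?ev = "eval (M_ring \<Gamma>) (Q_ring \<Gamma>) id (homogeneous 2 E)"
  let ?P = "UP (M_ring \<Gamma>)"
  have hom: "?ev \<in> ring_hom ?P (Q_ring \<Gamma>)" by (rule eval_ring_hom[OF E_in_Q_ring])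
  define fam where "fam = (\<lambda>(p :: nat \<Rightarrow> nat \<Rightarrow> complex \<Rightarrow> complex) n i. if i \<le> n div 2 then p i (n - 2 * i) else 0)"
  have coeffM: "coeff ?P p i \<in> carrier (M_ring \<Gamma>)" if "p \<in> carrier ?P" for p i
    using that by simp
  have fam_M: "fam (coeff ?P p) n \<in> M_sum \<Gamma> n (n div 2)" if "p \<in> carrier ?P" for p n
  proof -
    have "fam (coeff ?P p) n i \<in> M_space \<Gamma> (int n - 2 * int i)" if i: "i \<le> n div 2" for i
    proof -
      have "int (n - 2 * i) = int n - 2 * int i" using i by (simp add: of_nat_diff)
      then show ?thesis using graded_in[OF coeffM[OF \<open>p \<in> carrier ?P\<close>, unfolded M_ring_carrier], of i "n - 2 * i"] i
        by (simp add: fam_def)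
    qed
    then show ?thesis by (simp add: M_sum_def fam_def)
  qed
  have ev_eq: "?ev p n = mult_map E (n div 2) (fam (coeff ?P p) n)" if p: "p \<in> carrier ?P" for p n
  proof (rule ext)
    fix \<tau>
    let ?D = "deg (M_ring \<Gamma>) p"
    have out: "coeff ?P p i m \<tau> = 0" if "\<tau> \<notin> upper_half_plane" for i m
      using graded_in[OF coeffM[OF p, unfolded M_ring_carrier], of i m] that by (simp add: M_space_iff)
    have above: "coeff ?P p i m \<tau> = 0" if "?D < i" for i m
      using deg_aboveD[OF that p] by (simp add: M_ops Q_ring_simps)
    have "?ev p = (\<Oplus>\<^bsub>Q_ring \<Gamma>\<^esub> i \<in> {..?D}. id (coeff ?P p i) \<otimes>\<^bsub>Q_ring \<Gamma>\<^esub> homogeneous 2 E [^]\<^bsub>Q_ring \<Gamma>\<^esub> i)"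
      by (rule eval_on_carrier[OF p])
    also have "\<dots> = (\<lambda>n \<tau>. \<Sum>i\<le>?D. (id (coeff ?P p i) \<otimes>\<^bsub>Q_ring \<Gamma>\<^esub> homogeneous 2 E [^]\<^bsub>Q_ring \<Gamma>\<^esub> i) n \<tau>)"
    proof (rule finsum_Q_ring)
      fix i
      have "coeff ?P p i \<in> carrier (Q_ring \<Gamma>)" using coeffM[OF p] sub by blast
      then show "id (coeff ?P p i) \<otimes>\<^bsub>Q_ring \<Gamma>\<^esub> homogeneous 2 E [^]\<^bsub>Q_ring \<Gamma>\<^esub> i \<in> carrier (Q_ring \<Gamma>)"
        using E_in_Q_ring by simp
    qed simp
    finally have "?ev p n \<tau> = (\<Sum>i\<le>?D. if 2 * i \<le> n then coeff ?P p i (n - 2 * i) \<tau> * (if \<tau> \<in> upper_half_plane then E \<tau> ^ i else 0) else 0)"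
      unfolding E_pow homogeneous_mult id_apply by simp
    also have "\<dots> = (\<Sum>i\<le>?D. fam (coeff ?P p) n i \<tau> * E \<tau> ^ i)"
      using out by (intro sum.cong refl) (auto simp: fam_def)
    also have "\<dots> = (\<Sum>i\<le>max ?D (n div 2). fam (coeff ?P p) n i \<tau> * E \<tau> ^ i)"
      using above by (intro sum.mono_neutral_left) (auto simp: fam_def)
    also have "\<dots> = (\<Sum>i\<le>n div 2. fam (coeff ?P p) n i \<tau> * E \<tau> ^ i)"
      by (intro sum.mono_neutral_right) (auto simp: fam_def)
    finally show "?ev p n \<tau> = mult_map E (n div 2) (fam (coeff ?P p) n) \<tau>" by (simp add: mult_map_def)
  qed
  have inj: "inj_on ?ev (carrier ?P)"
  proof (rule inj_onI)
    fix p q assume p: "p \<in> carrier ?P" and q: "q \<in> carrier ?P" and e: "?ev p = ?ev q"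
    show "p = q"
    proof (rule up_eqI[OF _ p q], rule ext)
      fix i m :: nat
      let ?n = "m + 2 * i"
      have "fam (coeff ?P p) ?n = fam (coeff ?P q) ?n"
        by (rule inj_onD[OF mult_map_injective _ fam_M[OF p] fam_M[OF q]])
           (simp only: ev_eq[OF p, symmetric] ev_eq[OF q, symmetric] e)
      then have "fam (coeff ?P p) ?n i = fam (coeff ?P q) ?n i" by simp
      then show "coeff ?P p i m = coeff ?P q i m" by (simp add: fam_def)
    qed
  qed
  have surj: "\<exists>p\<in>carrier ?P. ?ev p = F" if F: "F \<in> carrier (Q_ring \<Gamma>)" for F
  proof -
    have Fg: "F \<in> graded (\<lambda>k. Q_space \<Gamma> (int k))" using F by (simp add: Q_ring_simps)
    have "\<forall>n. \<exists>h. h \<in> M_sum \<Gamma> n (n div 2) \<and> F n = mult_map E (n div 2) h"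
      using mult_map_surjective[OF graded_in[OF Fg] refl] by blast
    then obtain h where h: "\<forall>n. h n \<in> M_sum \<Gamma> n (n div 2) \<and> F n = mult_map E (n div 2) (h n)" by (rule choice[THEN exE])
    obtain N where N: "\<And>k \<tau>. N < k \<Longrightarrow> F k \<tau> = 0" by (rule gradedE[OF Fg]) blast
    have zero_M: "(\<lambda>_. 0) \<in> M_sum \<Gamma> n (n div 2)" for n
      using M_space_zero by (simp add: M_sum_def zero_fun_def)
    have h0: "h n = (\<lambda>_. 0)" if "N < n" for n
    proof (rule inj_onD[OF mult_map_injective _ conjunct1[OF spec[OF h]] zero_M])
      have "F n = (\<lambda>\<tau>. 0)" using N[OF that] by (intro ext)
      then show "mult_map E (n div 2) (h n) = mult_map E (n div 2) (\<lambda>_. 0)"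
        using h by (simp add: mult_map_def)
    qed
    define p where "p = (\<lambda>i m. h (m + 2 * i) i)"
    have pM: "p i \<in> carrier (M_ring \<Gamma>)" for i
      unfolding M_ring_carrier
    proof (rule gradedI[of _ _ N])
      fix m
      have "h (m + 2 * i) \<in> M_sum \<Gamma> (m + 2 * i) ((m + 2 * i) div 2)" using h by blast
      moreover have "i \<le> (m + 2 * i) div 2" by simp
      ultimately have "h (m + 2 * i) i \<in> M_space \<Gamma> (int (m + 2 * i) - 2 * int i)"
        unfolding M_sum_def by blast
      then show "p i m \<in> M_space \<Gamma> (int m)" by (simp add: p_def)
    next
      fix m assume "N < m"
      then show "p i m = (\<lambda>\<tau>. 0)" using h0[of "m + 2 * i"] by (simp add: p_def zero_fun_def)
    qed
    have "p \<in> up (M_ring \<Gamma>)"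
    proof (rule mem_upI[OF pM])
      have "bound \<zero>\<^bsub>M_ring \<Gamma>\<^esub> N p"
      proof (rule bound.intro)
        fix i assume "N < i"
        then show "p i = \<zero>\<^bsub>M_ring \<Gamma>\<^esub>"
          unfolding M_ops Q_ring_simps p_def using h0 by (intro ext) simp
      qed
      then show "\<exists>n. bound \<zero>\<^bsub>M_ring \<Gamma>\<^esub> n p" by (rule exI)
    qed
    then have pP: "p \<in> carrier ?P" and cp: "coeff ?P p = p" by (simp_all add: UP_def)
    have "?ev p = F"
    proof (rule ext)
      fix n
      have "fam p n = h n"
      proof (rule ext)
        fix i
        show "fam p n i = h n i"
        proof (cases "i \<le> n div 2")
          case True
          then have "n - 2 * i + 2 * i = n" by linarith
          then show ?thesis using True by (simp add: fam_def p_def)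
        next
          case False
          then have "h n i = 0" using h unfolding M_sum_def by (simp add: not_le)
          then show ?thesis using False by (simp add: fam_def)
        qed
      qed
      then show "?ev p n = F n" unfolding ev_eq[OF pP] cp using h by simp
    qed
    then show ?thesis using pP by blast
  qed
  have "bij_betw ?ev (carrier ?P) (carrier (Q_ring \<Gamma>))"
    unfolding bij_betw_def
  proof (intro conjI inj equalityI subsetI)
    fix F assume "F \<in> ?ev ` carrier ?P"
    then show "F \<in> carrier (Q_ring \<Gamma>)" using ring_hom_closed[OF hom] by blast
  next
    fix F assume "F \<in> carrier (Q_ring \<Gamma>)"
    then show "F \<in> ?ev ` carrier ?P" using surj by blast
  qed
  then show ?thesis using hom by (simp add: ring_iso_def)
qed

end

theorem lemma2p8:
  fixes \<Gamma> :: "(real^2^2) set set"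
    and E :: "complex \<Rightarrow> complex"
    and Q :: "nat \<Rightarrow> complex \<Rightarrow> complex"
    and c :: complex
  assumes "fuchsian_first_kind \<Gamma>"
    and "E \<in> Q_space \<Gamma> 2"
    and "quasimodular_coeffs \<Gamma> 2 E 1 Q"
    and "\<forall>\<tau>\<in>upper_half_plane. Q 1 \<tau> = c"
    and "c \<noteq> 0"
  shows "(\<forall>k J :: nat. J = nat \<lfloor>real k / 2\<rfloor> \<longrightarrow>
            module.subspace fam_scale (M_sum \<Gamma> k J) \<and>
            module.subspace fun_scale (Q_space \<Gamma> (int k)) \<and>
            Vector_Spaces.linear fam_scale fun_scale (mult_map E J) \<and>
            bij_betw (mult_map E J) (M_sum \<Gamma> k J) (Q_space \<Gamma> (int k))) \<and>
         cring (Q_ring \<Gamma>) \<and>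
         subcring (carrier (M_ring \<Gamma>)) (Q_ring \<Gamma>) \<and>
         eval (M_ring \<Gamma>) (Q_ring \<Gamma>) id (homogeneous 2 E) \<in>
           ring_iso (UP (M_ring \<Gamma>)) (Q_ring \<Gamma>)"
proof -
  interpret weight2_generator \<Gamma> E c
  proof
    show "slash 2 \<gamma> E \<tau> = E \<tau> + c * X \<gamma> \<tau>" if "\<gamma> \<in> lift \<Gamma>" "\<tau> \<in> upper_half_plane" for \<gamma> \<tau>
      using assms(3,4) that by (simp add: quasimodular_coeffs_def mult.commute)
  qed (fact assms)+
  have "nat \<lfloor>real k / 2\<rfloor> = k div 2" for k :: nat
    using floor_divide_of_nat_eq[where 'a = real, of k 2] by simp
  then show ?thesis
    using subspace_M_sum subspace_Q_space linear_mult_map mult_map_bij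
      cring_Q_ring subcring_M_ring eval_ring_iso by simp
qed

end
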